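(* Let $n\ge2$, $s>\frac{n+1}2$ and $\theta\in(\frac12,1)$. Suppose $f$ and $g$ belong to the space $H^{s-1,1}_\theta$ on $\mathbb R^{1+n}$. Let $Q_0(f,g)=\partial_tf\,\partial_tg-\partial_{y_1}f\,\partial_{y_1}g$. Then $$\|Q_0(f,g)\|_{H^{s-1,0}_0}\lesssim |f|_{H^{s-1,1}_\theta}\,|g|_{H^{s-1,1}_\theta},$$ with an implicit constant independent of $f$ and $g$.
   Context: Points of $\mathbb R^{1+n}$ are $(t,\mathbf y)$, $\mathbf y=(y_1,\dots,y_n)$, with dual variables $(\tau,\xi)$, $\xi=(\xi_1,\dots,\xi_n)$; $\widetilde u(\tau,\xi)$ is the space-time Fourier transform and $\langle r\rangle=1+|r|$. For $a,b,\theta\in\mathbb R$, $H^{a,b}_\theta$ is the space of $u\in\mathcal S'(\mathbb R^{1+n})$ with $$\|u\|_{H^{a,b}_\theta}=\big\|\langle\xi\rangle^a\langle\xi_1\rangle^b\langle||\tau|-|\xi_1||\rangle^\theta\,\widetilde u(\tau,\xi)\big\|_{L^2(\mathbb R^{1+n})}<\infty,$$ and $|f|_{H^{a,b}_\theta}=\|f\|_{H^{a,b}_\theta}+\|\partial_tf\|_{H^{a,b-1}_\theta}$ (the estimate is of interest when the right-hand side is finite). *)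

theory Defs
  imports "HOL-Analysis.Analysis"
begin

section \<open>Schwartz functions and tempered distributions\<close>

definition partial :: "'a \<Rightarrow> ('a \<Rightarrow> complex) \<Rightarrow> 'a::euclidean_space \<Rightarrow> complex" where
  "partial b \<phi> x = vector_derivative (\<lambda>h::real. \<phi> (x + h *\<^sub>R b)) (at 0)"

definition iter_partial :: "'a::euclidean_space list \<Rightarrow> ('a \<Rightarrow> complex) \<Rightarrow> 'a \<Rightarrow> complex" where
  "iter_partial bs \<phi> = foldr partial bs \<phi>"

definition schwartz :: "('a::euclidean_space \<Rightarrow> complex) set" where
  "schwartz = {\<phi>. \<forall>bs. set bs \<subseteq> Basis \<longrightarrow>
     (\<forall>x. iter_partial bs \<phi> differentiable (at x)) \<and>
     (\<forall>N::nat. bounded (range (\<lambda>x. (1 + norm x) ^ N *\<^sub>R iter_partial bs \<phi> x)))}"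

text \<open>An increasing sequence of seminorms defining the usual topology of the Schwartz space.\<close>

definition schwartz_norm :: "nat \<Rightarrow> ('a::euclidean_space \<Rightarrow> complex) \<Rightarrow> real" where
  "schwartz_norm N \<phi> = (\<Sum>bs | set bs \<subseteq> Basis \<and> length bs \<le> N.
     SUP x. (1 + norm x) ^ N * norm (iter_partial bs \<phi> x))"

text \<open>A distribution is a functional of which only the values on Schwartz functions
  matter. For a linear functional, continuity amounts to a bound by one of the seminorms above.\<close>

definition tempered :: "(('a::euclidean_space \<Rightarrow> complex) \<Rightarrow> complex) \<Rightarrow> bool" where
  "tempered u \<longleftrightarrow>
     (\<forall>\<phi>\<in>schwartz. \<forall>\<psi>\<in>schwartz. u (\<lambda>x. \<phi> x + \<psi> x) = u \<phi> + u \<psi>) \<and>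
     (\<forall>c. \<forall>\<phi>\<in>schwartz. u (\<lambda>x. c * \<phi> x) = c * u \<phi>) \<and>
     (\<exists>N. \<exists>C::real. \<forall>\<phi>\<in>schwartz. norm (u \<phi>) \<le> C * schwartz_norm N \<phi>)"

definition dist_deriv ::
    "'a \<Rightarrow> (('a::euclidean_space \<Rightarrow> complex) \<Rightarrow> complex) \<Rightarrow> ('a \<Rightarrow> complex) \<Rightarrow> complex" where
  "dist_deriv b u = (\<lambda>\<phi>. - u (partial b \<phi>))"

definition fourier_fun :: "('a::euclidean_space \<Rightarrow> complex) \<Rightarrow> 'a \<Rightarrow> complex" where
  "fourier_fun \<phi> \<zeta> = (\<integral>x. exp (- (\<i> * complex_of_real (x \<bullet> \<zeta>))) * \<phi> x \<partial>lborel)"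

definition fourier ::
    "(('a::euclidean_space \<Rightarrow> complex) \<Rightarrow> complex) \<Rightarrow> ('a \<Rightarrow> complex) \<Rightarrow> complex" where
  "fourier u = (\<lambda>\<phi>. u (fourier_fun \<phi>))"

text \<open>The distribution \<open>u\<close> is given by the function \<open>F\<close>; then \<open>F\<close> is unique up to null sets.\<close>

definition has_density ::
    "(('a::euclidean_space \<Rightarrow> complex) \<Rightarrow> complex) \<Rightarrow> ('a \<Rightarrow> complex) \<Rightarrow> bool" where
  "has_density u F \<longleftrightarrow> F \<in> borel_measurable borel \<and>
     (\<forall>\<phi>\<in>schwartz. integrable lborel (\<lambda>x. F x * \<phi> x) \<and> u \<phi> = (\<integral>x. F x * \<phi> x \<partial>lborel))"

definition density_of :: "(('a::euclidean_space \<Rightarrow> complex) \<Rightarrow> complex) \<Rightarrow> 'a \<Rightarrow> complex" where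
  "density_of u = (SOME F. has_density u F)"

text \<open>Products of distributions are formed by multiplying densities. Where this makes no sense,
  \<open>dist_mult\<close> returns \<open>0\<close> by convention, so statements about it should be
  accompanied by \<open>dist_mult_defined\<close>.\<close>

definition dist_mult_defined ::
    "(('a::euclidean_space \<Rightarrow> complex) \<Rightarrow> complex) \<Rightarrow> (('a \<Rightarrow> complex) \<Rightarrow> complex) \<Rightarrow> bool" where
  "dist_mult_defined u v \<longleftrightarrow> (\<exists>F. has_density u F) \<and> (\<exists>G. has_density v G) \<and>
     (\<forall>\<phi>\<in>schwartz. integrable lborel (\<lambda>x. density_of u x * density_of v x * \<phi> x))"

definition dist_mult ::
    "(('a::euclidean_space \<Rightarrow> complex) \<Rightarrow> complex) \<Rightarrow> (('a \<Rightarrow> complex) \<Rightarrow> complex)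
      \<Rightarrow> ('a \<Rightarrow> complex) \<Rightarrow> complex" where
  "dist_mult u v = (if dist_mult_defined u v
     then (\<lambda>\<phi>. \<integral>x. density_of u x * density_of v x * \<phi> x \<partial>lborel) else (\<lambda>\<phi>. 0))"

section \<open>The spaces \<open>H\<close> and the null form\<close>

text \<open>Space-time is \<^typ>\<open>real \<times> (real ^ 'n)\<close>. The index \<open>k :: 'n\<close> used throughout
  marks the coordinate called \<open>y\<^sub>1\<close> (dually \<open>\<xi>\<^sub>1\<close>).\<close>

type_synonym 'n dist = "(real \<times> (real ^ 'n) \<Rightarrow> complex) \<Rightarrow> complex"

definition japanese :: "'a::real_normed_vector \<Rightarrow> real" where
  "japanese r = 1 + norm r"

definition weight :: "'n::finite \<Rightarrow> real \<Rightarrow> real \<Rightarrow> real \<Rightarrow> real \<times> (real ^ 'n) \<Rightarrow> real" where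
  "weight k a b \<theta> = (\<lambda>(\<tau>, \<xi>). japanese \<xi> powr a * japanese (\<xi> $ k) powr b
     * japanese (\<bar>\<tau>\<bar> - \<bar>\<xi> $ k\<bar>) powr \<theta>)"

definition L2_norm :: "('a::euclidean_space \<Rightarrow> complex) \<Rightarrow> ennreal" where
  "L2_norm F = (let I = \<integral>\<^sup>+x. ennreal ((norm (F x))\<^sup>2) \<partial>lborel
     in if I = \<infinity> then \<infinity> else ennreal (sqrt (enn2real I)))"

definition H_norm :: "'n::finite \<Rightarrow> real \<Rightarrow> real \<Rightarrow> real \<Rightarrow> 'n dist \<Rightarrow> ennreal" where
  "H_norm k a b \<theta> u = (if \<exists>F. has_density (fourier u) F
     then L2_norm (\<lambda>\<zeta>. of_real (weight k a b \<theta> \<zeta>) * density_of (fourier u) \<zeta>) else \<infinity>)"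

definition H_space :: "'n::finite \<Rightarrow> real \<Rightarrow> real \<Rightarrow> real \<Rightarrow> 'n dist set" where
  "H_space k a b \<theta> = {u. tempered u \<and> H_norm k a b \<theta> u < \<infinity>}"

definition d_t :: "'n::finite dist \<Rightarrow> 'n dist" where
  "d_t = dist_deriv (1, 0)"

definition d_y :: "'n::finite \<Rightarrow> 'n dist \<Rightarrow> 'n dist" where
  "d_y k = dist_deriv (0, axis k 1)"

definition H_norm_t :: "'n::finite \<Rightarrow> real \<Rightarrow> real \<Rightarrow> real \<Rightarrow> 'n dist \<Rightarrow> ennreal" where
  "H_norm_t k a b \<theta> f = H_norm k a b \<theta> f + H_norm k a (b - 1) \<theta> (d_t f)"

definition Q0 :: "'n::finite \<Rightarrow> 'n dist \<Rightarrow> 'n dist \<Rightarrow> 'n dist" where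
  "Q0 k f g = (\<lambda>\<phi>. dist_mult (d_t f) (d_t g) \<phi> - dist_mult (d_y k f) (d_y k g) \<phi>)"

definition Q0_defined :: "'n::finite \<Rightarrow> 'n dist \<Rightarrow> 'n dist \<Rightarrow> bool" where
  "Q0_defined k f g \<longleftrightarrow>
     dist_mult_defined (d_t f) (d_t g) \<and> dist_mult_defined (d_y k f) (d_y k g)"

end

theory Submission
  imports Defs
begin

text \<open>
  The estimate is an inequality between Fourier transforms. Let \<open>F\<close> and \<open>G\<close> be the densities of the
  Fourier transforms of \<open>f\<close> and \<open>g\<close>. If the right-hand side is finite, the first derivatives
  in \<open>t\<close> and \<open>y\<^sub>1\<close> have square integrable Fourier transforms, hence are square integrable functions,
  their products are integrable, and up to a constant factor the Fourier transform of \<open>Q\<^sub>0(f, g)\<close> at \<open>z\<close> is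
  \<open>- \<integral> q(z - w, w) F(z - w) G(w) dw\<close>, where
  \<open>q((\<mu>, \<zeta>), (\<lambda>, \<eta>)) = \<mu> \<lambda> - \<zeta>\<^sub>1 \<eta>\<^sub>1\<close>.

  Give each of the two frequencies its null coordinates \<open>u = \<tau> + \<xi>\<^sub>1\<close> and \<open>v = \<tau> - \<xi>\<^sub>1\<close>. Then
  \<open>q = (u\<^sub>1 v\<^sub>2 + v\<^sub>1 u\<^sub>2) / 2\<close>: no product of two parallel null coordinates occurs. Moreover
  \<open>|\<tau>| + |\<xi>\<^sub>1|\<close> and \<open>||\<tau>| - |\<xi>\<^sub>1||\<close> are the maximum and the minimum of \<open>|u|\<close> and \<open>|v|\<close>, so for
  \<open>\<theta> \<le> 1\<close> the energy weight \<open>(1 + |\<tau>| + |\<xi>\<^sub>1|) \<langle>|\<tau>| - |\<xi>\<^sub>1|\<rangle>\<^sup>\<theta>\<close> dominates both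
  \<open>|u| \<langle>v\<rangle>\<^sup>\<theta>\<close> and \<open>|v| \<langle>u\<rangle>\<^sup>\<theta>\<close> (\<open>null_weight_bound\<close>). Divided by the energy weights of both
  frequencies, the term \<open>u\<^sub>1 v\<^sub>2\<close> is therefore at most \<open>\<langle>v\<^sub>1\<rangle>\<^sup>-\<^sup>\<theta> \<langle>u\<^sub>2\<rangle>\<^sup>-\<^sup>\<theta>\<close>. For a fixed sum of the
  two frequencies this decays in both null directions, and its square is integrable in
  \<open>(\<tau>, \<xi>\<^sub>1)\<close> because \<open>2 \<theta> > 1\<close>. Of the two weights \<open>\<langle>\<xi>\<rangle>\<^sup>s\<^sup>-\<^sup>1\<close> of the factors one pays for that of the
  product; the other one is left over, and its inverse is square integrable in
  \<open>\<xi>\<^sub>2, \<dots>, \<xi>\<^sub>n\<close> because \<open>2 (s - 1) > n - 1\<close>. So the kernel that remains has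
  square integral in \<open>w\<close> bounded uniformly in \<open>z\<close> (\<open>null_symbol_bound\<close>,
  \<open>null_kernel_integral_bound\<close>), and the Cauchy-Schwarz inequality in \<open>w\<close>, followed by an
  integration in \<open>z\<close>, is the estimate (\<open>null_form_estimate\<close>).

  Most of the text justifies the formula for the Fourier transform of \<open>Q\<^sub>0(f, g)\<close>. The Fourier
  transform preserves the Schwartz space, and averaging over small Gaussians yields the inversion
  formula, the uniqueness of densities and an \<open>L\<^sup>2\<close> bound. Constants are not
  normalised: the mass of the Gaussian is never evaluated, and an upper bound takes
  the place of Plancherel's identity. A distribution whose Fourier transform is a square
  integrable function \<open>H\<close> is then the function obtained as the almost everywhere limit, dominated in
  \<open>L\<^sup>2\<close>, of the inverse transforms of truncations of \<open>H\<close> (\<open>fourier_limit_exists\<close>,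
  \<open>has_density_from_fourier\<close>). Passing to this limit turns products into convolutions
  (\<open>dist_mult_square_integrable\<close>).

  If one of the two norms on the right is infinite, there is something to prove only when the other one is zero;
  the latter forces \<open>Q\<^sub>0(f, g) = 0\<close> (\<open>Q0_zero\<close>).
\<close>

section \<open>Schwartz functions\<close>

lemma partial_eq_derivative:
  assumes "(\<phi> has_derivative D) (at x)"
  shows "partial b \<phi> x = D b"
proof -
  have "((\<lambda>h::real. x + h *\<^sub>R b) has_derivative (\<lambda>h. h *\<^sub>R b)) (at 0)"
    by (auto intro!: derivative_eq_intros)
  moreover have "(\<phi> has_derivative D) (at (x + 0 *\<^sub>R b))"
    using assms by simp
  ultimately have "((\<phi> \<circ> (\<lambda>h::real. x + h *\<^sub>R b)) has_derivative (D \<circ> (\<lambda>h. h *\<^sub>R b))) (at 0)"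
    by (rule diff_chain_at)
  moreover have "D \<circ> (\<lambda>h. h *\<^sub>R b) = (\<lambda>h. h *\<^sub>R D b)"
    using linear_scale[OF has_derivative_linear[OF assms]] by (auto simp: o_def)
  ultimately have "((\<lambda>h::real. \<phi> (x + h *\<^sub>R b)) has_vector_derivative D b) (at 0)"
    by (simp add: has_vector_derivative_def o_def)
  then show ?thesis
    unfolding partial_def by (rule vector_derivative_at)
qed

definition rapidly_decreasing :: "('a::euclidean_space \<Rightarrow> complex) \<Rightarrow> bool" where
  "rapidly_decreasing \<phi> \<longleftrightarrow> (\<forall>x. \<phi> differentiable (at x)) \<and> (\<forall>N. \<exists>C. \<forall>x. (1 + norm x) ^ N * norm (\<phi> x) \<le> C)"

lemma rapidly_decreasing_derivative:
  "rapidly_decreasing \<phi> \<Longrightarrow> (\<phi> has_derivative frechet_derivative \<phi> (at x)) (at x)"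
  unfolding rapidly_decreasing_def using frechet_derivative_works by blast

lemma rapidly_decreasingI:
  assumes "\<And>x. (\<phi> has_derivative D x) (at x)" "\<And>N. \<exists>C. \<forall>x. (1 + norm x) ^ N * norm (\<phi> x) \<le> C"
  shows "rapidly_decreasing \<phi>"
  using assms unfolding rapidly_decreasing_def by (blast intro: differentiableI)

lemma rapidly_decreasing_add:
  assumes \<phi>: "rapidly_decreasing \<phi>" and \<psi>: "rapidly_decreasing \<psi>"
  shows "rapidly_decreasing (\<lambda>x. \<phi> x + \<psi> x)" "partial b (\<lambda>x. \<phi> x + \<psi> x) = (\<lambda>x. partial b \<phi> x + partial b \<psi> x)"
proof -
  note d = rapidly_decreasing_derivative[OF \<phi>] rapidly_decreasing_derivative[OF \<psi>]
  note D = has_derivative_add[OF d]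
  show "rapidly_decreasing (\<lambda>x. \<phi> x + \<psi> x)"
  proof (rule rapidly_decreasingI[OF D])
    fix N
    obtain C1 C2 where C: "\<And>x. (1 + norm x) ^ N * norm (\<phi> x) \<le> C1" "\<And>x. (1 + norm x) ^ N * norm (\<psi> x) \<le> C2"
      using \<phi> \<psi> unfolding rapidly_decreasing_def by meson
    have "(1 + norm x) ^ N * norm (\<phi> x + \<psi> x) \<le> (1 + norm x) ^ N * (norm (\<phi> x) + norm (\<psi> x))" for x
      by (intro mult_left_mono norm_triangle_ineq) auto
    then show "\<exists>C. \<forall>x. (1 + norm x) ^ N * norm (\<phi> x + \<psi> x) \<le> C"
      using add_mono[OF C] unfolding distrib_left by (meson order_trans)
  qed
  show "partial b (\<lambda>x. \<phi> x + \<psi> x) = (\<lambda>x. partial b \<phi> x + partial b \<psi> x)"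
    by (rule ext) (simp add: partial_eq_derivative[OF D] partial_eq_derivative[OF d(1)] partial_eq_derivative[OF d(2)])
qed

lemma rapidly_decreasing_cmult:
  assumes \<phi>: "rapidly_decreasing \<phi>"
  shows "rapidly_decreasing (\<lambda>x. c * \<phi> x)" "partial b (\<lambda>x. c * \<phi> x) = (\<lambda>x. c * partial b \<phi> x)"
proof -
  note d = rapidly_decreasing_derivative[OF \<phi>]
  note D = has_derivative_mult_right[OF d]
  show "rapidly_decreasing (\<lambda>x. c * \<phi> x)"
  proof (rule rapidly_decreasingI[OF D])
    fix N
    obtain C where "\<And>x. (1 + norm x) ^ N * norm (\<phi> x) \<le> C" using \<phi> unfolding rapidly_decreasing_def by meson
    then have "norm c * ((1 + norm x) ^ N * norm (\<phi> x)) \<le> norm c * C" for x by (rule mult_left_mono) auto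
    then show "\<exists>C. \<forall>x. (1 + norm x) ^ N * norm (c * \<phi> x) \<le> C"
      by (intro exI[of _ "norm c * C"]) (simp add: norm_mult mult_ac)
  qed
  show "partial b (\<lambda>x. c * \<phi> x) = (\<lambda>x. c * partial b \<phi> x)"
    by (rule ext) (simp add: partial_eq_derivative[OF D] partial_eq_derivative[OF d])
qed

lemma rapidly_decreasing_coordinate:
  assumes \<phi>: "rapidly_decreasing \<phi>"
  shows "rapidly_decreasing (\<lambda>x. of_real (x \<bullet> c) * \<phi> x)"
    "partial b (\<lambda>x. of_real (x \<bullet> c) * \<phi> x) = (\<lambda>x. of_real (x \<bullet> c) * partial b \<phi> x + of_real (b \<bullet> c) * \<phi> x)"
proof -
  have c: "((\<lambda>x. complex_of_real (x \<bullet> c)) has_derivative (\<lambda>h. of_real (h \<bullet> c))) (at x)" for x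
    by (auto intro!: derivative_eq_intros)
  note d = rapidly_decreasing_derivative[OF \<phi>]
  note D = has_derivative_mult[OF c d]
  show "rapidly_decreasing (\<lambda>x. of_real (x \<bullet> c) * \<phi> x)"
  proof (rule rapidly_decreasingI[OF D])
    fix N
    obtain C where C: "\<And>x. (1 + norm x) ^ Suc N * norm (\<phi> x) \<le> C" using \<phi> unfolding rapidly_decreasing_def by meson
    have "(1 + norm x) ^ N * norm (of_real (x \<bullet> c) * \<phi> x) \<le> norm c * C" for x
    proof -
      have "\<bar>x \<bullet> c\<bar> \<le> norm c * (1 + norm x)"
        using Cauchy_Schwarz_ineq2[of x c] norm_ge_zero[of c] unfolding distrib_left mult.commute[of "norm c"] by linarith
      then have "(1 + norm x) ^ N * norm (of_real (x \<bullet> c) * \<phi> x) \<le> (1 + norm x) ^ N * (norm c * (1 + norm x) * norm (\<phi> x))"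
        by (intro mult_left_mono) (simp_all add: norm_mult mult_right_mono)
      also have "\<dots> = norm c * ((1 + norm x) ^ Suc N * norm (\<phi> x))" by (simp add: algebra_simps)
      also have "\<dots> \<le> norm c * C" using C by (intro mult_left_mono) auto
      finally show ?thesis .
    qed
    then show "\<exists>C. \<forall>x. (1 + norm x) ^ N * norm (of_real (x \<bullet> c) * \<phi> x) \<le> C" by blast
  qed
  show "partial b (\<lambda>x. of_real (x \<bullet> c) * \<phi> x) = (\<lambda>x. of_real (x \<bullet> c) * partial b \<phi> x + of_real (b \<bullet> c) * \<phi> x)"
    by (rule ext) (simp add: partial_eq_derivative[OF D] partial_eq_derivative[OF d])
qed

text \<open>Iterated partial derivatives are never computed below: a function belongs to the
  Schwartz space as soon as it lies in some set of rapidly decreasing functions that is closed under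
  partial derivatives. Each closure property of the Schwartz space comes from a suitable set.\<close>

lemma schwartz_coinduct:
  assumes "\<phi> \<in> X"
    and X: "\<And>\<psi>. \<psi> \<in> X \<Longrightarrow> rapidly_decreasing \<psi>"
    and step: "\<And>\<psi> b. \<psi> \<in> X \<Longrightarrow> b \<in> Basis \<Longrightarrow> partial b \<psi> \<in> X"
  shows "\<phi> \<in> schwartz"
proof -
  have "iter_partial bs \<phi> \<in> X" if "set bs \<subseteq> Basis" for bs
    using that by (induction bs) (auto simp: iter_partial_def assms)
  then show ?thesis
    using X unfolding schwartz_def by (auto simp: rapidly_decreasing_def bounded_iff)
qed

lemma schwartz_rapidly_decreasing:
  assumes "\<phi> \<in> schwartz" shows "rapidly_decreasing \<phi>"
proof -
  have "\<phi> differentiable (at x)" "bounded (range (\<lambda>x. (1 + norm x) ^ N *\<^sub>R \<phi> x))" for x N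
    using assms by (auto simp: schwartz_def iter_partial_def dest: spec[of _ "[]"])
  then show ?thesis by (auto simp: rapidly_decreasing_def bounded_iff)
qed

lemma schwartz_has_derivative:
  "\<phi> \<in> schwartz \<Longrightarrow> (\<phi> has_derivative frechet_derivative \<phi> (at x)) (at x)"
  by (rule rapidly_decreasing_derivative[OF schwartz_rapidly_decreasing])

lemma schwartz_continuous: "\<phi> \<in> schwartz \<Longrightarrow> continuous_on UNIV \<phi>"
  by (meson continuous_at_imp_continuous_on has_derivative_continuous schwartz_has_derivative)

lemma schwartz_measurable [measurable_dest]: "\<phi> \<in> schwartz \<Longrightarrow> \<phi> \<in> borel_measurable borel"
  by (intro borel_measurable_continuous_onI schwartz_continuous)

lemma schwartz_bound:
  assumes "\<phi> \<in> schwartz"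
  obtains C where "C > 0" "\<And>x. (1 + norm x) ^ N * norm (\<phi> x) \<le> C"
proof -
  obtain C where C: "\<And>x. (1 + norm x) ^ N * norm (\<phi> x) \<le> C"
    using schwartz_rapidly_decreasing[OF assms] unfolding rapidly_decreasing_def by meson
  show ?thesis
    by (rule that[of "max 1 C"]) (use C in \<open>auto simp: le_max_iff_disj\<close>)
qed

lemma schwartz_partial:
  fixes \<phi> :: "'a::euclidean_space \<Rightarrow> complex"
  assumes "\<phi> \<in> schwartz" "b \<in> Basis"
  shows "partial b \<phi> \<in> schwartz"
proof -
  have *: "iter_partial bs (partial b \<phi>) = iter_partial (bs @ [b]) \<phi>" for bs :: "'a list"
    by (simp add: iter_partial_def)
  show ?thesis
    unfolding schwartz_def mem_Collect_eq *
  proof (rule allI, rule impI)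
    fix bs :: "'a list" assume "set bs \<subseteq> Basis"
    then have "set (bs @ [b]) \<subseteq> Basis" using assms by auto
    then show "(\<forall>x. iter_partial (bs @ [b]) \<phi> differentiable at x) \<and>
       (\<forall>N. bounded (range (\<lambda>x. (1 + norm x) ^ N *\<^sub>R iter_partial (bs @ [b]) \<phi> x)))"
      using assms(1) unfolding schwartz_def by blast
  qed
qed

lemma schwartz_add:
  assumes "\<phi> \<in> schwartz" "\<psi> \<in> schwartz"
  shows "(\<lambda>x. \<phi> x + \<psi> x) \<in> schwartz"
proof (rule schwartz_coinduct[where X = "{(\<lambda>x. \<phi> x + \<psi> x) | \<phi> \<psi>. \<phi> \<in> schwartz \<and> \<psi> \<in> schwartz}"])
  fix \<kappa> :: "'a \<Rightarrow> complex" and b :: 'a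
  assume "\<kappa> \<in> {(\<lambda>x. \<phi> x + \<psi> x) | \<phi> \<psi>. \<phi> \<in> schwartz \<and> \<psi> \<in> schwartz}"
  then obtain \<phi> \<psi> where *: "\<phi> \<in> schwartz" "\<psi> \<in> schwartz" and \<kappa>: "\<kappa> = (\<lambda>x. \<phi> x + \<psi> x)" by auto
  note r = rapidly_decreasing_add[OF *[THEN schwartz_rapidly_decreasing]]
  show "rapidly_decreasing \<kappa>" unfolding \<kappa> by (rule r)
  assume "b \<in> Basis"
  then show "partial b \<kappa> \<in> {(\<lambda>x. \<phi> x + \<psi> x) | \<phi> \<psi>. \<phi> \<in> schwartz \<and> \<psi> \<in> schwartz}"
    unfolding \<kappa> r using * by (blast intro: schwartz_partial)
qed (use assms in auto)

lemma schwartz_cmult: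
  assumes "\<phi> \<in> schwartz"
  shows "(\<lambda>x. c * \<phi> x) \<in> schwartz"
proof (rule schwartz_coinduct[where X = "{(\<lambda>x. c * \<phi> x) | \<phi>. \<phi> \<in> schwartz}"])
  fix \<kappa> :: "'a \<Rightarrow> complex" and b :: 'a
  assume "\<kappa> \<in> {(\<lambda>x. c * \<phi> x) | \<phi>. \<phi> \<in> schwartz}"
  then obtain \<phi> where *: "\<phi> \<in> schwartz" and \<kappa>: "\<kappa> = (\<lambda>x. c * \<phi> x)" by auto
  note r = rapidly_decreasing_cmult[OF schwartz_rapidly_decreasing[OF *]]
  show "rapidly_decreasing \<kappa>" unfolding \<kappa> by (rule r)
  assume "b \<in> Basis"
  then show "partial b \<kappa> \<in> {(\<lambda>x. c * \<phi> x) | \<phi>. \<phi> \<in> schwartz}"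
    unfolding \<kappa> r using * by (blast intro: schwartz_partial)
qed (use assms in auto)

text \<open>Differentiating a product with a coordinate leaves an extra term without that coordinate,
  so the invariant set consists of sums.\<close>

lemma schwartz_coordinate:
  assumes "\<phi> \<in> schwartz"
  shows "(\<lambda>x. of_real (x \<bullet> c) * \<phi> x) \<in> schwartz"
proof (rule schwartz_coinduct[where X = "{(\<lambda>x. of_real (x \<bullet> c) * \<phi> x + \<psi> x) | \<phi> \<psi>. \<phi> \<in> schwartz \<and> \<psi> \<in> schwartz}"])
  have "(\<lambda>x. 0 * \<phi> x) \<in> schwartz" by (rule schwartz_cmult[OF assms])
  then show "(\<lambda>x. of_real (x \<bullet> c) * \<phi> x) \<in> {(\<lambda>x. of_real (x \<bullet> c) * \<phi> x + \<psi> x) | \<phi> \<psi>. \<phi> \<in> schwartz \<and> \<psi> \<in> schwartz}"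
    using assms by force
  fix \<kappa> :: "'a \<Rightarrow> complex" and b :: 'a
  assume "\<kappa> \<in> {(\<lambda>x. of_real (x \<bullet> c) * \<phi> x + \<psi> x) | \<phi> \<psi>. \<phi> \<in> schwartz \<and> \<psi> \<in> schwartz}"
  then obtain \<phi> \<psi> where *: "\<phi> \<in> schwartz" "\<psi> \<in> schwartz"
    and \<kappa>: "\<kappa> = (\<lambda>x. of_real (x \<bullet> c) * \<phi> x + \<psi> x)" by auto
  note r = rapidly_decreasing_coordinate[OF schwartz_rapidly_decreasing[OF *(1)], where c = c]
  note s = rapidly_decreasing_add[OF r(1) schwartz_rapidly_decreasing[OF *(2)]]
  show "rapidly_decreasing \<kappa>" unfolding \<kappa> by (rule s)
  assume b: "b \<in> Basis"
  have "partial b \<kappa> = (\<lambda>x. of_real (x \<bullet> c) * partial b \<phi> x + (of_real (b \<bullet> c) * \<phi> x + partial b \<psi> x))"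
    unfolding \<kappa> s r by (simp add: add.assoc)
  then show "partial b \<kappa> \<in> {(\<lambda>x. of_real (x \<bullet> c) * \<phi> x + \<psi> x) | \<phi> \<psi>. \<phi> \<in> schwartz \<and> \<psi> \<in> schwartz}"
    unfolding mem_Collect_eq
    by (intro exI[of _ "partial b \<phi>"] exI[of _ "\<lambda>x. of_real (b \<bullet> c) * \<phi> x + partial b \<psi> x"] conjI
        schwartz_partial schwartz_add schwartz_cmult * b)
qed

lemma schwartz_reflect:
  assumes "\<phi> \<in> schwartz"
  shows "(\<lambda>x. \<phi> (- x)) \<in> schwartz"
proof (rule schwartz_coinduct[where X = "{(\<lambda>x. \<phi> (- x)) | \<phi>. \<phi> \<in> schwartz}"])
  fix \<kappa> :: "'a \<Rightarrow> complex" and b :: 'a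
  assume "\<kappa> \<in> {(\<lambda>x. \<phi> (- x)) | \<phi>. \<phi> \<in> schwartz}"
  then obtain \<phi> where *: "\<phi> \<in> schwartz" and \<kappa>: "\<kappa> = (\<lambda>x. \<phi> (- x))" by auto
  have D: "((\<lambda>x. \<phi> (- x)) has_derivative (\<lambda>h. frechet_derivative \<phi> (at (- x)) (- h))) (at x)" for x
    by (rule has_derivative_compose[OF _ schwartz_has_derivative[OF *]]) (auto intro!: derivative_eq_intros)
  show "rapidly_decreasing \<kappa>"
    unfolding \<kappa>
  proof (rule rapidly_decreasingI[OF D])
    fix N
    obtain C where "\<And>x. (1 + norm x) ^ N * norm (\<phi> x) \<le> C" using schwartz_bound[OF *] by metis
    from this[of "- x" for x] show "\<exists>C. \<forall>x. (1 + norm x) ^ N * norm (\<phi> (- x)) \<le> C" by auto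
  qed
  assume b: "b \<in> Basis"
  have "partial b \<kappa> = (\<lambda>x. (\<lambda>x. - 1 * partial b \<phi> x) (- x))"
    unfolding \<kappa>
    by (rule ext) (simp add: partial_eq_derivative[OF D] partial_eq_derivative[OF schwartz_has_derivative[OF *]]
         linear_neg[OF has_derivative_linear[OF schwartz_has_derivative[OF *]]])
  moreover have "(\<lambda>x. - 1 * partial b \<phi> x) \<in> schwartz"
    using * b by (intro schwartz_cmult schwartz_partial)
  ultimately show "partial b \<kappa> \<in> {(\<lambda>x. \<phi> (- x)) | \<phi>. \<phi> \<in> schwartz}"
    unfolding mem_Collect_eq by (intro exI[of _ "\<lambda>x. - 1 * partial b \<phi> x"] conjI)
qed (use assms in auto)

text \<open>The character of the Fourier transform; \<open>wave (- x) \<zeta>\<close> is that of the inverse transform.\<close>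

definition wave :: "'a::euclidean_space \<Rightarrow> 'a \<Rightarrow> complex" where
  "wave \<zeta> x = exp (- (\<i> * complex_of_real (x \<bullet> \<zeta>)))"

lemma norm_wave [simp]: "norm (wave \<zeta> x) = 1"
  by (simp add: wave_def norm_exp_eq_Re)

lemma wave_measurable [measurable (raw)]: 
  assumes "f \<in> borel_measurable M" "g \<in> borel_measurable M"
  shows "(\<lambda>p. wave (f p) (g p)) \<in> borel_measurable M"
  using assms unfolding wave_def by measurable

lemma wave_commute: "wave \<zeta> x = wave x \<zeta>"
  by (simp add: wave_def inner_commute)

lemma wave_add_left: "wave (\<zeta> + \<eta>) x = wave \<zeta> x * wave \<eta> x"
  by (simp add: wave_def inner_add_right exp_add[symmetric] algebra_simps)

lemma wave_add_right: "wave \<zeta> (x + y) = wave \<zeta> x * wave \<zeta> y"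
  by (simp add: wave_def inner_add_left exp_add[symmetric] algebra_simps)

lemma wave_minus: "wave (- \<zeta>) x = wave \<zeta> (- x)"
  by (simp add: wave_def)

lemma wave_has_derivative:
  "(wave \<zeta> has_derivative (\<lambda>h. - (\<i> * of_real (h \<bullet> \<zeta>)) * wave \<zeta> x)) (at x)"
  unfolding wave_def[abs_def]
  proof -
  have "((\<lambda>x. - (\<i> * complex_of_real (x \<bullet> \<zeta>))) has_derivative (\<lambda>h. - (\<i> * of_real (h \<bullet> \<zeta>)))) (at x)"
    by (auto intro!: derivative_eq_intros)
  from has_derivative_compose[OF this DERIV_exp[unfolded has_field_derivative_def]]
  show "((\<lambda>x. exp (- (\<i> * complex_of_real (x \<bullet> \<zeta>)))) has_derivative
     (\<lambda>h. - (\<i> * of_real (h \<bullet> \<zeta>)) * exp (- (\<i> * complex_of_real (x \<bullet> \<zeta>))))) (at x)"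
    by (simp add: mult.commute)
qed

lemma schwartz_wave:
  fixes \<phi> :: "'a::euclidean_space \<Rightarrow> complex"
  assumes "\<phi> \<in> schwartz"
  shows "(\<lambda>x. wave \<zeta> x * \<phi> x) \<in> schwartz"
proof (rule schwartz_coinduct[where X = "{(\<lambda>x. wave \<zeta> x * \<phi> x) | \<phi>. \<phi> \<in> schwartz}"])
  fix \<kappa> :: "'a \<Rightarrow> complex" and b :: 'a
  assume "\<kappa> \<in> {(\<lambda>x. wave \<zeta> x * \<phi> x) | \<phi>. \<phi> \<in> schwartz}"
  then obtain \<phi> where *: "\<phi> \<in> schwartz" and \<kappa>: "\<kappa> = (\<lambda>x. wave \<zeta> x * \<phi> x)" by auto
  note D = has_derivative_mult[OF wave_has_derivative schwartz_has_derivative[OF *(1)]]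
  show "rapidly_decreasing \<kappa>"
    unfolding \<kappa> by (rule rapidly_decreasingI[OF D]) (use * in \<open>simp add: norm_mult, metis schwartz_bound\<close>)
  assume b: "b \<in> Basis"
  have "partial b \<kappa> = (\<lambda>x. wave \<zeta> x * (partial b \<phi> x + (- \<i> * of_real (b \<bullet> \<zeta>)) * \<phi> x))"
    unfolding \<kappa> partial_eq_derivative[OF D] by (rule ext) (simp add: partial_eq_derivative[OF D] partial_eq_derivative[OF schwartz_has_derivative[OF *]] ring_distribs)
  moreover have "(\<lambda>x. partial b \<phi> x + (- \<i> * of_real (b \<bullet> \<zeta>)) * \<phi> x) \<in> schwartz"
    using * b by (intro schwartz_add schwartz_cmult schwartz_partial)
  ultimately show "partial b \<kappa> \<in> {(\<lambda>x. wave \<zeta> x * \<phi> x) | \<phi>. \<phi> \<in> schwartz}"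
    unfolding mem_Collect_eq by (intro exI conjI)
qed (use assms in auto)

text \<open>The Gaussian enters through two properties: it is a Schwartz function, and it is, up to a constant,
  its own Fourier transform.\<close>

definition gauss :: "'a::euclidean_space \<Rightarrow> real" where
  "gauss x = exp (- (x \<bullet> x) / 2)"

lemma gauss_pos: "gauss x > 0" by (simp add: gauss_def)
lemma gauss_le_1: "gauss x \<le> 1" by (simp add: gauss_def)
lemma gauss_uminus [simp]: "gauss (- x) = gauss x" by (simp add: gauss_def)

lemma gauss_measurable [measurable]: "gauss \<in> borel_measurable borel"
  unfolding gauss_def[abs_def] by measurable

text \<open>One has \<open>r ^ N / N! \<le> exp r\<close> for \<open>r = 1 + |x|\<close>, and
  \<open>1 + |x| - |x|\<^sup>2 / 2 \<le> 3 / 2\<close>.\<close>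

lemma gauss_decay: "(1 + norm x) ^ N * gauss x \<le> fact N * exp (3 / 2)"
proof -
  let ?r = "1 + norm x"
  have "?r ^ N / fact N \<le> exp ?r"
  proof -
    have "(\<Sum>n\<in>{N}. ?r ^ n /\<^sub>R fact n) \<le> (\<Sum>n. ?r ^ n /\<^sub>R fact n)"
      by (rule sum_le_suminf) (use summable_exp_generic[of ?r] in auto)
    then show ?thesis by (simp add: exp_def divide_inverse mult.commute)
  qed
  then have "?r ^ N \<le> fact N * exp ?r" by (simp add: field_simps)
  then have "?r ^ N * gauss x \<le> fact N * exp ?r * gauss x"
    by (rule mult_right_mono) (simp add: gauss_def)
  also have "\<dots> = fact N * exp (?r - (norm x)\<^sup>2 / 2)"
    by (simp add: gauss_def power2_norm_eq_inner exp_add[symmetric] mult.assoc)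
  also have "\<dots> \<le> fact N * exp (3 / 2)"
  proof (intro mult_left_mono)
    have "0 \<le> (norm x - 1)\<^sup>2" by simp
    then show "exp (?r - (norm x)\<^sup>2 / 2) \<le> exp (3 / 2)"
      by (simp add: power2_eq_square algebra_simps)
  qed auto
  finally show ?thesis .
qed

text \<open>Polynomials times the Gaussian, generated without a normal form for polynomials: all that is needed
  is a set that contains the Gaussian and is closed under partial derivatives.\<close>

inductive_set gauss_polys :: "('a::euclidean_space \<Rightarrow> complex) set" where
  base: "(\<lambda>x. of_real (gauss x)) \<in> gauss_polys"
| coord: "\<phi> \<in> gauss_polys \<Longrightarrow> (\<lambda>x. of_real (x \<bullet> c) * \<phi> x) \<in> gauss_polys"
| add: "\<phi> \<in> gauss_polys \<Longrightarrow> \<psi> \<in> gauss_polys \<Longrightarrow> (\<lambda>x. \<phi> x + \<psi> x) \<in> gauss_polys"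
| cmult: "\<phi> \<in> gauss_polys \<Longrightarrow> (\<lambda>x. a * \<phi> x) \<in> gauss_polys"

lemma gauss_has_derivative:
  "((\<lambda>x. complex_of_real (gauss x)) has_derivative (\<lambda>h. - of_real ((x \<bullet> h) * gauss x))) (at x)"
proof -
  have "(gauss has_derivative (\<lambda>h. - ((x \<bullet> h) * gauss x))) (at x)"
    unfolding gauss_def[abs_def]
    by (auto intro!: derivative_eq_intros simp: inner_commute algebra_simps)
  from has_derivative_of_real[OF this] show ?thesis by simp
qed

lemma partial_gauss: "partial b (\<lambda>x. complex_of_real (gauss x)) = (\<lambda>x. - 1 * (of_real (x \<bullet> b) * of_real (gauss x)))"
  by (rule ext) (simp add: partial_eq_derivative[OF gauss_has_derivative])

lemma gauss_polys_props:
  assumes "\<phi> \<in> gauss_polys"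
  shows "rapidly_decreasing \<phi> \<and> (\<forall>b\<in>Basis. partial b \<phi> \<in> gauss_polys)"
  using assms
proof induction
  case base
  have "rapidly_decreasing (\<lambda>x::'a. complex_of_real (gauss x))"
  proof (rule rapidly_decreasingI[OF gauss_has_derivative])
    show "\<exists>C. \<forall>x::'a. (1 + norm x) ^ N * norm (complex_of_real (gauss x)) \<le> C" for N
      by (intro exI[of _ "fact N * exp (3 / 2)"] allI) (simp add: abs_of_nonneg gauss_decay less_imp_le[OF gauss_pos])
  qed
  moreover have "(\<lambda>x. - 1 * (complex_of_real (x \<bullet> b) * of_real (gauss x))) \<in> gauss_polys" for b
    by (intro gauss_polys.intros)
  ultimately show ?case unfolding partial_gauss by blast
next
  case (coord \<phi> c)
  have "(\<lambda>x. of_real (x \<bullet> c) * partial b \<phi> x + of_real (b \<bullet> c) * \<phi> x) \<in> gauss_polys" if "b \<in> Basis" for b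
    using coord that by (intro gauss_polys.intros) auto
  then show ?case using coord rapidly_decreasing_coordinate[of \<phi>] by metis
next
  case (add \<phi> \<psi>)
  then show ?case using rapidly_decreasing_add[of \<phi> \<psi>] by (simp add: gauss_polys.add)
next
  case (cmult \<phi> a)
  then show ?case using rapidly_decreasing_cmult[of \<phi>] by (simp add: gauss_polys.cmult)
qed

lemma gauss_schwartz: "(\<lambda>x. complex_of_real (gauss x)) \<in> schwartz"
  by (rule schwartz_coinduct[OF gauss_polys.base]) (use gauss_polys_props in blast)+

section \<open>Integration on Euclidean space\<close>

lemma nn_integral_lborel_affine:
  fixes t :: "'a::euclidean_space"
  assumes [measurable]: "f \<in> borel_measurable borel" and c: "c \<noteq> 0"
  shows "(\<integral>\<^sup>+x. f x \<partial>lborel) = ennreal (\<bar>c\<bar> ^ DIM('a)) * (\<integral>\<^sup>+x. f (t + c *\<^sub>R x) \<partial>lborel)"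
  by (subst lborel_affine[OF c, of t]) (simp add: nn_integral_density nn_integral_distr nn_integral_cmult)

lemma lborel_integrable_affine:
  fixes t :: "'a::euclidean_space" and f :: "'a \<Rightarrow> complex"
  assumes "integrable lborel f" and c: "c \<noteq> 0"
  shows "integrable lborel (\<lambda>x. f (t + c *\<^sub>R x))"
proof -
  have [measurable]: "f \<in> borel_measurable borel" using assms by auto
  show ?thesis
    using assms(1) unfolding integrable_iff_bounded
    by (subst (asm) nn_integral_lborel_affine[OF _ c, of _ t]) (auto simp: ennreal_mult_less_top c)
qed

lemma lborel_integral_affine:
  fixes t :: "'a::euclidean_space" and f :: "'a \<Rightarrow> complex"
  assumes [measurable]: "f \<in> borel_measurable borel" and c: "c \<noteq> 0"
  shows "(\<integral>x. f x \<partial>lborel) = of_real (\<bar>c\<bar> ^ DIM('a)) * (\<integral>x. f (t + c *\<^sub>R x) \<partial>lborel)"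
  by (subst lborel_affine[OF c, of t]) (simp add: integral_density integral_distr scaleR_conv_of_real)

lemma nn_integral_lborel_translate:
  fixes t :: "'a::euclidean_space"
  assumes "f \<in> borel_measurable borel"
  shows "(\<integral>\<^sup>+x. f (t + x) \<partial>lborel) = (\<integral>\<^sup>+x. f x \<partial>lborel)"
  using nn_integral_lborel_affine[OF assms, of 1 t] by simp

lemma nn_integral_lborel_reflect:
  fixes t :: "'a::euclidean_space"
  assumes "f \<in> borel_measurable borel"
  shows "(\<integral>\<^sup>+x. f (t - x) \<partial>lborel) = (\<integral>\<^sup>+x. f x \<partial>lborel)"
  using nn_integral_lborel_affine[OF assms, of "-1" t] by simp

text \<open>The primitive on the half line is \<open>- (1 + x) powr (1 - p) / (p - 1)\<close>.\<close>

lemma nn_integral_japanese_finite: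
  assumes "p > 1"
  shows "(\<integral>\<^sup>+x. ennreal (japanese x powr (- p)) \<partial>(lborel :: real measure)) < \<infinity>"
proof -
  have half: "(\<integral>\<^sup>+x. ennreal ((1 + x) powr (- p)) * indicator {0..} x \<partial>lborel) = ennreal (0 - (- ((1 + 0) powr (1 - p) / (p - 1))))"
  proof (rule nn_integral_FTC_atLeast)
    show "((\<lambda>x. - ((1 + x) powr (1 - p) / (p - 1))) has_real_derivative (1 + x) powr (- p)) (at x)" if "0 \<le> x" for x
    proof -
      have "((\<lambda>x. 1 + x) has_real_derivative 1) (at x)" by (auto intro!: derivative_eq_intros)
      from DERIV_fun_powr[OF this, of "1 - p"] that
      have "((\<lambda>x. (1 + x) powr (1 - p)) has_real_derivative (1 - p) * (1 + x) powr (- p)) (at x)" by simp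
      from DERIV_minus[OF DERIV_cdivide[OF this, of "p - 1"]]
      show ?thesis
        by (rule DERIV_cong) (use assms in \<open>simp add: field_simps\<close>)
    qed
    have "((\<lambda>x. (1 + x) powr (1 - p)) \<longlongrightarrow> 0) at_top"
      using assms by (intro tendsto_neg_powr filterlim_tendsto_add_at_top[OF tendsto_const filterlim_ident]) auto
    then have "((\<lambda>x. - ((1 + x) powr (1 - p) / (p - 1))) \<longlongrightarrow> - (0 / (p - 1))) at_top"
      by (intro tendsto_intros) (use assms in auto)
    then show "((\<lambda>x. - ((1 + x) powr (1 - p) / (p - 1))) \<longlongrightarrow> 0) at_top" by simp
  qed auto
  have "(\<integral>\<^sup>+x. ennreal (japanese x powr (- p)) \<partial>(lborel :: real measure))
    \<le> (\<integral>\<^sup>+x. ennreal ((1 + x) powr (- p)) * indicator {0..} x + ennreal ((1 + (0 - x)) powr (- p)) * indicator {0..} (0 - x) \<partial>lborel)"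
    by (intro nn_integral_mono) (auto simp: japanese_def split: split_indicator)
  also have "\<dots> = 2 * (\<integral>\<^sup>+x. ennreal ((1 + x) powr (- p)) * indicator {0..} x \<partial>lborel)"
    by (subst nn_integral_add)
       (auto simp: mult_2 nn_integral_lborel_reflect[where f = "\<lambda>x. ennreal ((1 + x) powr (- p)) * indicator {0..} x" and t = 0, simplified])
  also have "\<dots> < \<infinity>"
    unfolding half by (simp add: ennreal_mult_less_top)
  finally show ?thesis .
qed

text \<open>Each factor \<open>(1 + |x|)\<^sup>2\<close> of the assumed decay dominates the square of one one-dimensional
  bracket, so that the function is bounded by a product of integrable functions of the coordinates.\<close>

lemma integrable_if_decay:
  fixes f :: "'a::euclidean_space \<Rightarrow> complex"
  assumes [measurable]: "f \<in> borel_measurable borel"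
    and le: "\<And>x. (1 + norm x) ^ (2 * DIM('a)) * norm (f x) \<le> C"
  shows "integrable lborel f"
proof (rule integrableI_bounded)
  have C: "C \<ge> 0" using le[of 0] norm_ge_zero[of "f 0"] by (simp del: norm_ge_zero)
  have pw: "ennreal (norm (f x)) \<le> ennreal C * (\<Prod>b\<in>Basis. ennreal (japanese (x \<bullet> b) powr (- 2)))" for x
  proof -
    have "(\<Prod>b\<in>Basis. japanese (x \<bullet> b) ^ 2) \<le> (\<Prod>b\<in>(Basis::'a set). (1 + norm x) ^ 2)"
      by (intro prod_mono) (auto intro!: power_mono simp: japanese_def Basis_le_norm)
    also have "\<dots> = (1 + norm x) ^ (2 * DIM('a))"
      by (simp add: power_mult)
    finally have "(\<Prod>b\<in>Basis. japanese (x \<bullet> b) ^ 2) * norm (f x) \<le> C"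
      using le[of x] by (meson mult_right_mono norm_ge_zero order_trans)
    moreover have pos: "(\<Prod>b\<in>Basis. japanese (x \<bullet> b) ^ 2) > 0"
      by (intro prod_pos) (auto simp: japanese_def add_pos_nonneg)
    ultimately have "norm (f x) \<le> C * inverse (\<Prod>b\<in>Basis. japanese (x \<bullet> b) ^ 2)"
      by (simp add: field_simps)
    also have "inverse (\<Prod>b\<in>Basis. japanese (x \<bullet> b) ^ 2) = (\<Prod>b\<in>Basis. japanese (x \<bullet> b) powr (- 2))"
    proof -
      have "(y::real) > 0 \<Longrightarrow> inverse (y ^ 2) = y powr (- 2)" for y
        by (simp add: powr_minus)
      moreover have "japanese (x \<bullet> b) > 0" for b
        by (simp add: japanese_def add_pos_nonneg)
      ultimately show ?thesis unfolding prod_inversef[symmetric] by (simp add: o_def)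
    qed
    finally show ?thesis
      using C by (simp add: prod_ennreal ennreal_mult[symmetric] prod_nonneg ennreal_leI)
  qed
  have [measurable]: "(\<lambda>x::real. japanese x) \<in> borel_measurable borel"
    by (simp add: japanese_def[abs_def])
  have "(\<integral>\<^sup>+x. ennreal (norm (f x)) \<partial>lborel) \<le> (\<integral>\<^sup>+x. ennreal C * (\<Prod>b\<in>Basis. ennreal (japanese (x \<bullet> b) powr (- 2))) \<partial>(lborel :: 'a measure))"
    by (intro nn_integral_mono pw)
  also have "\<dots> = ennreal C * (\<Prod>b\<in>(Basis::'a set). \<integral>\<^sup>+x. ennreal (japanese x powr (- 2)) \<partial>(lborel :: real measure))"
    by (subst nn_integral_cmult, measurable, subst nn_integral_lborel_prod) auto
  also have "\<dots> < \<infinity>"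
    using nn_integral_japanese_finite[of 2] by (simp add: ennreal_mult_less_top power_less_top_ennreal)
  finally show "(\<integral>\<^sup>+x. ennreal (norm (f x)) \<partial>lborel) < \<infinity>" .
qed auto

lemma schwartz_integrable [intro]:
  assumes "\<phi> \<in> schwartz" shows "integrable lborel \<phi>"
  using integrable_if_decay schwartz_bound[OF assms] schwartz_measurable[OF assms] by metis

lemma integrable_bounded_mult:
  fixes f k :: "'a \<Rightarrow> complex"
  assumes "integrable M f" "k \<in> borel_measurable M" "\<And>x. norm (k x) \<le> B"
  shows "integrable M (\<lambda>x. k x * f x)"
proof (rule Bochner_Integration.integrable_bound[of M "\<lambda>x. B * norm (f x)"])
  show "integrable M (\<lambda>x. B * norm (f x))" using assms by auto
  show "AE x in M. norm (k x * f x) \<le> norm (B * norm (f x))"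
  proof (rule AE_I2)
    fix x
    have "norm (k x * f x) \<le> B * norm (f x)"
      by (simp add: norm_mult assms(3) mult_right_mono)
    then show "norm (k x * f x) \<le> norm (B * norm (f x))" by simp
  qed
qed (use assms in auto)

lemma integrable_pair_mult:
  fixes f :: "'a::euclidean_space \<Rightarrow> complex" and g :: "'b::euclidean_space \<Rightarrow> complex"
  assumes f: "integrable lborel f" and g: "integrable lborel g"
    and k: "case_prod k \<in> borel_measurable (lborel \<Otimes>\<^sub>M lborel)" "\<And>x y. norm (k x y) \<le> B"
  shows "integrable (lborel \<Otimes>\<^sub>M lborel) (\<lambda>(x, y). k x y * (f x * g y))"
proof -
  have [measurable]: "f \<in> borel_measurable borel" "g \<in> borel_measurable borel"
    using f g by auto
  have "integrable (lborel \<Otimes>\<^sub>M lborel) (\<lambda>(x, y). f x * g y)"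
    using f g by (intro lborel_pair.Fubini_integrable) (auto simp: norm_mult split_beta)
  from integrable_bounded_mult[OF this k(1), of B]
  show ?thesis using k(2) by (simp add: split_beta')
qed

text \<open>Fubini's theorem for two integrable functions joined by a bounded kernel, which will be a character
  or a translated Gaussian.\<close>

lemma Fubini_mult:
  fixes f :: "'a::euclidean_space \<Rightarrow> complex" and g :: "'b::euclidean_space \<Rightarrow> complex"
  assumes f: "integrable lborel f" and g: "integrable lborel g"
    and k: "case_prod k \<in> borel_measurable (lborel \<Otimes>\<^sub>M lborel)" "\<And>x y. norm (k x y) \<le> B"
  shows "(\<integral>x. f x * (\<integral>y. k x y * g y \<partial>lborel) \<partial>lborel) = (\<integral>y. g y * (\<integral>x. k x y * f x \<partial>lborel) \<partial>lborel)"
proof -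
  have "(\<integral>y. (\<integral>x. k x y * (f x * g y) \<partial>lborel) \<partial>lborel) = (\<integral>x. (\<integral>y. k x y * (f x * g y) \<partial>lborel) \<partial>lborel)"
    by (rule lborel_pair.Fubini_integral[OF integrable_pair_mult[OF assms]])
  then show ?thesis
    by (simp flip: integral_mult_right_zero integral_mult_left_zero add: mult_ac)
qed

section \<open>The Fourier transform of Schwartz functions\<close>

lemma fourier_fun_wave: "fourier_fun \<phi> \<zeta> = (\<integral>x. wave \<zeta> x * \<phi> x \<partial>lborel)"
  by (simp add: fourier_fun_def wave_def)

lemma wave_integrable [intro]:
  "integrable lborel \<phi> \<Longrightarrow> integrable lborel (\<lambda>x. wave \<zeta> x * \<phi> x)"
  by (rule integrable_bounded_mult[where B = 1]) auto

lemma fourier_fun_measurable [measurable]: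
  assumes [measurable]: "\<phi> \<in> borel_measurable borel"
  shows "fourier_fun \<phi> \<in> borel_measurable borel"
  unfolding fourier_fun_wave[abs_def] by measurable

lemma fourier_fun_bound:
  "norm (fourier_fun \<phi> \<zeta>) \<le> (\<integral>x. norm (\<phi> x) \<partial>lborel)"
  unfolding fourier_fun_wave
  using integral_norm_bound[of lborel "\<lambda>x. wave \<zeta> x * \<phi> x"] by (simp add: norm_mult)

text \<open>The kernel of the Fourier transform is symmetric.\<close>

lemma fourier_fun_multiplication:
  assumes f: "integrable lborel f" and g: "integrable lborel g"
  shows "(\<integral>x. f x * fourier_fun g x \<partial>lborel) = (\<integral>y. g y * fourier_fun f y \<partial>lborel)"
  unfolding fourier_fun_wave 
  by (subst Fubini_mult[OF f g, where B = 1]) (auto simp: wave_commute split_beta)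

lemma fourier_fun_cmult: "fourier_fun (\<lambda>x. c * \<phi> x) \<zeta> = c * fourier_fun \<phi> \<zeta>"
  by (simp add: fourier_fun_wave mult.left_commute[of _ c])

lemma fourier_fun_reflect:
  assumes [measurable]: "\<phi> \<in> borel_measurable borel"
  shows "fourier_fun (\<lambda>x. \<phi> (- x)) \<zeta> = fourier_fun \<phi> (- \<zeta>)"
  unfolding fourier_fun_wave wave_minus
  by (subst lborel_integral_affine[where c = "-1" and t = 0]) auto

lemma fourier_fun_translate:
  assumes [measurable]: "\<phi> \<in> borel_measurable borel"
  shows "fourier_fun (\<lambda>x. \<phi> (x + a)) \<zeta> = wave \<zeta> (- a) * fourier_fun \<phi> \<zeta>"
  unfolding fourier_fun_wave
  by (subst lborel_integral_affine[where c = "1" and t = "- a"])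
     (auto simp: wave_add_right[of \<zeta> _ "- a", simplified] mult_ac simp flip: integral_mult_right_zero)

lemma schwartz_line_derivative:
  assumes \<phi>: "\<phi> \<in> schwartz"
  shows "((\<lambda>t::real. \<phi> (x + t *\<^sub>R b)) has_vector_derivative partial b \<phi> (x + t *\<^sub>R b)) (at t)"
proof -
  note d = schwartz_has_derivative[OF \<phi>]
  have "((\<lambda>t::real. x + t *\<^sub>R b) has_derivative (\<lambda>h. h *\<^sub>R b)) (at t)"
    by (auto intro!: derivative_eq_intros)
  from has_derivative_compose[OF this d] show ?thesis
    using partial_eq_derivative[OF d, of b] linear_scale[OF has_derivative_linear[OF d]]
    by (simp add: has_vector_derivative_def)
qed

lemma difference_quotient_tendsto:
  fixes f :: "real \<Rightarrow> 'a::real_normed_vector"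
  assumes "(f has_vector_derivative d) (at 0)"
  shows "((\<lambda>t. (1 / t) *\<^sub>R (f t - f 0)) \<longlongrightarrow> d) (at 0)"
proof -
  have "((\<lambda>t. norm (f t - f 0 - t *\<^sub>R d) / norm t) \<longlongrightarrow> 0) (at 0)"
    using assms by (simp add: has_vector_derivative_def has_derivative_at)
  then have "((\<lambda>t. norm ((1 / t) *\<^sub>R (f t - f 0) - d)) \<longlongrightarrow> 0) (at 0)"
  proof (rule Lim_transform_eventually)
    have "norm (f t - f 0 - t *\<^sub>R d) / norm t = norm ((1 / t) *\<^sub>R (f t - f 0) - d)" if "t \<noteq> 0" for t
    proof -
      have "(1 / t) *\<^sub>R (f t - f 0) - d = (1 / t) *\<^sub>R (f t - f 0 - t *\<^sub>R d)"
        using that by (simp add: scaleR_diff_right)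
      then show ?thesis by simp
    qed
    then show "\<forall>\<^sub>F t in at 0. norm (f t - f 0 - t *\<^sub>R d) / norm t = norm ((1 / t) *\<^sub>R (f t - f 0) - d)"
      by (auto simp: eventually_at_filter)
  qed
  then show ?thesis by (simp add: tendsto_norm_zero_iff LIM_zero_iff)
qed

text \<open>Mean value inequality along a segment of length at most one. On such a segment
  \<open>1 + |x|\<close> changes by a factor of at most two, which is why the decay of the derivative survives.\<close>

lemma schwartz_difference_bound:
  fixes \<phi> :: "'a::euclidean_space \<Rightarrow> complex"
  assumes \<phi>: "\<phi> \<in> schwartz" and b: "b \<in> Basis"
  obtains C where "\<And>x h. 0 < h \<Longrightarrow> h \<le> 1 \<Longrightarrow> (1 + norm x) ^ N * norm (\<phi> (x + h *\<^sub>R b) - \<phi> x) \<le> C * h"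
proof -
  obtain C where "C > 0" and C: "\<And>x. (1 + norm x) ^ N * norm (partial b \<phi> x) \<le> C"
    using schwartz_bound[OF schwartz_partial[OF \<phi> b]] by blast
  have main: "(1 + norm x) ^ N * norm (\<phi> (x + h *\<^sub>R b) - \<phi> x) \<le> (2 ^ N * C) * h" if h: "0 < h" "h \<le> 1" for x h
  proof -
    let ?B = "2 ^ N * C / (1 + norm x) ^ N"
    have pos: "(1 + norm x) ^ N > 0" by (simp add: add_pos_nonneg)
    have "norm (\<phi> (x + h *\<^sub>R b) - \<phi> (x + 0 *\<^sub>R b)) \<le> ?B * h - ?B * 0"
    proof (rule differentiable_bound_general[OF h(1)])
      show "continuous_on {0..h} (\<lambda>t. \<phi> (x + t *\<^sub>R b))"
        using schwartz_line_derivative[OF \<phi>] by (meson continuous_at_imp_continuous_on has_vector_derivative_continuous)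
      show "((\<lambda>t. ?B * t) has_vector_derivative ?B) (at t)" for t
        using DERIV_cmult_Id[of ?B t UNIV] by (simp only: has_real_derivative_iff_has_vector_derivative)
      fix t assume t: "0 < t" "t < h"
      show "((\<lambda>t::real. \<phi> (x + t *\<^sub>R b)) has_vector_derivative partial b \<phi> (x + t *\<^sub>R b)) (at t)"
        by (rule schwartz_line_derivative[OF \<phi>])
      have "norm x \<le> norm (x + t *\<^sub>R b) + norm (t *\<^sub>R b)"
        using norm_triangle_ineq4[of "x + t *\<^sub>R b" "t *\<^sub>R b"] by simp
      moreover have "norm (t *\<^sub>R b) \<le> 1" using t h b by simp
      ultimately have "1 + norm x \<le> 2 * (1 + norm (x + t *\<^sub>R b))"
        using norm_ge_zero[of "x + t *\<^sub>R b"] unfolding distrib_left by linarith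
      then have "(1 + norm x) ^ N \<le> 2 ^ N * (1 + norm (x + t *\<^sub>R b)) ^ N"
        by (metis add_nonneg_nonneg norm_ge_zero power_mono power_mult_distrib zero_le_one)
      then have "(1 + norm x) ^ N * norm (partial b \<phi> (x + t *\<^sub>R b))
          \<le> 2 ^ N * (1 + norm (x + t *\<^sub>R b)) ^ N * norm (partial b \<phi> (x + t *\<^sub>R b))"
        by (rule mult_right_mono) simp
      also have "\<dots> \<le> 2 ^ N * C"
        using C[of "x + t *\<^sub>R b"] by (simp add: mult.assoc)
      finally show "norm (partial b \<phi> (x + t *\<^sub>R b)) \<le> ?B"
        using pos by (simp add: field_simps)
    qed (intro continuous_intros)
    then show ?thesis using pos by (simp add: field_simps)
  qed
  show ?thesis using main by (rule that)
qed

text \<open>Integration by parts, without an iterated integral: translation multiplies the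
  Fourier transform by a character, so the Fourier transforms of the difference quotients are explicit, and
  both sides are passed to the limit.\<close>

lemma fourier_fun_partial:
  fixes \<phi> :: "'a::euclidean_space \<Rightarrow> complex"
  assumes \<phi>: "\<phi> \<in> schwartz" and b: "b \<in> Basis"
  shows "fourier_fun (partial b \<phi>) \<zeta> = \<i> * of_real (b \<bullet> \<zeta>) * fourier_fun \<phi> \<zeta>"
proof -
  define h where "h n = 1 / real (Suc n)" for n
  have h: "0 < h n" "h n \<le> 1" for n by (auto simp: h_def)
  have h0: "h \<longlonglongrightarrow> 0" unfolding h_def by (rule LIMSEQ_inverse_real_of_nat[unfolded inverse_eq_divide])
  let ?P = "\<lambda>x::'a. (1 + norm x) ^ (2 * DIM('a))"
  define D where "D n x = (\<phi> (x + h n *\<^sub>R b) - \<phi> x) / of_real (h n)" for n x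
  have [measurable]: "\<phi> \<in> borel_measurable borel" "partial b \<phi> \<in> borel_measurable borel"
    using \<phi> b schwartz_partial by (auto intro: schwartz_measurable)
  have [measurable]: "D n \<in> borel_measurable borel" for n
    unfolding D_def by measurable
  obtain C where C: "\<And>x h. 0 < h \<Longrightarrow> h \<le> 1 \<Longrightarrow> ?P x * norm (\<phi> (x + h *\<^sub>R b) - \<phi> x) \<le> C * h"
    using schwartz_difference_bound[OF \<phi> b] by blast
  have DC: "?P x * norm (D n x) \<le> C" for n x
    using C[OF h, of x n] h[of n] by (simp add: D_def norm_divide field_simps)
  have "(\<lambda>n. fourier_fun (D n) \<zeta>) \<longlonglongrightarrow> fourier_fun (partial b \<phi>) \<zeta>"
    unfolding fourier_fun_wave
  proof (rule integral_dominated_convergence[where w = "\<lambda>x. norm (complex_of_real (C / ?P x))"])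
    have C0: "C \<ge> 0" using DC[of 0 0] norm_ge_zero[of "D 0 0"] by (simp del: norm_ge_zero)
    have "integrable lborel (\<lambda>x::'a. complex_of_real (C / ?P x))"
    proof (rule integrable_if_decay[where C = C])
      show "?P x * norm (complex_of_real (C / ?P x)) \<le> C" for x :: 'a
      proof -
        have "?P x > 0" by (simp add: add_pos_nonneg)
        then show ?thesis using C0 unfolding norm_of_real by simp
      qed
    qed measurable
    then show "integrable lborel (\<lambda>x::'a. norm (complex_of_real (C / ?P x)))" by (rule integrable_norm)
    show "AE x in lborel. norm (wave \<zeta> x * D n x) \<le> norm (complex_of_real (C / ?P x))" for n
    proof (rule AE_I2)
      fix x :: 'a
      have "?P x > 0" by (simp add: add_pos_nonneg)
      then have "norm (D n x) \<le> C / ?P x"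
        using DC[of x n] by (simp add: field_simps)
      then show "norm (wave \<zeta> x * D n x) \<le> norm (complex_of_real (C / ?P x))"
        using C0 by (simp add: norm_mult del: norm_divide of_real_divide)
    qed
    show "AE x in lborel. (\<lambda>n. wave \<zeta> x * D n x) \<longlonglongrightarrow> wave \<zeta> x * partial b \<phi> x"
    proof (intro AE_I2 tendsto_intros)
      fix x
      have "((\<lambda>t. (1 / t) *\<^sub>R (\<phi> (x + t *\<^sub>R b) - \<phi> x)) \<longlongrightarrow> partial b \<phi> x) (at 0)"
        using difference_quotient_tendsto[of "\<lambda>t. \<phi> (x + t *\<^sub>R b)"] schwartz_line_derivative[OF \<phi>, of x b 0] by simp
      moreover have "filterlim h (at 0) sequentially"
        using h0 h by (auto simp: filterlim_at less_imp_neq[symmetric] intro!: always_eventually)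
      ultimately have "(\<lambda>n. (1 / h n) *\<^sub>R (\<phi> (x + h n *\<^sub>R b) - \<phi> x)) \<longlonglongrightarrow> partial b \<phi> x"
        by (rule filterlim_compose)
      then show "(\<lambda>n. D n x) \<longlonglongrightarrow> partial b \<phi> x"
        by (simp add: D_def scaleR_conv_of_real)
    qed
  qed auto
  moreover have "fourier_fun (D n) \<zeta> = (exp (\<i> * of_real (b \<bullet> \<zeta>) * of_real (h n)) - 1) / of_real (h n) * fourier_fun \<phi> \<zeta>" for n
  proof -
    have int: "integrable lborel (\<lambda>x. \<phi> (x + h n *\<^sub>R b))"
      using lborel_integrable_affine[OF schwartz_integrable[OF \<phi>], of 1 "h n *\<^sub>R b"] by (simp add: add.commute)
    have "fourier_fun (D n) \<zeta> = (fourier_fun (\<lambda>x. \<phi> (x + h n *\<^sub>R b)) \<zeta> - fourier_fun \<phi> \<zeta>) / of_real (h n)"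
      using wave_integrable[OF int, of \<zeta>] wave_integrable[OF schwartz_integrable[OF \<phi>], of \<zeta>]
      unfolding fourier_fun_wave D_def by (simp add: right_diff_distrib)
    also have "fourier_fun (\<lambda>x. \<phi> (x + h n *\<^sub>R b)) \<zeta> = exp (\<i> * of_real (b \<bullet> \<zeta>) * of_real (h n)) * fourier_fun \<phi> \<zeta>"
      by (simp add: fourier_fun_translate) (simp add: wave_def mult_ac)
    finally show ?thesis by (simp add: left_diff_distrib)
  qed
  moreover have "(\<lambda>n. (exp (\<i> * of_real (b \<bullet> \<zeta>) * of_real (h n)) - 1) / of_real (h n) * fourier_fun \<phi> \<zeta>) \<longlonglongrightarrow> \<i> * of_real (b \<bullet> \<zeta>) * fourier_fun \<phi> \<zeta>"
  proof (intro tendsto_intros)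
    have "((\<lambda>z. exp (\<i> * of_real (b \<bullet> \<zeta>) * z)) has_field_derivative \<i> * of_real (b \<bullet> \<zeta>)) (at 0)"
      by (auto intro!: derivative_eq_intros)
    then have "((\<lambda>z. (exp (\<i> * of_real (b \<bullet> \<zeta>) * z) - 1) / z) \<longlongrightarrow> \<i> * of_real (b \<bullet> \<zeta>)) (at 0)"
      by (simp add: DERIV_def)
    moreover have "filterlim (\<lambda>n. complex_of_real (h n)) (at 0) sequentially"
      using tendsto_of_real[OF h0, where 'a = complex] h by (auto simp: filterlim_at less_imp_neq[symmetric] intro!: always_eventually)
    ultimately show "(\<lambda>n. (exp (\<i> * of_real (b \<bullet> \<zeta>) * of_real (h n)) - 1) / of_real (h n)) \<longlonglongrightarrow> \<i> * of_real (b \<bullet> \<zeta>)"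
      by (rule filterlim_compose)
  qed
  ultimately show ?thesis
    by (simp add: LIMSEQ_unique)
qed

lemma exp_taylor_1: "norm (exp (- (\<i> * of_real s)) - 1 + \<i> * of_real s) \<le> s\<^sup>2"
  using Taylor_exp[of "- (\<i> * of_real s)" 1] by (simp add: norm_mult power2_eq_square algebra_simps)

text \<open>Differentiation under the integral. The remainder of the character is quadratic in the increment,
  with a factor \<open>|x|\<^sup>2\<close> that the Schwartz function absorbs.\<close>

lemma fourier_fun_has_derivative:
  fixes \<phi> :: "'a::euclidean_space \<Rightarrow> complex"
  assumes \<phi>: "\<phi> \<in> schwartz"
  shows "(fourier_fun \<phi> has_derivative (\<lambda>h. fourier_fun (\<lambda>x. - \<i> * (of_real (x \<bullet> h) * \<phi> x)) \<zeta>)) (at \<zeta>)"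
proof -
  let ?\<psi> = "\<lambda>h x. - \<i> * (of_real (x \<bullet> h) * \<phi> x)"
  have S: "?\<psi> h \<in> schwartz" for h
    by (intro schwartz_cmult schwartz_coordinate \<phi>)
  note Sint = wave_integrable[OF schwartz_integrable[OF S]]
  note pint = wave_integrable[OF schwartz_integrable[OF \<phi>]]
  define K where "K = (\<integral>x. (norm x)\<^sup>2 * norm (\<phi> x) \<partial>lborel)"
  have Kint: "integrable lborel (\<lambda>x. (norm x)\<^sup>2 * norm (\<phi> x))"
  proof -
    obtain C where C: "\<And>x. (1 + norm x) ^ (2 * DIM('a) + 2) * norm (\<phi> x) \<le> C"
      using schwartz_bound[OF \<phi>] by metis
    have "integrable lborel (\<lambda>x. of_real ((norm x)\<^sup>2) * \<phi> x)"
    proof (rule integrable_if_decay[where C = C])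
      fix x :: 'a
      have "(norm x)\<^sup>2 \<le> (1 + norm x)\<^sup>2" by (intro power_mono) auto
      then have "(1 + norm x) ^ (2 * DIM('a)) * ((norm x)\<^sup>2 * norm (\<phi> x)) \<le> (1 + norm x) ^ (2 * DIM('a)) * ((1 + norm x)\<^sup>2 * norm (\<phi> x))"
        by (intro mult_left_mono mult_right_mono) auto
      also have "\<dots> = (1 + norm x) ^ (2 * DIM('a) + 2) * norm (\<phi> x)" by (simp only: power_add mult.assoc)
      also have "\<dots> \<le> C" by (rule C)
      finally show "(1 + norm x) ^ (2 * DIM('a)) * norm (of_real ((norm x)\<^sup>2) * \<phi> x) \<le> C"
        by (simp add: norm_mult norm_power)
    qed (use schwartz_measurable[OF \<phi>] in measurable)
    from integrable_norm[OF this] show ?thesis by (simp add: norm_mult norm_power)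
  qed
  show ?thesis
  proof (rule has_derivativeI_sandwich[where e = 1 and H = "\<lambda>\<eta>. norm (\<eta> - \<zeta>) * K"])
    show "bounded_linear (\<lambda>h. fourier_fun (?\<psi> h) \<zeta>)"
      unfolding linear_conv_bounded_linear[symmetric]
    proof (rule linearI)
      fix h k
      show "fourier_fun (?\<psi> (h + k)) \<zeta> = fourier_fun (?\<psi> h) \<zeta> + fourier_fun (?\<psi> k) \<zeta>"
        unfolding fourier_fun_wave Bochner_Integration.integral_add[OF Sint[of \<zeta> h] Sint[of \<zeta> k], symmetric]
        by (rule arg_cong[where f = "integral\<^sup>L lborel"]) (auto simp: fun_eq_iff inner_add_right algebra_simps)
      fix r :: real
      show "fourier_fun (?\<psi> (r *\<^sub>R h)) \<zeta> = r *\<^sub>R fourier_fun (?\<psi> h) \<zeta>"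
        unfolding scaleR_conv_of_real fourier_fun_cmult[symmetric]
        by (rule arg_cong[where f = "\<lambda>f. fourier_fun f \<zeta>"]) (auto simp: fun_eq_iff)
    qed
    show "((\<lambda>\<eta>. norm (\<eta> - \<zeta>) * K) \<longlongrightarrow> 0) (at \<zeta> within UNIV)"
      by (rule tendsto_eq_intros refl tendsto_norm_zero | simp)+
    fix \<eta> assume "\<eta> \<noteq> \<zeta>"
    define h where "h = \<eta> - \<zeta>"
    let ?r = "\<lambda>x. wave \<eta> x * \<phi> x - wave \<zeta> x * \<phi> x - wave \<zeta> x * ?\<psi> h x"
    have "fourier_fun \<phi> \<eta> - fourier_fun \<phi> \<zeta> - fourier_fun (?\<psi> h) \<zeta>
        = (\<integral>x. (?r x) \<partial>lborel)"
      unfolding fourier_fun_wave using Sint[of \<zeta> h] pint[of \<zeta>] pint[of \<eta>] by simp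
    also have "norm \<dots> \<le> (\<integral>x. (norm h)\<^sup>2 * ((norm x)\<^sup>2 * norm (\<phi> x)) \<partial>lborel)"
    proof (rule order_trans[OF integral_norm_bound integral_mono])
      show "integrable lborel (\<lambda>x. norm (?r x))"
        by (intro integrable_norm Bochner_Integration.integrable_diff Sint pint)
      show "integrable lborel (\<lambda>x. (norm h)\<^sup>2 * ((norm x)\<^sup>2 * norm (\<phi> x)))"
        using Kint by auto
      fix x
      have "wave \<eta> x = wave \<zeta> x * exp (- (\<i> * of_real (x \<bullet> h)))"
        using wave_add_left[of \<zeta> h x] by (simp add: h_def wave_def)
      then have "?r x
          = wave \<zeta> x * ((exp (- (\<i> * of_real (x \<bullet> h))) - 1 + \<i> * of_real (x \<bullet> h)) * \<phi> x)"
        by (simp add: algebra_simps)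
      moreover have "norm (exp (- (\<i> * of_real (x \<bullet> h))) - 1 + \<i> * of_real (x \<bullet> h)) \<le> (norm h)\<^sup>2 * (norm x)\<^sup>2"
      proof (rule order_trans[OF exp_taylor_1])
        have "\<bar>x \<bullet> h\<bar>\<^sup>2 \<le> (norm x * norm h)\<^sup>2"
          by (intro power_mono Cauchy_Schwarz_ineq2) auto
        then show "(x \<bullet> h)\<^sup>2 \<le> (norm h)\<^sup>2 * (norm x)\<^sup>2" by (simp add: power_mult_distrib mult.commute)
      qed
      ultimately show "norm (?r x) \<le> (norm h)\<^sup>2 * ((norm x)\<^sup>2 * norm (\<phi> x))"
        by (simp only: norm_mult norm_wave mult_1 mult.assoc[symmetric]) (rule mult_right_mono, auto)
    qed
    also have "\<dots> = (norm h)\<^sup>2 * K" unfolding K_def by simp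
    finally show "norm (fourier_fun \<phi> \<eta> - fourier_fun \<phi> \<zeta> - fourier_fun (?\<psi> (\<eta> - \<zeta>)) \<zeta>) / norm (\<eta> - \<zeta>) \<le> norm (\<eta> - \<zeta>) * K"
      using \<open>\<eta> \<noteq> \<zeta>\<close> by (simp add: h_def divide_le_eq power2_eq_square mult_ac)
  qed auto
qed

lemma partial_fourier_fun:
  assumes "\<phi> \<in> schwartz"
  shows "partial b (fourier_fun \<phi>) = fourier_fun (\<lambda>x. - \<i> * (of_real (x \<bullet> b) * \<phi> x))"
  by (rule ext) (rule partial_eq_derivative[OF fourier_fun_has_derivative[OF assms]])

text \<open>Induction on \<open>N\<close>: by \<open>fourier_fun_partial\<close>, each factor \<open>|\<zeta> \<bullet> b|\<close> becomes a derivative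
  of the function under the transform.\<close>

lemma fourier_fun_decay:
  fixes \<phi> :: "'a::euclidean_space \<Rightarrow> complex"
  assumes "\<phi> \<in> schwartz"
  shows "\<exists>C. \<forall>\<zeta>. (1 + norm \<zeta>) ^ N * norm (fourier_fun \<phi> \<zeta>) \<le> C"
  using assms
proof (induction N arbitrary: \<phi>)
  case 0
  then show ?case using fourier_fun_bound[of \<phi>] by auto
next
  case (Suc N)
  obtain C0 where C0: "\<And>\<zeta>. (1 + norm \<zeta>) ^ N * norm (fourier_fun \<phi> \<zeta>) \<le> C0" 
    using Suc by metis
  have "\<forall>b. \<exists>C. b \<in> Basis \<longrightarrow> (\<forall>\<zeta>. (1 + norm \<zeta>) ^ N * norm (fourier_fun (partial b \<phi>) \<zeta>) \<le> C)"
    using Suc schwartz_partial by metis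
  then obtain C where C: "\<And>b \<zeta>. b \<in> Basis \<Longrightarrow> (1 + norm \<zeta>) ^ N * norm (fourier_fun (partial b \<phi>) \<zeta>) \<le> C b" 
    by metis
  have "(1 + norm \<zeta>) ^ Suc N * norm (fourier_fun \<phi> \<zeta>) \<le> C0 + (\<Sum>b\<in>Basis. C b)" for \<zeta>
  proof -
    have "1 + norm \<zeta> \<le> 1 + (\<Sum>b\<in>Basis. \<bar>\<zeta> \<bullet> b\<bar>)" using norm_le_l1[of \<zeta>] by simp
    then have "(1 + norm \<zeta>) * ((1 + norm \<zeta>) ^ N * norm (fourier_fun \<phi> \<zeta>)) \<le> (1 + (\<Sum>b\<in>Basis. \<bar>\<zeta> \<bullet> b\<bar>)) * ((1 + norm \<zeta>) ^ N * norm (fourier_fun \<phi> \<zeta>))"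
      by (rule mult_right_mono) auto
    also have "\<dots> = (1 + norm \<zeta>) ^ N * norm (fourier_fun \<phi> \<zeta>) + (\<Sum>b\<in>Basis. (1 + norm \<zeta>) ^ N * norm (fourier_fun (partial b \<phi>) \<zeta>))"
      by (simp add: fourier_fun_partial[OF Suc.prems] norm_mult inner_commute algebra_simps sum_distrib_left)
    also have "\<dots> \<le> C0 + (\<Sum>b\<in>Basis. C b)"
      by (intro add_mono sum_mono C C0)
    finally show ?thesis by (simp add: mult.assoc)
  qed
  then show ?case by blast
qed

lemma fourier_fun_schwartz:
  fixes \<phi> :: "'a::euclidean_space \<Rightarrow> complex"
  assumes "\<phi> \<in> schwartz"
  shows "fourier_fun \<phi> \<in> schwartz"
proof (rule schwartz_coinduct[where X = "fourier_fun ` schwartz"])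
  fix \<kappa> :: "'a \<Rightarrow> complex" and b :: 'a
  assume "\<kappa> \<in> fourier_fun ` schwartz"
  then obtain \<psi> where *: "\<psi> \<in> schwartz" and \<kappa>: "\<kappa> = fourier_fun \<psi>" by auto
  show "rapidly_decreasing \<kappa>"
    unfolding \<kappa> by (rule rapidly_decreasingI[OF fourier_fun_has_derivative[OF *] fourier_fun_decay[OF *]])
  show "partial b \<kappa> \<in> fourier_fun ` schwartz"
    unfolding \<kappa> partial_fourier_fun[OF *] by (intro imageI schwartz_cmult schwartz_coordinate *)
qed (use assms in auto)

section \<open>Gaussian averages and Fourier inversion\<close>

text \<open>Equal to \<open>(2 \<pi>) powr (DIM('a) / 2)\<close>.\<close>

definition gauss_mass :: "'a::euclidean_space itself \<Rightarrow> real" where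
  "gauss_mass _ = (\<integral>x. gauss x \<partial>(lborel :: 'a measure))"

lemma gauss_integrable_complex: "integrable lborel (\<lambda>x. complex_of_real (gauss x))"
  by (rule schwartz_integrable[OF gauss_schwartz])

lemma gauss_integrable [intro]: "integrable lborel (gauss :: 'a::euclidean_space \<Rightarrow> real)"
  using gauss_integrable_complex unfolding complex_of_real_integrable_eq .

lemma gauss_mass_pos: "gauss_mass TYPE('a::euclidean_space) > 0"
proof -
  have "gauss_mass TYPE('a) \<noteq> 0"
  proof
    assume "gauss_mass TYPE('a) = 0"
    then have "AE x in (lborel :: 'a measure). gauss x = 0"
      unfolding gauss_mass_def
      by (subst (asm) integral_nonneg_eq_0_iff_AE) (auto intro: less_imp_le[OF gauss_pos])
    then have "AE x in (lborel :: 'a measure). False"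
      using less_imp_neq[OF gauss_pos] by auto
    then show False
      unfolding AE_iff_null_sets[symmetric] by (simp add: trivial_limit_def[symmetric] ae_filter_eq_bot_iff)
  qed
  moreover have "gauss_mass TYPE('a) \<ge> 0"
    unfolding gauss_mass_def by (intro Bochner_Integration.integral_nonneg less_imp_le[OF gauss_pos])
  ultimately show ?thesis by simp
qed

text \<open>The partial derivatives of the Gaussian are minus the coordinates times the Gaussian. The Fourier transform turns
  this first order system into itself, so the quotient of the transform and the Gaussian has derivative zero.\<close>

lemma fourier_gauss:
  "fourier_fun (\<lambda>x. complex_of_real (gauss x)) \<zeta> = of_real (gauss_mass TYPE('a) * gauss (\<zeta>::'a::euclidean_space))"
proof -
  let ?G = "\<lambda>x::'a. complex_of_real (gauss x)"
  define K where "K \<zeta> = fourier_fun ?G \<zeta> * of_real (inverse (gauss \<zeta>))" for \<zeta>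
  have gi: "((\<lambda>x. complex_of_real (inverse (gauss x))) has_derivative (\<lambda>h. of_real ((x \<bullet> h) * inverse (gauss x)))) (at x)" for x :: 'a
  proof (rule has_derivative_of_real)
    show "((\<lambda>x. inverse (gauss x)) has_derivative (\<lambda>h. (x \<bullet> h) * inverse (gauss x))) (at x)"
      unfolding gauss_def[abs_def] exp_minus[symmetric]
      by (auto intro!: derivative_eq_intros simp: inner_commute algebra_simps)
  qed
  have "(K has_derivative (\<lambda>h. 0)) (at \<zeta>)" for \<zeta>
  proof -
    note D = has_derivative_mult[OF fourier_fun_has_derivative[OF gauss_schwartz] gi, of \<zeta>]
    let ?D = "\<lambda>h. fourier_fun ?G \<zeta> * of_real ((\<zeta> \<bullet> h) * inverse (gauss \<zeta>)) + fourier_fun (\<lambda>x. - \<i> * (of_real (x \<bullet> h) * ?G x)) \<zeta> * of_real (inverse (gauss \<zeta>))"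
    have "?D b = 0" if b: "b \<in> Basis" for b
    proof -
      have "fourier_fun (\<lambda>x. - \<i> * (of_real (x \<bullet> b) * ?G x)) \<zeta> = \<i> * fourier_fun (partial b ?G) \<zeta>"
        unfolding partial_gauss fourier_fun_cmult by simp
      also have "\<dots> = - (of_real (b \<bullet> \<zeta>) * fourier_fun ?G \<zeta>)"
        unfolding fourier_fun_partial[OF gauss_schwartz b] mult.assoc[symmetric] by simp
      finally show ?thesis by (simp add: inner_commute)
    qed
    then have "?D = (\<lambda>h. 0)"
      by (intro linear_eq_stdbasis[OF has_derivative_linear[OF D]]) (auto simp: linear_zero)
    then show ?thesis using D unfolding K_def[abs_def] by simp
  qed
  then have "K \<zeta> = K 0"
    by (intro has_derivative_zero_unique[of UNIV K]) auto
  moreover have "K 0 = of_real (gauss_mass TYPE('a))"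
    by (simp add: K_def fourier_fun_def gauss_mass_def) (simp add: gauss_def)
  ultimately show ?thesis
    using gauss_pos[of \<zeta>] by (simp add: K_def[of \<zeta>] field_simps)
qed

lemma gauss_scaled_integrable:
  fixes x :: "'a::euclidean_space"
  assumes "c \<noteq> 0" shows "integrable lborel (\<lambda>z. complex_of_real (gauss (x + c *\<^sub>R z)))"
  by (rule lborel_integrable_affine[OF gauss_integrable_complex assms])

lemma fourier_gauss_modulated:
  fixes x y :: "'a::euclidean_space"
  assumes "\<epsilon> > 0"
  shows "of_real (\<epsilon> ^ DIM('a)) * fourier_fun (\<lambda>\<zeta>. of_real (gauss (\<epsilon> *\<^sub>R \<zeta>)) * wave (- x) \<zeta>) y
    = of_real (gauss_mass TYPE('a) * gauss ((1 / \<epsilon>) *\<^sub>R (y - x)))"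
proof -
  have "fourier_fun (\<lambda>\<zeta>. complex_of_real (gauss \<zeta>)) ((1 / \<epsilon>) *\<^sub>R (y - x))
      = of_real (\<epsilon> ^ DIM('a)) * (\<integral>\<zeta>. wave ((1 / \<epsilon>) *\<^sub>R (y - x)) (\<epsilon> *\<^sub>R \<zeta>) * of_real (gauss (\<epsilon> *\<^sub>R \<zeta>)) \<partial>lborel)"
    unfolding fourier_fun_wave using assms
    by (subst lborel_integral_affine[where c = \<epsilon> and t = 0]) auto
  also have "(\<lambda>\<zeta>. wave ((1 / \<epsilon>) *\<^sub>R (y - x)) (\<epsilon> *\<^sub>R \<zeta>)) = (\<lambda>\<zeta>. wave y \<zeta> * wave (- x) \<zeta>)"
    using assms by (auto simp: fun_eq_iff wave_add_left[symmetric]) (simp add: wave_def)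
  finally show ?thesis
    unfolding fourier_gauss by (simp add: fourier_fun_wave mult_ac)
qed

text \<open>The multiplication formula, applied to a modulated Gaussian of width \<open>1 / \<epsilon>\<close>. In this form it also shows
  that a function with vanishing Fourier transform is orthogonal to all translates of Gaussians.\<close>

lemma fourier_against_gauss:
  fixes \<psi> :: "'a::euclidean_space \<Rightarrow> complex"
  assumes \<psi>: "integrable lborel \<psi>" and \<epsilon>: "\<epsilon> > 0"
  shows "of_real (\<epsilon> ^ DIM('a)) * (\<integral>\<zeta>. fourier_fun \<psi> \<zeta> * of_real (gauss (\<epsilon> *\<^sub>R \<zeta>)) * wave (- x) \<zeta> \<partial>lborel)
    = of_real (gauss_mass TYPE('a)) * (\<integral>y. \<psi> y * of_real (gauss ((1 / \<epsilon>) *\<^sub>R (y - x))) \<partial>lborel)"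
proof -
  have g: "integrable lborel (\<lambda>\<zeta>. of_real (gauss (\<epsilon> *\<^sub>R \<zeta>)) * wave (- x) \<zeta>)"
    using wave_integrable[OF gauss_scaled_integrable[of \<epsilon> 0], of "- x"] \<epsilon> by (simp add: mult.commute)
  have "(\<integral>\<zeta>. fourier_fun \<psi> \<zeta> * of_real (gauss (\<epsilon> *\<^sub>R \<zeta>)) * wave (- x) \<zeta> \<partial>lborel)
     = (\<integral>y. \<psi> y * fourier_fun (\<lambda>\<zeta>. of_real (gauss (\<epsilon> *\<^sub>R \<zeta>)) * wave (- x) \<zeta>) y \<partial>lborel)"
    using fourier_fun_multiplication[OF g \<psi>] by (simp add: mult_ac)
  also have "of_real (\<epsilon> ^ DIM('a)) * \<dots> = (\<integral>y. \<psi> y * (of_real (\<epsilon> ^ DIM('a)) * fourier_fun (\<lambda>\<zeta>. of_real (gauss (\<epsilon> *\<^sub>R \<zeta>)) * wave (- x) \<zeta>) y) \<partial>lborel)"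
    by (simp add: mult.left_commute flip: integral_mult_right_zero)
  also have "\<dots> = of_real (gauss_mass TYPE('a)) * (\<integral>y. \<psi> y * of_real (gauss ((1 / \<epsilon>) *\<^sub>R (y - x))) \<partial>lborel)"
    unfolding fourier_gauss_modulated[OF \<epsilon>] by (simp add: mult_ac flip: integral_mult_right_zero)
  finally show ?thesis .
qed

text \<open>The convolution with a Gaussian of width \<open>\<epsilon>\<close>, not normalised. Written in this way the
  limit \<open>\<epsilon> \<rightarrow> 0\<close> is a dominated convergence against a fixed Gaussian.\<close>

abbreviation gauss_average :: "real \<Rightarrow> ('a::euclidean_space \<Rightarrow> complex) \<Rightarrow> 'a \<Rightarrow> complex" where
  "gauss_average \<epsilon> f x \<equiv> \<integral>z. f (x + \<epsilon> *\<^sub>R z) * of_real (gauss z) \<partial>lborel"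

lemma null_sequence: obtains \<epsilon> :: "nat \<Rightarrow> real" where "\<And>n. \<epsilon> n > 0" "\<epsilon> \<longlonglongrightarrow> 0"
  using LIMSEQ_inverse_real_of_nat that[of "\<lambda>n. inverse (real (Suc n))"] by simp

lemma gauss_convolution:
  fixes \<psi> :: "'a::euclidean_space \<Rightarrow> complex"
  assumes [measurable]: "\<psi> \<in> borel_measurable borel" and \<epsilon>: "\<epsilon> > 0"
  shows "(\<integral>y. \<psi> y * of_real (gauss ((1 / \<epsilon>) *\<^sub>R (y - x))) \<partial>lborel)
    = of_real (\<epsilon> ^ DIM('a)) * gauss_average \<epsilon> \<psi> x"
  using \<epsilon> by (subst lborel_integral_affine[where c = \<epsilon> and t = x]) auto

text \<open>Inserting a Gaussian that is nearly constant into the inversion integral gives a local average of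
  the function. Inversion and the \<open>L\<^sup>2\<close> bound rest on this identity.\<close>

lemma fourier_smoothing:
  fixes \<psi> :: "'a::euclidean_space \<Rightarrow> complex"
  assumes \<psi>: "integrable lborel \<psi>" and \<epsilon>: "\<epsilon> > 0"
  shows "(\<integral>\<zeta>. fourier_fun \<psi> \<zeta> * of_real (gauss (\<epsilon> *\<^sub>R \<zeta>)) * wave (- x) \<zeta> \<partial>lborel)
    = of_real (gauss_mass TYPE('a)) * gauss_average \<epsilon> \<psi> x"
  using fourier_against_gauss[OF assms, of x] gauss_convolution[of \<psi> \<epsilon> x] assms by auto

lemma gauss_smoothing_tendsto:
  fixes f :: "'a::euclidean_space \<Rightarrow> complex"
  assumes cont: "continuous_on UNIV f" and bound: "\<And>x. norm (f x) \<le> B" and \<epsilon>: "\<epsilon> \<longlonglongrightarrow> 0"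
  shows "(\<lambda>n. gauss_average (\<epsilon> n) f x) \<longlonglongrightarrow> of_real (gauss_mass TYPE('a)) * f x"
proof -
  have [measurable]: "f \<in> borel_measurable borel" by (rule borel_measurable_continuous_onI[OF cont])
  have "(\<lambda>n. gauss_average (\<epsilon> n) f x) \<longlonglongrightarrow> (\<integral>z. f x * of_real (gauss z) \<partial>(lborel :: 'a measure))"
  proof (rule integral_dominated_convergence[where w = "\<lambda>z::'a. B * gauss z"])
    show "AE z in lborel. (\<lambda>n. f (x + \<epsilon> n *\<^sub>R z) * of_real (gauss z)) \<longlonglongrightarrow> f x * of_real (gauss z)"
    proof (intro AE_I2 tendsto_intros)
      fix z
      have "(\<lambda>n. x + \<epsilon> n *\<^sub>R z) \<longlonglongrightarrow> x + 0 *\<^sub>R z" by (intro tendsto_intros \<epsilon>)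
      then show "(\<lambda>n. f (x + \<epsilon> n *\<^sub>R z)) \<longlonglongrightarrow> f x"
        by (intro continuous_on_tendsto_compose[OF cont]) auto
    qed
    show "AE z in lborel. norm (f (x + \<epsilon> n *\<^sub>R z) * of_real (gauss z)) \<le> B * gauss z" for n
      by (intro AE_I2) (simp add: norm_mult bound mult_right_mono less_imp_le[OF gauss_pos] abs_of_pos[OF gauss_pos])
    show "integrable lborel (\<lambda>z. B * gauss z)" by auto
  qed auto
  then show ?thesis by (simp add: gauss_mass_def mult.commute)
qed

lemma gauss_scaled_tendsto:
  assumes "\<epsilon> \<longlonglongrightarrow> 0" shows "(\<lambda>n. gauss (\<epsilon> n *\<^sub>R x)) \<longlonglongrightarrow> 1"
proof -
  have "(\<lambda>n. exp (- ((\<epsilon> n *\<^sub>R x) \<bullet> (\<epsilon> n *\<^sub>R x)) / 2)) \<longlonglongrightarrow> exp (- ((0 *\<^sub>R x) \<bullet> (0 *\<^sub>R x)) / 2)"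
    by (intro tendsto_intros assms) auto
  then show ?thesis by (simp add: gauss_def)
qed

text \<open>Both sides of \<open>fourier_smoothing\<close> converge when the inserted Gaussian tends to \<open>1\<close>.\<close>

lemma fourier_inversion:
  fixes \<psi> :: "'a::euclidean_space \<Rightarrow> complex"
  assumes \<psi>: "\<psi> \<in> schwartz"
  shows "fourier_fun (fourier_fun \<psi>) (- x) = of_real ((gauss_mass TYPE('a))\<^sup>2) * \<psi> x"
proof -
  obtain \<epsilon> :: "nat \<Rightarrow> real" where \<epsilon>: "\<And>n. \<epsilon> n > 0" and \<epsilon>0: "\<epsilon> \<longlonglongrightarrow> 0"
    using null_sequence by blast
  note F = schwartz_integrable[OF fourier_fun_schwartz[OF \<psi>]]
  obtain B where B: "\<And>x. norm (\<psi> x) \<le> B" using schwartz_bound[OF \<psi>, of 0] by auto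
  have "(\<lambda>n. \<integral>\<zeta>. fourier_fun \<psi> \<zeta> * of_real (gauss (\<epsilon> n *\<^sub>R \<zeta>)) * wave (- x) \<zeta> \<partial>lborel) \<longlonglongrightarrow> (\<integral>\<zeta>. fourier_fun \<psi> \<zeta> * of_real 1 * wave (- x) \<zeta> \<partial>lborel)"
  proof (rule integral_dominated_convergence[where w = "\<lambda>\<zeta>. norm (fourier_fun \<psi> \<zeta>)"])
    show "AE \<zeta> in lborel. (\<lambda>n. fourier_fun \<psi> \<zeta> * of_real (gauss (\<epsilon> n *\<^sub>R \<zeta>)) * wave (- x) \<zeta>) \<longlonglongrightarrow> fourier_fun \<psi> \<zeta> * of_real 1 * wave (- x) \<zeta>"
      by (intro AE_I2 tendsto_intros gauss_scaled_tendsto \<epsilon>0)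
    show "AE \<zeta> in lborel. norm (fourier_fun \<psi> \<zeta> * of_real (gauss (\<epsilon> n *\<^sub>R \<zeta>)) * wave (- x) \<zeta>) \<le> norm (fourier_fun \<psi> \<zeta>)" for n
      by (intro AE_I2) (simp add: norm_mult abs_of_pos[OF gauss_pos] gauss_le_1 mult_left_le)
  qed (use F schwartz_measurable[OF \<psi>] in auto)
  moreover have "(\<lambda>n. \<integral>\<zeta>. fourier_fun \<psi> \<zeta> * of_real (gauss (\<epsilon> n *\<^sub>R \<zeta>)) * wave (- x) \<zeta> \<partial>lborel) \<longlonglongrightarrow> of_real (gauss_mass TYPE('a)) * (of_real (gauss_mass TYPE('a)) * \<psi> x)"
    unfolding fourier_smoothing[OF schwartz_integrable[OF \<psi>] \<epsilon>]
    by (intro tendsto_intros gauss_smoothing_tendsto[OF schwartz_continuous[OF \<psi>] B \<epsilon>0])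
  ultimately show ?thesis
    by (simp add: LIMSEQ_unique fourier_fun_wave[of "fourier_fun \<psi>"] power2_eq_square mult_ac)
qed

section \<open>Uniqueness of densities\<close>

text \<open>The averages of the test function over Gaussians are superpositions of translated Gaussians, to
  which the given function is orthogonal; they converge boundedly to the test function.\<close>

lemma zero_fourier_orthogonal:
  fixes \<psi> \<kappa> :: "'a::euclidean_space \<Rightarrow> complex"
  assumes \<psi>: "integrable lborel \<psi>" and zero: "\<And>\<zeta>. fourier_fun \<psi> \<zeta> = 0"
    and \<kappa>: "integrable lborel \<kappa>" "continuous_on UNIV \<kappa>" "\<And>x. norm (\<kappa> x) \<le> B"
  shows "(\<integral>y. \<psi> y * \<kappa> y \<partial>lborel) = 0"
proof -
  obtain \<epsilon> :: "nat \<Rightarrow> real" where \<epsilon>: "\<And>n. \<epsilon> n > 0" and \<epsilon>0: "\<epsilon> \<longlonglongrightarrow> 0"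
    using null_sequence by blast
  have [measurable]: "\<psi> \<in> borel_measurable borel" "\<kappa> \<in> borel_measurable borel"
    using \<psi> \<kappa> by auto
  have Bnn: "B \<ge> 0" using \<kappa>(3)[of 0] norm_ge_zero order_trans by blast
  have "(\<integral>y. \<psi> y * gauss_average (\<epsilon> n) \<kappa> y \<partial>lborel) = 0" for n
  proof -
    let ?k = "\<lambda>x y::'a. complex_of_real (gauss ((1 / \<epsilon> n) *\<^sub>R (y - x)))"
    have "(\<integral>x. \<kappa> x * (\<integral>y. ?k x y * \<psi> y \<partial>lborel) \<partial>lborel) = (\<integral>y. \<psi> y * (\<integral>x. ?k x y * \<kappa> x \<partial>lborel) \<partial>lborel)"
      by (rule Fubini_mult[OF \<kappa>(1) \<psi>, where B = 1]) (auto simp: gauss_le_1 abs_of_pos[OF gauss_pos] split_beta')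
    moreover have "(\<integral>y. ?k x y * \<psi> y \<partial>lborel) = 0" for x
      using fourier_against_gauss[OF \<psi> \<epsilon>, of n x] gauss_mass_pos[where 'a = 'a] by (simp add: zero mult.commute)
    moreover have "(\<integral>x. ?k x y * \<kappa> x \<partial>lborel) = of_real (\<epsilon> n ^ DIM('a)) * gauss_average (\<epsilon> n) \<kappa> y" for y
    proof -
      have "gauss ((1 / \<epsilon> n) *\<^sub>R (y - x)) = gauss ((1 / \<epsilon> n) *\<^sub>R (x - y))" for x
        by (metis gauss_uminus minus_diff_eq scaleR_minus_right)
      then show ?thesis
        using gauss_convolution[OF _ \<epsilon>, of \<kappa> n y] by (simp add: mult.commute)
    qed
    ultimately have "of_real (\<epsilon> n ^ DIM('a)) * (\<integral>y. \<psi> y * gauss_average (\<epsilon> n) \<kappa> y \<partial>lborel) = 0"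
      by (simp add: mult.left_commute[of "\<psi> _"])
    then show ?thesis using \<epsilon>[of n] by simp
  qed
  moreover have "(\<lambda>n. \<integral>y. \<psi> y * gauss_average (\<epsilon> n) \<kappa> y \<partial>lborel)
      \<longlonglongrightarrow> (\<integral>y. \<psi> y * (of_real (gauss_mass TYPE('a)) * \<kappa> y) \<partial>lborel)"
  proof (rule integral_dominated_convergence[where w = "\<lambda>y. norm (\<psi> y) * (B * gauss_mass TYPE('a))"])
    show "AE y in lborel. (\<lambda>n. \<psi> y * gauss_average (\<epsilon> n) \<kappa> y) \<longlonglongrightarrow> \<psi> y * (of_real (gauss_mass TYPE('a)) * \<kappa> y)"
      by (intro AE_I2 tendsto_intros gauss_smoothing_tendsto[OF \<kappa>(2,3) \<epsilon>0])
    have "norm (gauss_average (\<epsilon> n) \<kappa> y) \<le> B * gauss_mass TYPE('a)" for y n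
    proof -
      have "norm (gauss_average (\<epsilon> n) \<kappa> y) \<le> (\<integral>z. norm (\<kappa> (y + \<epsilon> n *\<^sub>R z) * of_real (gauss z)) \<partial>lborel)"
        by (rule integral_norm_bound)
      also have "\<dots> \<le> (\<integral>z. B * gauss z \<partial>(lborel :: 'a measure))"
        by (rule Bochner_Integration.integral_mono')
           (auto simp: norm_mult \<kappa>(3) mult_right_mono less_imp_le[OF gauss_pos] abs_of_pos[OF gauss_pos] Bnn)
      finally show ?thesis by (simp add: gauss_mass_def)
    qed
    then show "AE y in lborel. norm (\<psi> y * gauss_average (\<epsilon> n) \<kappa> y) \<le> norm (\<psi> y) * (B * gauss_mass TYPE('a))" for n
      by (intro AE_I2) (simp add: norm_mult mult_left_mono)
    show "integrable lborel (\<lambda>y. norm (\<psi> y) * (B * gauss_mass TYPE('a)))" using \<psi> by auto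
  qed measurable
  ultimately have "(\<integral>y. \<psi> y * (of_real (gauss_mass TYPE('a)) * \<kappa> y) \<partial>lborel) = 0"
    by (simp add: LIMSEQ_const_iff)
  then show ?thesis
    using gauss_mass_pos[where 'a = 'a] by (simp add: mult.left_commute[of "\<psi> _"])
qed

lemma open_indicator_approx:
  fixes U :: "'a::euclidean_space set"
  assumes "open U"
  obtains f :: "nat \<Rightarrow> 'a \<Rightarrow> real" where "\<And>n. continuous_on UNIV (f n)" "\<And>n x. 0 \<le> f n x" "\<And>n x. f n x \<le> 1"
    "\<And>x. (\<lambda>n. f n x) \<longlonglongrightarrow> indicator U x"
proof (cases "U = UNIV")
  case True
  then show ?thesis by (intro that[of "\<lambda>n x. 1"]) auto
next
  case False
  define f where "f n x = min 1 (real n * infdist x (- U))" for n x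
  have "(\<lambda>n. f n x) \<longlonglongrightarrow> indicator U x" for x
  proof (cases "x \<in> U")
    case True
    have "closed (- U)" using assms by auto
    then have d: "infdist x (- U) > 0"
      using True False in_closed_iff_infdist_zero[of "- U" x] infdist_nonneg[of x "- U"] by fastforce
    then obtain N :: nat where N: "1 < real N * infdist x (- U)" using ex_less_of_nat_mult by blast
    have "\<forall>\<^sub>F n in sequentially. f n x = indicator U x"
    proof (rule eventually_sequentiallyI)
      fix n assume "n \<ge> N"
      then have "real N * infdist x (- U) \<le> real n * infdist x (- U)" using d by (intro mult_right_mono) auto
      then show "f n x = indicator U x" using N True by (simp add: f_def)
    qed
    then show ?thesis by (rule tendsto_eventually)
  next
    case False
    then have "f n x = 0" for n by (simp add: f_def)
    then show ?thesis using False by simp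
  qed
  moreover have "continuous_on UNIV (f n)" for n
    unfolding f_def by (intro continuous_intros)
  ultimately show ?thesis by (intro that[of f]) (auto simp: f_def infdist_nonneg)
qed

text \<open>Continuous functions approximate indicators of open sets, open sets generate the Borel sets, and a function
  whose integral over every measurable set vanishes is zero almost everywhere. Multiplying by the Gaussian makes
  the test functions integrable.\<close>

lemma fourier_fun_zero_imp_AE_zero:
  fixes \<psi> :: "'a::euclidean_space \<Rightarrow> complex"
  assumes \<psi>: "integrable lborel \<psi>" and zero: "\<And>\<zeta>. fourier_fun \<psi> \<zeta> = 0"
  shows "AE x in lborel. \<psi> x = 0"
proof -
  define D where "D x = \<psi> x * of_real (gauss x)" for x
  have [measurable]: "\<psi> \<in> borel_measurable borel" using \<psi> by auto
  have D: "integrable lborel D"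
    using integrable_bounded_mult[OF \<psi>, of "\<lambda>x. of_real (gauss x)" 1] unfolding D_def
    by (simp add: mult.commute abs_of_pos[OF gauss_pos] gauss_le_1)
  have opn: "(LINT x:U|lborel. D x) = 0" if U: "open U" for U :: "'a set"
  proof -
    obtain f :: "nat \<Rightarrow> 'a \<Rightarrow> real" where f: "\<And>n. continuous_on UNIV (f n)" "\<And>n x. 0 \<le> f n x" "\<And>n x. f n x \<le> 1"
      "\<And>x. (\<lambda>n. f n x) \<longlonglongrightarrow> indicator U x"
      using open_indicator_approx[OF U] by blast
    have [measurable]: "f n \<in> borel_measurable borel" "U \<in> sets borel" for n
      using f(1) U by (auto intro: borel_measurable_continuous_onI)
    have "(\<integral>x. f n x *\<^sub>R D x \<partial>lborel) = 0" for n
    proof -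
      have g: "continuous_on UNIV (gauss :: 'a \<Rightarrow> real)" unfolding gauss_def[abs_def] by (intro continuous_intros) auto
      have "(\<integral>x. \<psi> x * of_real (f n x * gauss x) \<partial>lborel) = 0"
      proof (rule zero_fourier_orthogonal[OF \<psi> zero, where B = 1])
        show "integrable lborel (\<lambda>x. complex_of_real (f n x * gauss x))"
          using integrable_bounded_mult[OF gauss_integrable_complex, of "\<lambda>x. of_real (f n x)" 1] f(2,3) by simp
        show "continuous_on UNIV (\<lambda>x. complex_of_real (f n x * gauss x))" by (intro continuous_intros f g)
        show "norm (complex_of_real (f n x * gauss x)) \<le> 1" for x
          using mult_mono[OF f(3)[of n x] gauss_le_1[of x]] f(2)[of n x] less_imp_le[OF gauss_pos[of x]] unfolding norm_of_real by (simp add: abs_mult)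
      qed
      then show ?thesis by (simp add: D_def scaleR_conv_of_real mult_ac)
    qed
    moreover have "(\<lambda>n. \<integral>x. f n x *\<^sub>R D x \<partial>lborel) \<longlonglongrightarrow> (\<integral>x. indicator U x *\<^sub>R D x \<partial>lborel)"
    proof (rule integral_dominated_convergence[where w = "\<lambda>x. norm (D x)"])
      show "AE x in lborel. (\<lambda>n. f n x *\<^sub>R D x) \<longlonglongrightarrow> indicator U x *\<^sub>R D x"
        by (intro AE_I2 tendsto_intros f)
      show "AE x in lborel. norm (f n x *\<^sub>R D x) \<le> norm (D x)" for n
        using f(2,3)[of n] by (intro AE_I2) (simp add: mult_left_le_one_le)
    qed (use D in auto)
    ultimately show ?thesis by (simp add: LIMSEQ_const_iff set_lebesgue_integral_def)
  qed
  have "(LINT x:A|lborel. D x) = 0" if "A \<in> sets lborel" for A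
  proof -
    have sb: "sets (lborel :: 'a measure) = sigma_sets UNIV {U. open U}" by (simp add: borel_def)
    have I: "Int_stable {U::'a set. open U}" by (auto simp: Int_stable_def)
    have "A \<in> sigma_sets UNIV {U. open U}" using that sb by auto
    have "{U::'a set. open U} \<subseteq> Pow UNIV" by auto
    from I this \<open>A \<in> sigma_sets UNIV {U. open U}\<close> show ?thesis
    proof (induction rule: sigma_sets_induct_disjoint)
      case (compl A)
      then have A: "A \<in> sets lborel" unfolding sb by simp
      have "(LINT x:(UNIV - A)|lborel. D x) = (LINT x:UNIV|lborel. D x) - (LINT x:A|lborel. D x)"
      proof -
        have "(\<lambda>x. indicator (UNIV - A) x *\<^sub>R D x) = (\<lambda>x. indicator UNIV x *\<^sub>R D x - indicator A x *\<^sub>R D x)"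
          by (auto simp: fun_eq_iff split: split_indicator)
        then show ?thesis unfolding set_lebesgue_integral_def
          using D A by (simp add: integrable_mult_indicator)
      qed
      then show ?case using compl opn[of UNIV] by simp
    next
      case (union A)
      then have A: "A i \<in> sets lborel" for i unfolding sb by auto
      have "(LINT x:(\<Union>i. A i)|lborel. D x) = (\<Sum>i. (LINT x:A i|lborel. D x))"
      proof (rule lebesgue_integral_countable_add)
        show "set_integrable lborel (\<Union> (range A)) D"
          unfolding set_integrable_def using D A by (intro integrable_mult_indicator) auto
        show "A i \<inter> A j = {}" if "i \<noteq> j" for i j
          using union(1) that by (auto simp: disjoint_family_on_def)
      qed (use A in auto)
      then show ?case using union by simp
    qed (use opn in \<open>auto simp: set_lebesgue_integral_def\<close>)
  qed
  from sigma_finite_measure.density_zero[OF sigma_finite_lborel D this] have "AE x in lborel. D x = 0" .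
  then show ?thesis using less_imp_neq[OF gauss_pos] by (auto simp: D_def)
qed

text \<open>Nothing is known about the growth of the two densities, but their products with the Gaussian
  are integrable. Since a character times the Gaussian is a Schwartz function, these products have the
  same Fourier transform.\<close>

lemma has_density_unique:
  fixes u :: "('a::euclidean_space \<Rightarrow> complex) \<Rightarrow> complex"
  assumes F: "has_density u F" and G: "has_density u G"
  shows "AE x in lborel. F x = G x"
proof -
  have [measurable]: "F \<in> borel_measurable borel" "G \<in> borel_measurable borel"
    using F G by (auto simp: has_density_def)
  let ?D = "\<lambda>x. (F x - G x) * of_real (gauss x)"
  have *: "integrable lborel (\<lambda>x. F x * \<phi> x)" "integrable lborel (\<lambda>x. G x * \<phi> x)" "(\<integral>x. F x * \<phi> x \<partial>lborel) = (\<integral>x. G x * \<phi> x \<partial>lborel)" if "\<phi> \<in> schwartz" for \<phi>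
    using F G that by (auto simp: has_density_def)
  have "AE x in lborel. ?D x = 0"
  proof (rule fourier_fun_zero_imp_AE_zero)
    show "integrable lborel ?D" using *(1,2)[OF gauss_schwartz] by (simp add: left_diff_distrib)
    show "fourier_fun ?D \<zeta> = 0" for \<zeta>
    proof -
      have "fourier_fun ?D \<zeta> = (\<integral>x. F x * (wave \<zeta> x * of_real (gauss x)) - G x * (wave \<zeta> x * of_real (gauss x)) \<partial>lborel)"
        unfolding fourier_fun_wave by (rule arg_cong[where f = "integral\<^sup>L lborel"]) (auto simp: fun_eq_iff algebra_simps)
      also have "\<dots> = 0"
        using *[OF schwartz_wave[OF gauss_schwartz, of \<zeta>]] by simp
      finally show ?thesis .
    qed
  qed
  then show ?thesis using less_imp_neq[OF gauss_pos] by auto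
qed

lemma has_density_density_of: "has_density u F \<Longrightarrow> has_density u (density_of u)"
  unfolding density_of_def by (rule someI[where P = "has_density u"])

lemma density_of_AE: "has_density u F \<Longrightarrow> AE x in lborel. density_of u x = F x"
  by (rule has_density_unique[OF has_density_density_of])

section \<open>Square integrable functions\<close>

abbreviation square_integral :: "('a::euclidean_space \<Rightarrow> complex) \<Rightarrow> ennreal" where
  "square_integral f \<equiv> \<integral>\<^sup>+x. ennreal ((norm (f x))\<^sup>2) \<partial>lborel"

definition square_integrable :: "('a::euclidean_space \<Rightarrow> complex) \<Rightarrow> bool" where
  "square_integrable f \<longleftrightarrow> f \<in> borel_measurable borel \<and> square_integral f < \<infinity>"

lemma square_integrable_measurable [measurable_dest]: "square_integrable f \<Longrightarrow> f \<in> borel_measurable borel"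
  by (simp add: square_integrable_def)

lemma square_integrable_norm: 
  assumes "square_integrable f" shows "integrable lborel (\<lambda>x. (norm (f x))\<^sup>2)"
  using assms by (intro integrableI_bounded) (auto simp: square_integrable_def)

lemma mult_le_sum_squares: "(a::real) * b \<le> a\<^sup>2 + b\<^sup>2"
proof -
  have "0 \<le> (a - b)\<^sup>2 + a\<^sup>2 + b\<^sup>2" by simp
  then show ?thesis by (simp add: power2_eq_square algebra_simps)
qed

lemma square_integrable_mult:
  assumes f: "square_integrable f" and g: "square_integrable g"
  shows "integrable lborel (\<lambda>x. f x * g x)"
proof (rule Bochner_Integration.integrable_bound)
  show "integrable lborel (\<lambda>x. (norm (f x))\<^sup>2 + (norm (g x))\<^sup>2)"
    by (intro Bochner_Integration.integrable_add square_integrable_norm f g)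
  show "AE x in lborel. norm (f x * g x) \<le> norm ((norm (f x))\<^sup>2 + (norm (g x))\<^sup>2)"
    using mult_le_sum_squares by (intro AE_I2) (simp add: norm_mult)
qed (use f g in \<open>auto simp: square_integrable_def\<close>)

lemma square_integrable_bound:
  assumes "square_integrable g" "f \<in> borel_measurable borel" "AE x in lborel. norm (f x) \<le> C * norm (g x)"
  shows "square_integrable f"
proof -
  have [measurable]: "g \<in> borel_measurable borel" using assms by (auto simp: square_integrable_def)
  have "square_integral f \<le> (\<integral>\<^sup>+x. ennreal (C\<^sup>2) * ennreal ((norm (g x))\<^sup>2) \<partial>lborel)"
  proof (rule nn_integral_mono_AE)
    show "AE x in lborel. ennreal ((norm (f x))\<^sup>2) \<le> ennreal (C\<^sup>2) * ennreal ((norm (g x))\<^sup>2)"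
      using assms(3)
    proof eventually_elim
      case (elim x)
      then have "(norm (f x))\<^sup>2 \<le> (C * norm (g x))\<^sup>2" by (intro power_mono) auto
      then show ?case by (simp add: power_mult_distrib ennreal_mult[symmetric] ennreal_leI)
    qed
  qed
  also have "\<dots> = ennreal (C\<^sup>2) * square_integral g"
    by (rule nn_integral_cmult) auto
  also have "\<dots> < \<infinity>"
    using assms(1) by (simp add: square_integrable_def ennreal_mult_less_top)
  finally show ?thesis using assms(2) by (simp add: square_integrable_def)
qed

lemma schwartz_square_integrable:
  assumes \<phi>: "\<phi> \<in> schwartz" shows "square_integrable \<phi>"
proof -
  obtain B where B: "B > 0" "\<And>x. norm (\<phi> x) \<le> B" using schwartz_bound[OF \<phi>, of 0] by auto
  have "integrable lborel (\<lambda>x. (norm (\<phi> x))\<^sup>2)"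
  proof (rule Bochner_Integration.integrable_bound[of _ "\<lambda>x. B * norm (\<phi> x)"])
    show "integrable lborel (\<lambda>x. B * norm (\<phi> x))" using schwartz_integrable[OF \<phi>] by auto
    show "AE x in lborel. norm ((norm (\<phi> x))\<^sup>2) \<le> norm (B * norm (\<phi> x))"
      using B by (intro AE_I2) (simp add: power2_eq_square mult_right_mono)
  qed (use schwartz_measurable[OF \<phi>] in measurable)
  then show ?thesis
    using schwartz_measurable[OF \<phi>] by (auto simp: square_integrable_def integrable_iff_bounded)
qed

text \<open>If \<open>f\<close> is not integrable, its integral is \<open>0\<close> by convention and the bound is trivial.\<close>

lemma norm_integral_le_nn_integral:
  fixes f :: "'a \<Rightarrow> complex"
  shows "ennreal (norm (\<integral>x. f x \<partial>M)) \<le> (\<integral>\<^sup>+x. ennreal (norm (f x)) \<partial>M)"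
  by (cases "integrable M f") (auto simp: integral_norm_bound_ennreal not_integrable_integral_eq)

lemma cnj_fourier_fun:
  "cnj (fourier_fun F \<zeta>) = (\<integral>x. wave (- x) \<zeta> * cnj (F x) \<partial>lborel)"
  unfolding fourier_fun_wave Bochner_Integration.integral_cnj[symmetric]
  by (rule arg_cong[where f = "integral\<^sup>L lborel"]) (auto simp: fun_eq_iff wave_def exp_cnj inner_commute)

text \<open>By \<open>fourier_smoothing\<close> the left-hand side is, up to a constant, the integral of
  \<open>cnj (F x) * F (x + \<epsilon> z) * gauss z\<close>. The elementary inequality
  \<open>a b \<le> a\<^sup>2 + b\<^sup>2\<close> and translation invariance bound it independently of \<open>\<epsilon>\<close>.\<close>

lemma fourier_fun_L2_bound_gauss:
  fixes F :: "'a::euclidean_space \<Rightarrow> complex"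
  assumes F: "integrable lborel F" and \<epsilon>: "\<epsilon> > 0"
  shows "(\<integral>\<^sup>+\<zeta>. ennreal ((norm (fourier_fun F \<zeta>))\<^sup>2 * gauss (\<epsilon> *\<^sub>R \<zeta>)) \<partial>lborel)
    \<le> ennreal (2 * (gauss_mass TYPE('a))\<^sup>2) * square_integral F"
proof -
  let ?S = "\<lambda>x z. (ennreal ((norm (F x))\<^sup>2) + ennreal ((norm (F (x + \<epsilon> *\<^sub>R z)))\<^sup>2)) * ennreal (gauss z)"
  let ?T = "\<lambda>\<zeta>. (norm (fourier_fun F \<zeta>))\<^sup>2 * gauss (\<epsilon> *\<^sub>R \<zeta>)"
  let ?c = "gauss_mass TYPE('a)"
  let ?I = "square_integral F"
  have c0: "?c > 0" by (rule gauss_mass_pos)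
  have [measurable]: "F \<in> borel_measurable borel" using F by auto
  define f where "f x = cnj (F x)" for x
  have f: "integrable lborel f" using F unfolding f_def by simp
  define g where "g \<zeta> = fourier_fun F \<zeta> * of_real (gauss (\<epsilon> *\<^sub>R \<zeta>))" for \<zeta>
  have g: "integrable lborel g"
    unfolding g_def using gauss_scaled_integrable[of \<epsilon> 0] \<epsilon>
    by (intro integrable_bounded_mult[OF _ _ fourier_fun_bound]) auto
  have prod: "complex_of_real (?T \<zeta>) = g \<zeta> * (\<integral>x. wave (- x) \<zeta> * f x \<partial>lborel)" for \<zeta>
    unfolding f_def cnj_fourier_fun[symmetric] g_def by (simp add: complex_norm_square del: of_real_power) 
  have int: "integrable lborel ?T"
  proof -
    have "integrable lborel (\<lambda>\<zeta>. cnj (fourier_fun F \<zeta>) * g \<zeta>)"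
    proof (rule integrable_bounded_mult[OF g, where B = "\<integral>x. norm (F x) \<partial>lborel"])
      have "continuous_on UNIV cnj" by (intro continuous_intros)
      then have [measurable]: "cnj \<in> borel_measurable borel" by (rule borel_measurable_continuous_onI)
      show "(\<lambda>\<zeta>. cnj (fourier_fun F \<zeta>)) \<in> borel_measurable lborel" by measurable
    qed (auto simp: fourier_fun_bound)
    then have "integrable lborel (\<lambda>\<zeta>. complex_of_real (?T \<zeta>))"
      unfolding prod f_def cnj_fourier_fun[symmetric] by (simp only: mult.commute[of "cnj _"])
    then show ?thesis by (simp only: complex_of_real_integrable_eq)
  qed
  have "(\<integral>\<zeta>. complex_of_real (?T \<zeta>) \<partial>lborel) = (\<integral>\<zeta>. g \<zeta> * (\<integral>x. wave (- x) \<zeta> * f x \<partial>lborel) \<partial>lborel)"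
    unfolding prod ..
  also have "\<dots> = (\<integral>x. f x * (\<integral>\<zeta>. wave (- x) \<zeta> * g \<zeta> \<partial>lborel) \<partial>lborel)"
    by (rule Fubini_mult[OF g f, where B = 1]) (auto simp: split_beta')
  also have "\<dots> = (\<integral>x. f x * (of_real ?c * gauss_average \<epsilon> F x) \<partial>lborel)"
    using fourier_smoothing[OF F \<epsilon>] by (simp add: g_def mult_ac)
  finally have eq: "complex_of_real (\<integral>\<zeta>. ?T \<zeta> \<partial>lborel) = \<dots>"
    by (simp only: integral_complex_of_real)
  have nn: "(\<integral>\<zeta>. ?T \<zeta> \<partial>lborel) \<ge> 0"
    by (intro Bochner_Integration.integral_nonneg mult_nonneg_nonneg less_imp_le[OF gauss_pos]) auto
  have "(\<integral>\<^sup>+\<zeta>. ennreal (?T \<zeta>) \<partial>lborel) = ennreal (\<integral>\<zeta>. ?T \<zeta> \<partial>lborel)"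
    by (rule nn_integral_eq_integral[OF int]) (auto intro!: mult_nonneg_nonneg less_imp_le[OF gauss_pos])
  also have "\<dots> = ennreal (norm (complex_of_real (\<integral>\<zeta>. ?T \<zeta> \<partial>lborel)))"
    using nn by (simp only: norm_of_real abs_of_nonneg)
  also have "\<dots> \<le> (\<integral>\<^sup>+x. ennreal (norm (f x * (of_real ?c * gauss_average \<epsilon> F x))) \<partial>lborel)"
    unfolding eq by (rule norm_integral_le_nn_integral)
  also have "\<dots> \<le> (\<integral>\<^sup>+x. ennreal ?c * (\<integral>\<^sup>+z. ?S x z \<partial>lborel) \<partial>lborel)"
  proof (rule nn_integral_mono)
    fix x
    have "ennreal (norm (f x * (of_real ?c * gauss_average \<epsilon> F x)))
      = ennreal ?c * (ennreal (norm (F x)) * ennreal (norm (gauss_average \<epsilon> F x)))"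
      using c0 by (simp add: norm_mult f_def ennreal_mult mult_ac)
    also have "\<dots> \<le> ennreal ?c * (ennreal (norm (F x)) * (\<integral>\<^sup>+z. ennreal (norm (F (x + \<epsilon> *\<^sub>R z) * of_real (gauss z))) \<partial>lborel))"
      by (intro mult_left_mono norm_integral_le_nn_integral) auto
    also have "\<dots> = ennreal ?c * (\<integral>\<^sup>+z. ennreal (norm (F x)) * ennreal (norm (F (x + \<epsilon> *\<^sub>R z) * of_real (gauss z))) \<partial>lborel)"
      by (subst nn_integral_cmult) auto
    also have "\<dots> \<le> ennreal ?c * (\<integral>\<^sup>+z. ?S x z \<partial>lborel)"
    proof (intro mult_left_mono nn_integral_mono)
      fix z
      have "norm (F x) * norm (F (x + \<epsilon> *\<^sub>R z)) * gauss z \<le> ((norm (F x))\<^sup>2 + (norm (F (x + \<epsilon> *\<^sub>R z)))\<^sup>2) * gauss z"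
        by (intro mult_right_mono mult_le_sum_squares less_imp_le[OF gauss_pos])
      then show "ennreal (norm (F x)) * ennreal (norm (F (x + \<epsilon> *\<^sub>R z) * of_real (gauss z))) \<le> ?S x z"
        using less_imp_le[OF gauss_pos, of z]
        by (simp add: norm_mult abs_of_pos[OF gauss_pos] ennreal_mult[symmetric] ennreal_plus[symmetric] ennreal_leI mult.assoc del: ennreal_plus)
    qed auto
    finally show "ennreal (norm (f x * (of_real ?c * gauss_average \<epsilon> F x))) \<le> \<dots>" .
  qed
  also have "\<dots> = ennreal ?c * (\<integral>\<^sup>+x. (\<integral>\<^sup>+z. ?S x z \<partial>lborel) \<partial>lborel)"
    by (rule nn_integral_cmult) measurable
  also have "(\<integral>\<^sup>+x. (\<integral>\<^sup>+z. ?S x z \<partial>lborel) \<partial>lborel)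
     = (\<integral>\<^sup>+z. (\<integral>\<^sup>+x. ?S x z \<partial>lborel) \<partial>lborel)"
    by (rule lborel_pair.Fubini'[symmetric]) measurable
  also have "\<dots> = (\<integral>\<^sup>+z. (?I + ?I) * ennreal (gauss z) \<partial>(lborel :: 'a measure))"
    using nn_integral_lborel_translate[where f = "\<lambda>x. ennreal ((norm (F x))\<^sup>2)"]
    by (simp add: nn_integral_multc nn_integral_add add.commute[of _ "_ *\<^sub>R _"])
  also have "\<dots> = (?I + ?I) * ennreal ?c"
    using nn_integral_eq_integral[OF gauss_integrable[where 'a = 'a]]
    by (simp add: nn_integral_cmult gauss_mass_def less_imp_le[OF gauss_pos])
  also have "ennreal ?c * \<dots> = ennreal (2 * ?c\<^sup>2) * ?I"
    using c0 by (simp add: power2_eq_square ennreal_mult mult_2[symmetric] mult_ac)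
  finally show ?thesis .
qed

text \<open>Half of Plancherel's theorem, with a constant that is not sharp; Fatou's lemma removes the Gaussian.\<close>

lemma fourier_fun_L2_bound:
  fixes F :: "'a::euclidean_space \<Rightarrow> complex"
  assumes F: "integrable lborel F"
  shows "square_integral (\<lambda>\<zeta>. fourier_fun F \<zeta>)
    \<le> ennreal (2 * (gauss_mass TYPE('a))\<^sup>2) * square_integral F"
    (is "_ \<le> ?C")
proof -
  obtain \<epsilon> :: "nat \<Rightarrow> real" where \<epsilon>: "\<And>n. \<epsilon> n > 0" and \<epsilon>0: "\<epsilon> \<longlonglongrightarrow> 0"
    using null_sequence by blast
  have [measurable]: "F \<in> borel_measurable borel" using F by auto
  let ?u = "\<lambda>n \<zeta>. ennreal ((norm (fourier_fun F \<zeta>))\<^sup>2 * gauss (\<epsilon> n *\<^sub>R \<zeta>))"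
  have "liminf (\<lambda>n. ?u n \<zeta>) = ennreal ((norm (fourier_fun F \<zeta>))\<^sup>2)" for \<zeta>
  proof (rule lim_imp_Liminf)
    have "(\<lambda>n. ?u n \<zeta>) \<longlonglongrightarrow> ennreal ((norm (fourier_fun F \<zeta>))\<^sup>2 * 1)"
      by (intro tendsto_ennrealI tendsto_intros gauss_scaled_tendsto \<epsilon>0)
    then show "(\<lambda>n. ?u n \<zeta>) \<longlonglongrightarrow> ennreal ((norm (fourier_fun F \<zeta>))\<^sup>2)" by simp
  qed simp
  then have "square_integral (\<lambda>\<zeta>. fourier_fun F \<zeta>) = (\<integral>\<^sup>+\<zeta>. liminf (\<lambda>n. ?u n \<zeta>) \<partial>lborel)"
    by simp
  also have "\<dots> \<le> liminf (\<lambda>n. \<integral>\<^sup>+\<zeta>. ?u n \<zeta> \<partial>lborel)"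
    by (rule nn_integral_liminf) measurable
  also have "\<dots> \<le> liminf (\<lambda>n. ?C)"
    by (intro Liminf_mono always_eventually allI fourier_fun_L2_bound_gauss F \<epsilon>)
  also have "\<dots> = ?C" by (simp add: Liminf_const)
  finally show ?thesis .
qed

text \<open>The core of the completeness of \<open>L\<^sup>2\<close>, including an \<open>L\<^sup>2\<close> majorant for the whole
  sequence. With \<open>d k\<close> the norms of the increments, \<open>S = (\<Sum>k. 2 ^ k * (d k)\<^sup>2)\<close> has a finite integral, hence
  is finite almost everywhere, and then \<open>d k \<le> sqrt S * sqrt (1 / 2) ^ k\<close> is dominated by a geometric series.\<close>

lemma rapid_L2_convergence:
  fixes h :: "nat \<Rightarrow> 'a::euclidean_space \<Rightarrow> complex"
  assumes h0: "square_integrable (h 0)" and [measurable]: "\<And>k. h k \<in> borel_measurable borel"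
    and step: "\<And>k. square_integral (\<lambda>x. h (Suc k) x - h k x) \<le> K * ennreal ((1 / 4) ^ k)"
    and K: "K < \<infinity>"
  obtains f G where "square_integrable f" "square_integrable G"
    "AE x in lborel. (\<lambda>k. h k x) \<longlonglongrightarrow> f x \<and> (\<forall>k. norm (h k x) \<le> norm (G x))"
proof -
  define d where "d k x = norm (h (Suc k) x - h k x)" for k x
  \<comment> \<open>The weights \<open>2 ^ k\<close> still leave a convergent sum, as the square integrals of the increments are of order \<open>(1 / 4) ^ k\<close>.\<close>
  define S where "S x = (\<Sum>k. ennreal (2 ^ k * (d k x)\<^sup>2))" for x
  define q where "q = sqrt (1 / 2)"
  have q: "0 < q" "q < 1" by (auto simp: q_def)
  have [measurable]: "d k \<in> borel_measurable borel" for k unfolding d_def by measurable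
  have [measurable]: "S \<in> borel_measurable borel" unfolding S_def by measurable
  have "(\<integral>\<^sup>+x. S x \<partial>lborel) = (\<Sum>k. \<integral>\<^sup>+x. ennreal (2 ^ k * (d k x)\<^sup>2) \<partial>lborel)"
    unfolding S_def by (rule nn_integral_suminf) measurable
  also have "\<dots> = (\<Sum>k. ennreal (2 ^ k) * (\<integral>\<^sup>+x. ennreal ((d k x)\<^sup>2) \<partial>lborel))"
    by (simp add: ennreal_mult nn_integral_cmult)
  also have "\<dots> \<le> (\<Sum>k. K * ennreal ((1 / 2) ^ k))"
  proof (intro suminf_le summableI)
    fix k
    have "ennreal (2 ^ k) * (\<integral>\<^sup>+x. ennreal ((d k x)\<^sup>2) \<partial>lborel) \<le> ennreal (2 ^ k) * (K * ennreal ((1 / 4) ^ k))"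
      unfolding d_def by (intro mult_left_mono step) auto
    also have "\<dots> = K * ennreal (2 ^ k * (1 / 4) ^ k)" by (simp only: ennreal_mult'' ennreal_mult mult_ac)  (simp add: ennreal_mult mult_ac)
    also have "(2::real) ^ k * (1 / 4) ^ k = (1 / 2) ^ k" by (simp add: power_mult_distrib[symmetric])
    finally show "ennreal (2 ^ k) * (\<integral>\<^sup>+x. ennreal ((d k x)\<^sup>2) \<partial>lborel) \<le> K * ennreal ((1 / 2) ^ k)" .
  qed
  also have "\<dots> = K * ennreal 2"
    by (subst ennreal_suminf_cmult, subst suminf_ennreal2) (auto simp: suminf_geometric summable_geometric)
  also have "\<dots> < \<infinity>" using K by (simp add: ennreal_mult_less_top)
  finally have Sfin: "(\<integral>\<^sup>+x. S x \<partial>lborel) < \<infinity>" .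
  then have SAE: "AE x in lborel. S x \<noteq> \<infinity>"
    by (intro nn_integral_PInf_AE) auto
  define \<sigma> where "\<sigma> x = enn2real (S x)" for x
  have [measurable]: "\<sigma> \<in> borel_measurable borel" unfolding \<sigma>_def by measurable
  have \<sigma>0: "\<sigma> x \<ge> 0" for x by (simp add: \<sigma>_def)
  define G where "G x = complex_of_real (norm (h 0 x) + sqrt (\<sigma> x) / (1 - q))" for x
  have Gn: "norm (G x) = norm (h 0 x) + sqrt (\<sigma> x) / (1 - q)" for x
    using q \<sigma>0[of x] unfolding G_def norm_of_real by simp
  have [measurable]: "G \<in> borel_measurable borel" unfolding G_def by measurable
  define f where "f x = lim (\<lambda>k. h k x)" for x
  have [measurable]: "f \<in> borel_measurable borel"
    unfolding f_def by (rule borel_measurable_lim_metric) measurable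
  have main: "AE x in lborel. (\<lambda>k. h k x) \<longlonglongrightarrow> f x \<and> (\<forall>k. norm (h k x) \<le> norm (G x))"
    using SAE
  proof eventually_elim
    case (elim x)
    have dk: "d k x \<le> sqrt (\<sigma> x) * q ^ k" for k
    proof -
      have "(\<Sum>j\<in>{k}. ennreal (2 ^ j * (d j x)\<^sup>2)) \<le> S x"
        unfolding S_def by (rule sum_le_suminf) auto
      then have "ennreal (2 ^ k * (d k x)\<^sup>2) \<le> ennreal (\<sigma> x)"
        using elim by (simp add: \<sigma>_def less_top)
      then have "2 ^ k * (d k x)\<^sup>2 \<le> \<sigma> x" using \<sigma>0 by (simp add: ennreal_le_iff)
      then have "(d k x)\<^sup>2 \<le> \<sigma> x * (1 / 2) ^ k" by (simp add: field_simps power_one_over)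
      then have "d k x \<le> sqrt (\<sigma> x * (1 / 2) ^ k)" by (rule real_le_rsqrt)
      then show ?thesis by (simp add: real_sqrt_mult real_sqrt_power q_def)
    qed
    have geo: "summable (\<lambda>k. sqrt (\<sigma> x) * q ^ k)" using q by (intro summable_mult summable_geometric) auto
    have sd: "summable (\<lambda>k. d k x)"
      by (rule summable_comparison_test[OF _ geo]) (use dk in \<open>auto simp: d_def\<close>)
    then have "summable (\<lambda>k. h (Suc k) x - h k x)"
      unfolding d_def by (rule summable_norm_cancel)
    then have "(\<lambda>n. \<Sum>k<n. h (Suc k) x - h k x) \<longlonglongrightarrow> (\<Sum>k. h (Suc k) x - h k x)"
      by (rule summable_LIMSEQ)
    then have "(\<lambda>n. h 0 x + (h n x - h 0 x)) \<longlonglongrightarrow> h 0 x + (\<Sum>k. h (Suc k) x - h k x)"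
      by (intro tendsto_intros) (simp only: sum_lessThan_telescope[of "\<lambda>k. h k x"])
    then have "convergent (\<lambda>n. h n x)" by (auto simp: convergent_def)
    then have "(\<lambda>k. h k x) \<longlonglongrightarrow> f x" unfolding f_def by (rule convergent_LIMSEQ_iff[THEN iffD1])
    moreover have "norm (h n x) \<le> norm (G x)" for n
    proof -
      have "norm (h n x) = norm (h 0 x + (\<Sum>k<n. h (Suc k) x - h k x))" by (simp add: sum_lessThan_telescope[of "\<lambda>k. h k x"])
      also have "\<dots> \<le> norm (h 0 x) + (\<Sum>k<n. d k x)"
        unfolding d_def by (intro order_trans[OF norm_triangle_ineq] add_left_mono norm_sum)
      also have "(\<Sum>k<n. d k x) \<le> (\<Sum>k<n. sqrt (\<sigma> x) * q ^ k)" by (intro sum_mono dk)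
      also have "\<dots> \<le> (\<Sum>k. sqrt (\<sigma> x) * q ^ k)"
        using q \<sigma>0 by (intro sum_le_suminf geo) auto
      also have "\<dots> = sqrt (\<sigma> x) / (1 - q)"
        using q by (simp add: suminf_mult summable_geometric suminf_geometric)
      finally show ?thesis by (simp add: Gn)
    qed
    ultimately show ?case by blast
  qed
  have G: "square_integrable G"
  proof -
    have "square_integral G \<le> (\<integral>\<^sup>+x. 2 * ennreal ((norm (h 0 x))\<^sup>2) + ennreal (2 / (1 - q)\<^sup>2) * S x \<partial>lborel)"
    proof (rule nn_integral_mono_AE)
      show "AE x in lborel. ennreal ((norm (G x))\<^sup>2) \<le> 2 * ennreal ((norm (h 0 x))\<^sup>2) + ennreal (2 / (1 - q)\<^sup>2) * S x"
        using SAE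
      proof eventually_elim
        case (elim x)
        then have S: "S x = ennreal (\<sigma> x)" by (simp add: \<sigma>_def less_top)
        have "(a + b)\<^sup>2 \<le> 2 * a\<^sup>2 + 2 * b\<^sup>2" for a b :: real
          using sum_squares_bound[of a b] by (simp add: power2_sum)
        from this[of "norm (h 0 x)" "sqrt (\<sigma> x) / (1 - q)"]
        have "(norm (G x))\<^sup>2 \<le> 2 * (norm (h 0 x))\<^sup>2 + 2 / (1 - q)\<^sup>2 * \<sigma> x"
          using \<sigma>0[of x] by (simp add: Gn power_divide)
        then have "ennreal ((norm (G x))\<^sup>2) \<le> ennreal (2 * (norm (h 0 x))\<^sup>2 + 2 / (1 - q)\<^sup>2 * \<sigma> x)" by (rule ennreal_leI)
        also have "\<dots> = 2 * ennreal ((norm (h 0 x))\<^sup>2) + ennreal (2 / (1 - q)\<^sup>2) * S x"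
          using \<sigma>0[of x] q unfolding S
          by (simp add: ennreal_plus[symmetric] ennreal_mult[symmetric] ennreal_numeral[symmetric] del: ennreal_plus ennreal_numeral)
        finally show ?case .
      qed
    qed
    also have "\<dots> = 2 * square_integral (\<lambda>x. h 0 x) + ennreal (2 / (1 - q)\<^sup>2) * (\<integral>\<^sup>+x. S x \<partial>lborel)"
      by (simp add: nn_integral_add nn_integral_cmult)
    also have "\<dots> < \<infinity>"
      using Sfin h0 by (simp add: square_integrable_def ennreal_mult_less_top)
    finally show ?thesis by (simp add: square_integrable_def)
  qed
  have "square_integrable f"
  proof (rule square_integrable_bound[OF G, where C = 1])
    show "AE x in lborel. norm (f x) \<le> 1 * norm (G x)"
      using main
    proof eventually_elim
      case (elim x)
      then have "(\<lambda>k. norm (h k x)) \<longlonglongrightarrow> norm (f x)" by (intro tendsto_norm) auto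
      then show ?case using elim by (auto intro: LIMSEQ_le_const2)
    qed
  qed measurable
  then show ?thesis using G main by (rule that)
qed

section \<open>Inverse Fourier transforms of square integrable functions\<close>

lemma square_integrable_fourier_fun:
  assumes F: "integrable lborel F" "square_integrable F"
  shows "square_integrable (\<lambda>x. fourier_fun F (- x))"
proof -
  have [measurable]: "F \<in> borel_measurable borel" using F by auto
  have "square_integral (\<lambda>x. fourier_fun F (0 - x)) = square_integral (\<lambda>x. fourier_fun F x)"
    by (rule nn_integral_lborel_reflect) measurable
  also have "\<dots> < \<infinity>"
    using F(2) by (intro le_less_trans[OF fourier_fun_L2_bound[OF F(1)]]) (auto simp: square_integrable_def ennreal_mult_less_top)
  finally show ?thesis by (simp add: square_integrable_def)
qed

definition cutoff :: "real \<Rightarrow> ('a::euclidean_space \<Rightarrow> complex) \<Rightarrow> 'a \<Rightarrow> complex" where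
  "cutoff r H \<zeta> = (if norm \<zeta> \<le> r then H \<zeta> else 0)"

lemma cutoff_measurable [measurable]:
  assumes [measurable]: "H \<in> borel_measurable borel"
  shows "cutoff r H \<in> borel_measurable borel"
proof -
  have "(\<lambda>\<zeta>. if norm \<zeta> \<le> r then H \<zeta> else 0) \<in> borel_measurable borel" by measurable
  then show ?thesis by (simp add: cutoff_def[abs_def])
qed

lemma norm_cutoff_le: "norm (cutoff r H x) \<le> norm (H x)"
  by (simp add: cutoff_def)

lemma cutoff_square_integrable: "square_integrable H \<Longrightarrow> square_integrable (cutoff r H)"
  by (rule square_integrable_bound[where C = 1]) (auto simp: norm_cutoff_le square_integrable_def)

lemma cutoff_integrable:
  assumes H: "square_integrable H" shows "integrable lborel (cutoff r H)"
proof (rule Bochner_Integration.integrable_bound)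
  show "integrable lborel (\<lambda>x. indicator (cball 0 r) x + (norm (H x))\<^sup>2)"
    by (intro Bochner_Integration.integrable_add square_integrable_norm H integrable_real_indicator emeasure_lborel_cball_finite) simp
  show "AE x in lborel. norm (cutoff r H x) \<le> norm (indicator (cball 0 r) x + (norm (H x))\<^sup>2)"
  proof (rule AE_I2)
    fix x
    have "norm (H x) \<le> 1 + (norm (H x))\<^sup>2" using mult_le_sum_squares[of 1 "norm (H x)"] by simp
    then show "norm (cutoff r H x) \<le> norm (indicator (cball 0 r) x + (norm (H x))\<^sup>2)"
      by (auto simp: cutoff_def)
  qed
qed (use H in \<open>auto simp: square_integrable_def\<close>)

lemma cutoff_tendsto:
  assumes "filterlim r at_top sequentially"
  shows "(\<lambda>k. cutoff (r k) H x) \<longlonglongrightarrow> H x"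
proof (rule tendsto_eventually)
  have "\<forall>\<^sub>F k in sequentially. norm x \<le> r k" using assms by (simp add: filterlim_at_top)
  then show "\<forall>\<^sub>F k in sequentially. cutoff (r k) H x = H x" by eventually_elim (simp add: cutoff_def)
qed

abbreviation truncated_inverse :: "real \<Rightarrow> ('a::euclidean_space \<Rightarrow> complex) \<Rightarrow> 'a \<Rightarrow> complex" where
  "truncated_inverse r H x \<equiv> fourier_fun (cutoff r H) (- x)"

text \<open>The function \<open>h\<close> is the inverse Fourier transform of \<open>H\<close>, without the normalising constant, as an almost everywhere
  limit of the integrals over balls. Almost everywhere convergence with a square integrable majorant is
  recorded instead of convergence in norm, since dominated convergence then applies to products as well.\<close>

definition fourier_limit :: "('a::euclidean_space \<Rightarrow> complex) \<Rightarrow> ('a \<Rightarrow> complex) \<Rightarrow> bool" where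
  "fourier_limit H h \<longleftrightarrow> square_integrable h \<and> (\<exists>r G. filterlim r at_top sequentially \<and> square_integrable G \<and>
     (AE x in lborel. (\<lambda>k. truncated_inverse (r k) H x) \<longlonglongrightarrow> h x \<and>
        (\<forall>k. norm (truncated_inverse (r k) H x) \<le> norm (G x))))"

abbreviation tail_integral :: "real \<Rightarrow> ('a::euclidean_space \<Rightarrow> complex) \<Rightarrow> ennreal" where
  "tail_integral r H \<equiv> \<integral>\<^sup>+x. ennreal ((norm (H x))\<^sup>2) * indicator {x. norm x > r} x \<partial>lborel"

lemma square_integrable_tail:
  assumes H: "square_integrable H" and e: "e > 0"
  obtains n :: nat where "\<And>r. r \<ge> real n \<Longrightarrow> tail_integral r H \<le> ennreal e"
proof -
  have [measurable]: "H \<in> borel_measurable borel" using H by (simp add: square_integrable_def)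
  have "(\<lambda>n. tail_integral (real n) H) \<longlonglongrightarrow> (\<integral>\<^sup>+x. 0 \<partial>(lborel :: 'a measure))"
  proof (rule nn_integral_dominated_convergence[where w = "\<lambda>x. ennreal ((norm (H x))\<^sup>2)"])
    show "AE x in lborel. (\<lambda>n. ennreal ((norm (H x))\<^sup>2) * indicator {x. norm x > real n} x) \<longlonglongrightarrow> 0"
    proof (intro AE_I2 tendsto_eventually)
      fix x :: 'a
      obtain N :: nat where "norm x \<le> real N" using real_arch_simple by blast
      then show "\<forall>\<^sub>F n in sequentially. ennreal ((norm (H x))\<^sup>2) * indicator {x. norm x > real n} x = 0"
        by (intro eventually_sequentiallyI[of N]) (auto split: split_indicator)
    qed
  qed (use H in \<open>auto simp: square_integrable_def split: split_indicator\<close>)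
  then have "(\<lambda>n. tail_integral (real n) H) \<longlonglongrightarrow> 0" by simp
  then have "\<forall>\<^sub>F n in sequentially. tail_integral (real n) H < ennreal e"
    using e by (intro order_tendstoD(2)) auto
  then obtain n where n: "tail_integral (real n) H < ennreal e"
    using eventually_happens by fastforce
  have "tail_integral r H \<le> ennreal e" if "r \<ge> real n" for r
    using that by (intro order_trans[OF nn_integral_mono less_imp_le[OF n]]) (auto split: split_indicator)
  then show ?thesis by (rule that)
qed

text \<open>The radii are chosen so that the tails of \<open>H\<close> decay geometrically;
  by \<open>fourier_fun_L2_bound\<close> so do the increments of the inverse transforms.\<close>

lemma fourier_limit_exists:
  fixes H :: "'a::euclidean_space \<Rightarrow> complex"
  assumes H: "square_integrable H"
  obtains h where "fourier_limit H h"
proof -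
  have [measurable]: "H \<in> borel_measurable borel" using H by (simp add: square_integrable_def)
  have "\<forall>k. \<exists>n::nat. \<forall>r\<ge>real n. tail_integral r H \<le> ennreal ((1 / 4) ^ k)"
    using square_integrable_tail[OF H] by (metis zero_less_divide_1_iff zero_less_numeral zero_less_power)
  then obtain n :: "nat \<Rightarrow> nat" where n: "\<And>k r. r \<ge> real (n k) \<Longrightarrow> tail_integral r H \<le> ennreal ((1 / 4) ^ k)" by metis
  \<comment> \<open>Summing the radii makes them increasing; the summand \<open>k\<close> makes them unbounded.\<close>
  define r where "r k = real k + (\<Sum>j\<le>k. real (n j))" for k
  have rn: "real (n k) \<le> r k" for k
  proof -
    have "real (n k) \<le> (\<Sum>j\<le>k. real (n j))" by (rule member_le_sum) auto
    then show ?thesis by (simp add: r_def)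
  qed
  have rmono: "r k \<le> r (Suc k)" for k by (simp add: r_def)
  have rtop: "filterlim r at_top sequentially"
  proof (rule filterlim_at_top_mono[OF filterlim_real_sequentially])
    show "\<forall>\<^sub>F k in sequentially. real k \<le> r k" by (simp add: r_def sum_nonneg)
  qed
  define h where "h k x = truncated_inverse (r k) H x" for k x
  define C where "C = ennreal (2 * (gauss_mass TYPE('a))\<^sup>2)"
  have step: "square_integral (\<lambda>x. h (Suc k) x - h k x) \<le> C * ennreal ((1 / 4) ^ k)" for k
  proof -
    let ?D = "\<lambda>x. cutoff (r (Suc k)) H x - cutoff (r k) H x"
    have D: "integrable lborel ?D" by (intro Bochner_Integration.integrable_diff cutoff_integrable H)
    have "h (Suc k) x - h k x = fourier_fun ?D (0 - x)" for x
      unfolding h_def fourier_fun_wave right_diff_distrib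
      using wave_integrable[OF cutoff_integrable[OF H]] by simp
    then have "square_integral (\<lambda>x. h (Suc k) x - h k x) = square_integral (\<lambda>x. fourier_fun ?D (0 - x))"
      by simp
    also have "\<dots> = square_integral (\<lambda>x. fourier_fun ?D x)"
      by (rule nn_integral_lborel_reflect) measurable
    also have "\<dots> \<le> C * square_integral (\<lambda>x. ?D x)"
      unfolding C_def by (rule fourier_fun_L2_bound[OF D])
    also have "\<dots> \<le> C * ennreal ((1 / 4) ^ k)"
    proof (intro mult_left_mono order_trans[OF nn_integral_mono n[OF rn]])
      show "ennreal ((norm (?D x))\<^sup>2) \<le> ennreal ((norm (H x))\<^sup>2) * indicator {x. norm x > r k} x" for x
        using rmono[of k] by (auto simp: cutoff_def split: split_indicator)
    qed simp
    finally show ?thesis .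
  qed
  have [measurable]: "h k \<in> borel_measurable borel" for k unfolding h_def by measurable
  have "square_integrable (h 0)"
    unfolding h_def by (intro square_integrable_fourier_fun cutoff_integrable cutoff_square_integrable H)
  from rapid_L2_convergence[OF this _ step] obtain f G where "square_integrable f" "square_integrable G"
    "AE x in lborel. (\<lambda>k. h k x) \<longlonglongrightarrow> f x \<and> (\<forall>k. norm (h k x) \<le> norm (G x))"
    by (auto simp: C_def)
  then have "fourier_limit H f"
    unfolding fourier_limit_def h_def using rtop by blast
  then show ?thesis by (rule that)
qed

lemma fourier_fun_multiplication_reflect:
  assumes F: "integrable lborel F" and G: "integrable lborel G"
  shows "(\<integral>x. fourier_fun F (- x) * G x \<partial>lborel) = (\<integral>\<zeta>. F \<zeta> * fourier_fun G (- \<zeta>) \<partial>lborel)"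
proof -
  have [measurable]: "F \<in> borel_measurable borel" "G \<in> borel_measurable borel" using F G by auto
  have Gr: "integrable lborel (\<lambda>x. G (- x))" using lborel_integrable_affine[OF G, of "-1" 0] by simp
  have "(\<integral>x. fourier_fun F (- x) * G x \<partial>lborel) = (\<integral>x. fourier_fun F x * G (- x) \<partial>lborel)"
    by (subst lborel_integral_affine[where c = "-1" and t = 0]) auto
  also have "\<dots> = (\<integral>\<zeta>. F \<zeta> * fourier_fun (\<lambda>x. G (- x)) \<zeta> \<partial>lborel)"
    using fourier_fun_multiplication[OF F Gr] by (simp add: mult.commute)
  finally show ?thesis by (simp add: fourier_fun_reflect)
qed

text \<open>The multiplication formula for the truncations, passed to the limit on both sides.\<close>

lemma fourier_limit_schwartz:
  assumes H: "square_integrable H" and h: "fourier_limit H h" and \<psi>: "\<psi> \<in> schwartz"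
  shows "(\<integral>x. h x * \<psi> x \<partial>lborel) = (\<integral>\<zeta>. H \<zeta> * fourier_fun \<psi> (- \<zeta>) \<partial>lborel)"
proof -
  obtain r G where r: "filterlim r at_top sequentially" and G: "square_integrable G" and
    ae: "AE x in lborel. (\<lambda>k. truncated_inverse (r k) H x) \<longlonglongrightarrow> h x \<and> (\<forall>k. norm (truncated_inverse (r k) H x) \<le> norm (G x))"
    using h unfolding fourier_limit_def by blast
  have [measurable]: "H \<in> borel_measurable borel" "h \<in> borel_measurable borel" "\<psi> \<in> borel_measurable borel"
    using H h \<psi> by (auto simp: square_integrable_def fourier_limit_def schwartz_measurable)
  have fr: "(\<lambda>\<zeta>. fourier_fun \<psi> (- \<zeta>)) \<in> schwartz" by (intro schwartz_reflect fourier_fun_schwartz \<psi>)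
  have "(\<lambda>k. \<integral>x. truncated_inverse (r k) H x * \<psi> x \<partial>lborel) \<longlonglongrightarrow> (\<integral>x. h x * \<psi> x \<partial>lborel)"
  proof (rule integral_dominated_convergence[where w = "\<lambda>x. norm (G x * \<psi> x)"])
    show "integrable lborel (\<lambda>x. norm (G x * \<psi> x))"
      by (intro integrable_norm square_integrable_mult G schwartz_square_integrable \<psi>)
    show "AE x in lborel. (\<lambda>k. truncated_inverse (r k) H x * \<psi> x) \<longlonglongrightarrow> h x * \<psi> x"
      using ae by eventually_elim (intro tendsto_intros, blast)
    show "AE x in lborel. norm (truncated_inverse (r k) H x * \<psi> x) \<le> norm (G x * \<psi> x)" for k
      using ae by eventually_elim (simp add: norm_mult mult_right_mono)
  qed measurable
  moreover have "(\<lambda>k. \<integral>\<zeta>. cutoff (r k) H \<zeta> * fourier_fun \<psi> (- \<zeta>) \<partial>lborel) \<longlonglongrightarrow> (\<integral>\<zeta>. H \<zeta> * fourier_fun \<psi> (- \<zeta>) \<partial>lborel)"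
  proof (rule integral_dominated_convergence[where w = "\<lambda>\<zeta>. norm (H \<zeta> * fourier_fun \<psi> (- \<zeta>))"])
    show "integrable lborel (\<lambda>\<zeta>. norm (H \<zeta> * fourier_fun \<psi> (- \<zeta>)))"
      by (intro integrable_norm square_integrable_mult H schwartz_square_integrable fr)
    show "AE \<zeta> in lborel. (\<lambda>k. cutoff (r k) H \<zeta> * fourier_fun \<psi> (- \<zeta>)) \<longlonglongrightarrow> H \<zeta> * fourier_fun \<psi> (- \<zeta>)"
      by (intro AE_I2 tendsto_intros cutoff_tendsto r)
    show "AE \<zeta> in lborel. norm (cutoff (r k) H \<zeta> * fourier_fun \<psi> (- \<zeta>)) \<le> norm (H \<zeta> * fourier_fun \<psi> (- \<zeta>))" for k
      by (intro AE_I2) (simp add: norm_mult mult_right_mono norm_cutoff_le)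
  qed measurable
  ultimately show ?thesis
    by (simp add: fourier_fun_multiplication_reflect[OF cutoff_integrable[OF H] schwartz_integrable[OF \<psi>]] LIMSEQ_unique)
qed

section \<open>The convolution theorem\<close>

definition convolution :: "('a::euclidean_space \<Rightarrow> complex) \<Rightarrow> ('a \<Rightarrow> complex) \<Rightarrow> 'a \<Rightarrow> complex" where
  "convolution F G z = (\<integral>w. F (z - w) * G w \<partial>lborel)"

lemma convolution_measurable [measurable]:
  assumes [measurable]: "F \<in> borel_measurable borel" "G \<in> borel_measurable borel"
  shows "convolution F G \<in> borel_measurable borel"
  unfolding convolution_def[abs_def] by measurable

lemma nn_integral_translate_minus:
  assumes [measurable]: "f \<in> borel_measurable borel"
  shows "(\<integral>\<^sup>+z. f (z - w) \<partial>lborel) = (\<integral>\<^sup>+z. f (z::'a::euclidean_space) \<partial>lborel)"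
  using nn_integral_lborel_translate[of f "- w"] by simp

text \<open>By \<open>a b \<le> a\<^sup>2 + b\<^sup>2\<close> the product of the two square integrable factors is bounded by a sum of
  functions whose integral in \<open>w\<close> does not depend on \<open>z\<close>.\<close>

lemma convolution_kernel_integrable:
  fixes F G \<phi> :: "'a::euclidean_space \<Rightarrow> complex"
  assumes F: "square_integrable F" and G: "square_integrable G" and \<phi>: "integrable lborel \<phi>"
  shows "integrable (lborel \<Otimes>\<^sub>M lborel) (\<lambda>(z, w). F (z - w) * G w * \<phi> z)"
proof (rule integrableI_bounded)
  have [measurable]: "F \<in> borel_measurable borel" "G \<in> borel_measurable borel" "\<phi> \<in> borel_measurable borel"
    using F G \<phi> by (auto simp: square_integrable_def)
  show "(\<lambda>(z, w). F (z - w) * G w * \<phi> z) \<in> borel_measurable (lborel \<Otimes>\<^sub>M lborel)" by measurable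
  let ?I = "\<lambda>F. square_integral F"
  have "(\<integral>\<^sup>+p. ennreal (norm (case p of (z, w) \<Rightarrow> F (z - w) * G w * \<phi> z)) \<partial>(lborel \<Otimes>\<^sub>M lborel))
    = (\<integral>\<^sup>+z. \<integral>\<^sup>+w. ennreal (norm (F (z - w) * G w * \<phi> z)) \<partial>lborel \<partial>lborel)"
    by (subst lborel.nn_integral_fst[symmetric]) (auto simp: split_beta')
  also have "\<dots> \<le> (\<integral>\<^sup>+z. \<integral>\<^sup>+w. (ennreal ((norm (F (z - w)))\<^sup>2) + ennreal ((norm (G w))\<^sup>2)) * ennreal (norm (\<phi> z)) \<partial>lborel \<partial>lborel)"
  proof (intro nn_integral_mono)
    fix z w
    have "norm (F (z - w)) * norm (G w) * norm (\<phi> z) \<le> ((norm (F (z - w)))\<^sup>2 + (norm (G w))\<^sup>2) * norm (\<phi> z)"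
      by (intro mult_right_mono mult_le_sum_squares) auto
    then show "ennreal (norm (F (z - w) * G w * \<phi> z)) \<le> (ennreal ((norm (F (z - w)))\<^sup>2) + ennreal ((norm (G w))\<^sup>2)) * ennreal (norm (\<phi> z))"
      by (simp add: norm_mult ennreal_mult[symmetric] ennreal_plus[symmetric] ennreal_leI del: ennreal_plus)
  qed
  also have "\<dots> = (\<integral>\<^sup>+z. (?I F + ?I G) * ennreal (norm (\<phi> z)) \<partial>lborel)"
    using nn_integral_lborel_reflect[of "\<lambda>x. ennreal ((norm (F x))\<^sup>2)"]
    by (simp add: nn_integral_multc nn_integral_add)
  also have "\<dots> = (?I F + ?I G) * (\<integral>\<^sup>+z. ennreal (norm (\<phi> z)) \<partial>lborel)"
    by (rule nn_integral_cmult) measurable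
  also have "\<dots> < \<infinity>"
    using F G \<phi> by (simp add: square_integrable_def integrable_iff_bounded ennreal_mult_less_top)
  finally show "(\<integral>\<^sup>+p. ennreal (norm (case p of (z, w) \<Rightarrow> F (z - w) * G w * \<phi> z)) \<partial>(lborel \<Otimes>\<^sub>M lborel)) < \<infinity>" .
qed

abbreviation convolution_pairing ::
    "('a::euclidean_space \<Rightarrow> complex) \<Rightarrow> ('a \<Rightarrow> complex) \<Rightarrow> ('a \<Rightarrow> complex) \<Rightarrow> complex" where
  "convolution_pairing F G \<phi> \<equiv> \<integral>(z, w). F (z - w) * G w * \<phi> z \<partial>(lborel \<Otimes>\<^sub>M lborel)"

text \<open>The two iterated integrals of the same kernel: the first is the convolution against \<open>\<phi>\<close>, the second is the form
  in which the inversion formula produces it.\<close>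

lemma convolution_pairing_eq:
  fixes F G \<phi> :: "'a::euclidean_space \<Rightarrow> complex"
  assumes F: "square_integrable F" and G: "square_integrable G" and \<phi>: "integrable lborel \<phi>"
  shows "convolution_pairing F G \<phi> = (\<integral>z. convolution F G z * \<phi> z \<partial>lborel)"
    and "integrable lborel (\<lambda>z. convolution F G z * \<phi> z)"
    and "convolution_pairing F G \<phi> = (\<integral>w. G w * (\<integral>\<zeta>. F \<zeta> * \<phi> (\<zeta> + w) \<partial>lborel) \<partial>lborel)"
proof -
  note K = convolution_kernel_integrable[OF assms]
  have [measurable]: "F \<in> borel_measurable borel" "\<phi> \<in> borel_measurable borel"
    using F \<phi> by (auto simp: square_integrable_def)
  show "convolution_pairing F G \<phi> = (\<integral>z. convolution F G z * \<phi> z \<partial>lborel)"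
    unfolding lborel_pair.integral_fst[OF K, symmetric] convolution_def by simp
  show "integrable lborel (\<lambda>z. convolution F G z * \<phi> z)"
    using lborel_pair.integrable_fst[OF K] unfolding convolution_def by simp
  have "(\<integral>z. F (z - w) * G w * \<phi> z \<partial>lborel) = G w * (\<integral>\<zeta>. F \<zeta> * \<phi> (\<zeta> + w) \<partial>lborel)" for w
  proof -
    have "(\<integral>z. F (z - w) * G w * \<phi> z \<partial>lborel) = G w * (\<integral>z. F (z - w) * \<phi> z \<partial>lborel)"
      by (subst integral_mult_right_zero[symmetric]) (simp add: mult_ac)
    also have "(\<integral>z. F (z - w) * \<phi> z \<partial>lborel) = (\<integral>\<zeta>. F \<zeta> * \<phi> (\<zeta> + w) \<partial>lborel)"
      using lborel_integral_affine[of "\<lambda>z. F (z - w) * \<phi> z" 1 w] by (simp add: add.commute)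
    finally show ?thesis .
  qed
  then show "convolution_pairing F G \<phi> = (\<integral>w. G w * (\<integral>\<zeta>. F \<zeta> * \<phi> (\<zeta> + w) \<partial>lborel) \<partial>lborel)"
    unfolding lborel_pair.integral_snd[OF K, symmetric] by simp
qed

text \<open>The multiplication formula is applied once for each factor; the remaining transform is
  that of a modulated \<open>fourier_fun \<phi>\<close>, to which the inversion formula applies.\<close>

lemma fourier_product_integrable:
  fixes F G \<phi> :: "'a::euclidean_space \<Rightarrow> complex"
  assumes F: "integrable lborel F" and G: "integrable lborel G" and \<phi>: "\<phi> \<in> schwartz"
  shows "(\<integral>x. fourier_fun F (- x) * fourier_fun G (- x) * fourier_fun \<phi> x \<partial>lborel)
    = of_real ((gauss_mass TYPE('a))\<^sup>2) * (\<integral>w. G w * (\<integral>\<zeta>. F \<zeta> * \<phi> (\<zeta> + w) \<partial>lborel) \<partial>lborel)"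
proof -
  have [measurable]: "F \<in> borel_measurable borel" "G \<in> borel_measurable borel" "\<phi> \<in> borel_measurable borel"
    using F G \<phi> by (auto simp: schwartz_measurable)
  let ?c = "complex_of_real ((gauss_mass TYPE('a))\<^sup>2)"
  have P: "integrable lborel (\<lambda>x. fourier_fun F (- x) * fourier_fun \<phi> x)"
    by (rule integrable_bounded_mult[OF schwartz_integrable[OF fourier_fun_schwartz[OF \<phi>]], where B = "\<integral>x. norm (F x) \<partial>lborel"])
       (auto simp: fourier_fun_bound)
  have "(\<integral>x. fourier_fun F (- x) * fourier_fun G (- x) * fourier_fun \<phi> x \<partial>lborel)
      = (\<integral>x. fourier_fun G (- x) * (fourier_fun F (- x) * fourier_fun \<phi> x) \<partial>lborel)"
    by (simp add: mult_ac)
  also have "\<dots> = (\<integral>w. G w * fourier_fun (\<lambda>x. fourier_fun F (- x) * fourier_fun \<phi> x) (- w) \<partial>lborel)"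
    by (rule fourier_fun_multiplication_reflect[OF G P])
  also have "(\<lambda>w. fourier_fun (\<lambda>x. fourier_fun F (- x) * fourier_fun \<phi> x) (- w)) = (\<lambda>w. ?c * (\<integral>\<zeta>. F \<zeta> * \<phi> (\<zeta> + w) \<partial>lborel))"
  proof
    fix w
    have "fourier_fun (\<lambda>x. fourier_fun F (- x) * fourier_fun \<phi> x) (- w)
        = (\<integral>x. fourier_fun F (- x) * (wave (- w) x * fourier_fun \<phi> x) \<partial>lborel)"
      unfolding fourier_fun_wave[of "\<lambda>x. fourier_fun F (- x) * fourier_fun \<phi> x"] by (simp add: mult_ac)
    also have "\<dots> = (\<integral>\<zeta>. F \<zeta> * fourier_fun (\<lambda>x. wave (- w) x * fourier_fun \<phi> x) (- \<zeta>) \<partial>lborel)"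
      by (intro fourier_fun_multiplication_reflect F schwartz_integrable schwartz_wave fourier_fun_schwartz \<phi>)
    also have "(\<lambda>\<zeta>. fourier_fun (\<lambda>x. wave (- w) x * fourier_fun \<phi> x) (- \<zeta>)) = (\<lambda>\<zeta>. ?c * \<phi> (\<zeta> + w))"
    proof
      fix \<zeta>
      have "fourier_fun (\<lambda>x. wave (- w) x * fourier_fun \<phi> x) (- \<zeta>) = fourier_fun (fourier_fun \<phi>) (- (\<zeta> + w))"
        unfolding fourier_fun_wave[of "\<lambda>x. wave (- w) x * fourier_fun \<phi> x"] fourier_fun_wave[of "fourier_fun \<phi>"]
        using wave_add_left[of "- \<zeta>" "- w"] by (simp add: mult.assoc)
      then show "fourier_fun (\<lambda>x. wave (- w) x * fourier_fun \<phi> x) (- \<zeta>) = ?c * \<phi> (\<zeta> + w)"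
        unfolding fourier_inversion[OF \<phi>] .
    qed
    finally show "fourier_fun (\<lambda>x. fourier_fun F (- x) * fourier_fun \<phi> x) (- w) = ?c * (\<integral>\<zeta>. F \<zeta> * \<phi> (\<zeta> + w) \<partial>lborel)"
      by (simp add: mult.left_commute[of "F _"])
  qed
  finally show ?thesis by (simp add: mult.left_commute[of "G _"])
qed

text \<open>The convolution theorem for square integrable functions, tested against Schwartz functions. It is
  passed to the limit from truncations.\<close>

lemma fourier_limit_product:
  fixes F G :: "'a::euclidean_space \<Rightarrow> complex"
  assumes F: "square_integrable F" "fourier_limit F f" and G: "square_integrable G" "fourier_limit G g"
    and \<phi>: "\<phi> \<in> schwartz"
  shows "(\<integral>x. f x * g x * fourier_fun \<phi> x \<partial>lborel)
    = of_real ((gauss_mass TYPE('a))\<^sup>2) * (\<integral>z. convolution F G z * \<phi> z \<partial>lborel)"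
proof -
  let ?c = "complex_of_real ((gauss_mass TYPE('a))\<^sup>2)"
  obtain r P where r: "filterlim r at_top sequentially" and P: "square_integrable P" and
    aeF: "AE x in lborel. (\<lambda>k. truncated_inverse (r k) F x) \<longlonglongrightarrow> f x \<and> (\<forall>k. norm (truncated_inverse (r k) F x) \<le> norm (P x))"
    using F unfolding fourier_limit_def by blast
  obtain q Q where q: "filterlim q at_top sequentially" and Q: "square_integrable Q" and
    aeG: "AE x in lborel. (\<lambda>k. truncated_inverse (q k) G x) \<longlonglongrightarrow> g x \<and> (\<forall>k. norm (truncated_inverse (q k) G x) \<le> norm (Q x))"
    using G unfolding fourier_limit_def by blast
  have [measurable]: "F \<in> borel_measurable borel" "G \<in> borel_measurable borel" "f \<in> borel_measurable borel" "g \<in> borel_measurable borel" "\<phi> \<in> borel_measurable borel"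
    using F G \<phi> by (auto simp: square_integrable_def fourier_limit_def schwartz_measurable)
  let ?Fk = "\<lambda>k. cutoff (r k) F" and ?Gk = "\<lambda>k. cutoff (q k) G"
  have "(\<lambda>k. \<integral>x. truncated_inverse (r k) F x * truncated_inverse (q k) G x * fourier_fun \<phi> x \<partial>lborel) \<longlonglongrightarrow> (\<integral>x. f x * g x * fourier_fun \<phi> x \<partial>lborel)"
  proof (rule integral_dominated_convergence[where w = "\<lambda>x. norm (fourier_fun \<phi> x * (P x * Q x))"])
    show "integrable lborel (\<lambda>x. norm (fourier_fun \<phi> x * (P x * Q x)))"
      by (intro integrable_norm integrable_bounded_mult[OF square_integrable_mult[OF P Q] _ fourier_fun_bound]) measurable
    show "AE x in lborel. (\<lambda>k. truncated_inverse (r k) F x * truncated_inverse (q k) G x * fourier_fun \<phi> x) \<longlonglongrightarrow> f x * g x * fourier_fun \<phi> x"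
      using aeF aeG by eventually_elim (intro tendsto_intros, auto)
    show "AE x in lborel. norm (truncated_inverse (r k) F x * truncated_inverse (q k) G x * fourier_fun \<phi> x) \<le> norm (fourier_fun \<phi> x * (P x * Q x))" for k
      using aeF aeG
    proof eventually_elim
      case (elim x)
      then have "norm (truncated_inverse (r k) F x) * norm (truncated_inverse (q k) G x) \<le> norm (P x) * norm (Q x)"
        by (intro mult_mono) auto
      then show ?case by (simp add: norm_mult mult.commute[of "norm (fourier_fun \<phi> x)"] mult_right_mono)
    qed
  qed measurable
  moreover have "(\<lambda>k. ?c * convolution_pairing (?Fk k) (?Gk k) \<phi>) \<longlonglongrightarrow> ?c * convolution_pairing F G \<phi>"
  proof (intro tendsto_intros integral_dominated_convergence[where w = "\<lambda>p. norm (case p of (z, w) \<Rightarrow> F (z - w) * G w * \<phi> z)"])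
    show "integrable (lborel \<Otimes>\<^sub>M lborel) (\<lambda>p. norm (case p of (z, w) \<Rightarrow> F (z - w) * G w * \<phi> z))"
      by (intro integrable_norm convolution_kernel_integrable F G schwartz_integrable \<phi>)
    show "AE p in lborel \<Otimes>\<^sub>M lborel. (\<lambda>k. case p of (z, w) \<Rightarrow> ?Fk k (z - w) * ?Gk k w * \<phi> z) \<longlonglongrightarrow> (case p of (z, w) \<Rightarrow> F (z - w) * G w * \<phi> z)"
      unfolding split_beta' by (intro AE_I2 tendsto_intros cutoff_tendsto r q)
    show "AE p in lborel \<Otimes>\<^sub>M lborel. norm (case p of (z, w) \<Rightarrow> ?Fk k (z - w) * ?Gk k w * \<phi> z) \<le> norm (case p of (z, w) \<Rightarrow> F (z - w) * G w * \<phi> z)" for k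
      unfolding split_beta' norm_mult by (intro AE_I2 mult_right_mono mult_mono norm_cutoff_le) auto
  qed measurable
  moreover have "(\<integral>x. truncated_inverse (r k) F x * truncated_inverse (q k) G x * fourier_fun \<phi> x \<partial>lborel) = ?c * convolution_pairing (?Fk k) (?Gk k) \<phi>" for k
    unfolding fourier_product_integrable[OF cutoff_integrable[OF F(1)] cutoff_integrable[OF G(1)] \<phi>]
      convolution_pairing_eq(3)[OF cutoff_square_integrable[OF F(1)] cutoff_square_integrable[OF G(1)] schwartz_integrable[OF \<phi>]] ..
  ultimately show ?thesis
    by (simp add: convolution_pairing_eq(1)[OF F(1) G(1) schwartz_integrable[OF \<phi>]] LIMSEQ_unique)
qed

section \<open>Distributions with square integrable Fourier transform\<close>

text \<open>The derivative of \<open>fourier_fun \<phi>\<close> is again the Fourier transform of a Schwartz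
  function, so the rule follows from the two definitions by duality.\<close>

lemma fourier_dist_deriv_density:
  assumes F: "has_density (fourier f) F"
  shows "has_density (fourier (dist_deriv b f)) (\<lambda>x. \<i> * of_real (x \<bullet> b) * F x)"
proof -
  have [measurable]: "F \<in> borel_measurable borel" using F by (simp add: has_density_def)
  have "integrable lborel (\<lambda>x. \<i> * of_real (x \<bullet> b) * F x * \<phi> x) \<and>
     fourier (dist_deriv b f) \<phi> = (\<integral>x. \<i> * of_real (x \<bullet> b) * F x * \<phi> x \<partial>lborel)" if \<phi>: "\<phi> \<in> schwartz" for \<phi>
  proof -
    let ?\<psi> = "\<lambda>x. - \<i> * (of_real (x \<bullet> b) * \<phi> x)"
    have \<psi>: "?\<psi> \<in> schwartz" by (intro schwartz_cmult schwartz_coordinate \<phi>)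
    have eq: "(\<lambda>x. \<i> * of_real (x \<bullet> b) * F x * \<phi> x) = (\<lambda>x. - (F x * ?\<psi> x))" by (auto simp: fun_eq_iff)
    have "fourier (dist_deriv b f) \<phi> = - fourier f ?\<psi>"
      by (simp add: fourier_def dist_deriv_def partial_fourier_fun[OF \<phi>])
    moreover have "integrable lborel (\<lambda>x. F x * ?\<psi> x) \<and> fourier f ?\<psi> = (\<integral>x. F x * ?\<psi> x \<partial>lborel)"
      by (rule bspec[OF conjunct2[OF F[unfolded has_density_def]] \<psi>])
    ultimately show ?thesis
      unfolding eq Bochner_Integration.integral_minus by (simp add: integrable_minus)
  qed
  then show ?thesis by (auto simp: has_density_def)
qed

text \<open>By inversion, every Schwartz function is the Fourier transform of a Schwartz function, so \<open>u\<close> is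
  determined by its Fourier transform.\<close>

lemma has_density_from_fourier:
  fixes u :: "('a::euclidean_space \<Rightarrow> complex) \<Rightarrow> complex"
  assumes u: "has_density (fourier u) H" and H: "square_integrable H" and h: "fourier_limit H h"
  shows "has_density u (\<lambda>x. h x / of_real ((gauss_mass TYPE('a))\<^sup>2))"
proof -
  let ?c = "complex_of_real ((gauss_mass TYPE('a))\<^sup>2)"
  have c: "?c \<noteq> 0" using gauss_mass_pos[where 'a = 'a] by simp
  have hs: "square_integrable h" using h by (simp add: fourier_limit_def)
  have "integrable lborel (\<lambda>x. h x / ?c * \<psi> x) \<and> u \<psi> = (\<integral>x. h x / ?c * \<psi> x \<partial>lborel)" if \<psi>: "\<psi> \<in> schwartz" for \<psi>
  proof -
    \<comment> \<open>The preimage of \<open>\<psi>\<close> under the Fourier transform.\<close>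
    let ?\<phi> = "\<lambda>\<zeta>. inverse ?c * fourier_fun \<psi> (- \<zeta>)"
    have \<phi>: "?\<phi> \<in> schwartz" by (intro schwartz_cmult schwartz_reflect fourier_fun_schwartz \<psi>)
    have "fourier_fun ?\<phi> = \<psi>"
    proof
      fix x
      have "fourier_fun ?\<phi> x = inverse ?c * (?c * \<psi> x)"
        unfolding fourier_fun_cmult fourier_inversion[OF \<psi>, symmetric]
        by (simp only: fourier_fun_reflect[OF fourier_fun_measurable[OF schwartz_measurable[OF \<psi>]]])
      then show "fourier_fun ?\<phi> x = \<psi> x" using c by simp
    qed
    then have "u \<psi> = fourier u ?\<phi>" by (simp add: fourier_def)
    also have "\<dots> = (\<integral>\<zeta>. H \<zeta> * ?\<phi> \<zeta> \<partial>lborel)" using u \<phi> unfolding has_density_def by blast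
    also have "\<dots> = inverse ?c * (\<integral>\<zeta>. H \<zeta> * fourier_fun \<psi> (- \<zeta>) \<partial>lborel)"
      by (simp add: mult.left_commute[of "H _"] flip: integral_mult_right_zero)
    also have "\<dots> = inverse ?c * (\<integral>x. h x * \<psi> x \<partial>lborel)"
      by (simp only: fourier_limit_schwartz[OF H h \<psi>])
    finally have "u \<psi> = (\<integral>x. inverse ?c * (h x * \<psi> x) \<partial>lborel)" by simp
    moreover have "integrable lborel (\<lambda>x. inverse ?c * (h x * \<psi> x))"
      by (intro integrable_mult_right square_integrable_mult hs schwartz_square_integrable \<psi>)
    moreover have "(\<lambda>x. h x / ?c * \<psi> x) = (\<lambda>x. inverse ?c * (h x * \<psi> x))"
      by (auto simp: fun_eq_iff divide_inverse)
    ultimately show ?thesis by simp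
  qed
  then show ?thesis using hs by (auto simp: has_density_def square_integrable_def)
qed

lemma integrable_mult_schwartz:
  assumes p: "integrable lborel p" and \<phi>: "\<phi> \<in> schwartz"
  shows "integrable lborel (\<lambda>x. p x * \<phi> x)"
proof -
  obtain B where B: "\<And>x. norm (\<phi> x) \<le> B" using schwartz_bound[OF \<phi>, of 0] by auto
  have "integrable lborel (\<lambda>x. \<phi> x * p x)"
    by (rule integrable_bounded_mult[OF p _ B]) (simp add: schwartz_measurable[OF \<phi>])
  then show ?thesis by (simp add: mult.commute)
qed

text \<open>The densities of \<open>u\<close> and \<open>v\<close> chosen by \<open>density_of\<close> agree almost everywhere with inverse transforms of \<open>F\<close> and
  \<open>G\<close>. Their product \<open>p\<close> is integrable, so it may be tested against every Schwartz function.\<close>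

lemma dist_mult_square_integrable:
  fixes u v :: "('a::euclidean_space \<Rightarrow> complex) \<Rightarrow> complex"
  assumes u: "has_density (fourier u) F" "square_integrable F"
    and v: "has_density (fourier v) G" "square_integrable G"
  obtains p where "dist_mult_defined u v" "integrable lborel p"
    "\<And>\<phi>. \<phi> \<in> schwartz \<Longrightarrow> dist_mult u v \<phi> = (\<integral>x. p x * \<phi> x \<partial>lborel)"
    "has_density (fourier (dist_mult u v)) (\<lambda>z. convolution F G z / of_real ((gauss_mass TYPE('a))\<^sup>2))"
proof -
  let ?c = "complex_of_real ((gauss_mass TYPE('a))\<^sup>2)"
  have c: "?c \<noteq> 0" using gauss_mass_pos[where 'a = 'a] by simp
  obtain f where f: "fourier_limit F f" using fourier_limit_exists[OF u(2)] by blast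
  obtain g where g: "fourier_limit G g" using fourier_limit_exists[OF v(2)] by blast
  note du = has_density_from_fourier[OF u f] and dv = has_density_from_fourier[OF v g]
  have [measurable]: "density_of u \<in> borel_measurable borel" "density_of v \<in> borel_measurable borel"
    using has_density_density_of[OF du] has_density_density_of[OF dv] by (auto simp: has_density_def)
  have sf: "square_integrable f" and sg: "square_integrable g" using f g by (auto simp: fourier_limit_def)
  then have [measurable]: "f \<in> borel_measurable borel" "g \<in> borel_measurable borel" by (auto simp: square_integrable_def)
  have [measurable]: "F \<in> borel_measurable borel" "G \<in> borel_measurable borel" using u v by (auto simp: square_integrable_def)
  define p where "p x = density_of u x * density_of v x" for x
  have [measurable]: "p \<in> borel_measurable borel" unfolding p_def[abs_def] by measurable
  have ae: "AE x in lborel. p x = inverse (?c * ?c) * (f x * g x)"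
    using density_of_AE[OF du] density_of_AE[OF dv] by eventually_elim (simp only: p_def divide_inverse inverse_mult_distrib mult_ac)
  have "integrable lborel (\<lambda>x. inverse (?c * ?c) * (f x * g x))"
    by (intro integrable_mult_right square_integrable_mult sf sg)
  then have p: "integrable lborel p"
    by (rule integrable_cong_AE_imp) (use ae in \<open>auto simp: p_def\<close>)
  have pphi: "integrable lborel (\<lambda>x. p x * \<phi> x)" if "\<phi> \<in> schwartz" for \<phi>
    by (rule integrable_mult_schwartz[OF p that])
  have defd: "dist_mult_defined u v"
    using du dv pphi unfolding dist_mult_defined_def p_def by blast
  then have val: "dist_mult u v \<phi> = (\<integral>x. p x * \<phi> x \<partial>lborel)" for \<phi>
    by (simp add: dist_mult_def p_def)
  have "has_density (fourier (dist_mult u v)) (\<lambda>z. convolution F G z / ?c)"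
    unfolding has_density_def
  proof (intro conjI ballI)
    fix \<phi> :: "'a \<Rightarrow> complex" assume \<phi>: "\<phi> \<in> schwartz"
    have [measurable]: "\<phi> \<in> borel_measurable borel" by (rule schwartz_measurable[OF \<phi>])
    note cp = convolution_pairing_eq(2)[OF u(2) v(2) schwartz_integrable[OF \<phi>]]
    have eq: "(\<lambda>x. convolution F G x / ?c * \<phi> x) = (\<lambda>x. inverse ?c * (convolution F G x * \<phi> x))"
      by (auto simp: fun_eq_iff divide_inverse)
    show "integrable lborel (\<lambda>x. convolution F G x / ?c * \<phi> x)"
      unfolding eq by (intro integrable_mult_right cp)
    have "fourier (dist_mult u v) \<phi> = (\<integral>x. p x * fourier_fun \<phi> x \<partial>lborel)"
      by (simp add: fourier_def val)
    also have "\<dots> = (\<integral>x. inverse (?c * ?c) * (f x * g x * fourier_fun \<phi> x) \<partial>lborel)"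
      by (rule integral_cong_AE) (use ae in \<open>auto simp: p_def\<close>)
    also have "\<dots> = inverse (?c * ?c) * (?c * (\<integral>z. convolution F G z * \<phi> z \<partial>lborel))"
      by (simp only: integral_mult_right_zero fourier_limit_product[OF u(2) f v(2) g \<phi>])
    also have "\<dots> = inverse ?c * (\<integral>z. convolution F G z * \<phi> z \<partial>lborel)"
      using c by (simp only: inverse_mult_distrib mult.assoc) simp
    also have "\<dots> = (\<integral>x. convolution F G x / ?c * \<phi> x \<partial>lborel)"
      unfolding eq by simp
    finally show "fourier (dist_mult u v) \<phi> = (\<integral>x. convolution F G x / ?c * \<phi> x \<partial>lborel)" .
  qed measurable
  then show ?thesis using defd p val by (intro that[of p]) 
qed

text \<open>Already the supremum norm of the test function bounds the functional.\<close>

lemma tempered_if_integrable_density: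
  fixes u :: "('a::euclidean_space \<Rightarrow> complex) \<Rightarrow> complex"
  assumes p: "integrable lborel p" and u: "\<And>\<phi>. \<phi> \<in> schwartz \<Longrightarrow> u \<phi> = (\<integral>x. p x * \<phi> x \<partial>lborel)"
  shows "tempered u"
proof -
  have int: "integrable lborel (\<lambda>x. p x * \<phi> x)" if "\<phi> \<in> schwartz" for \<phi>
    by (rule integrable_mult_schwartz[OF p that])
  have "norm (u \<phi>) \<le> (\<integral>x. norm (p x) \<partial>lborel) * schwartz_norm 0 \<phi>" if \<phi>: "\<phi> \<in> schwartz" for \<phi>
  proof -
    have "{bs. set bs \<subseteq> (Basis :: 'a set) \<and> length bs \<le> 0} = {[]}" by auto
    then have sn: "schwartz_norm 0 \<phi> = (SUP x. norm (\<phi> x))"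
      by (simp add: schwartz_norm_def iter_partial_def)
    obtain B where "\<And>x. norm (\<phi> x) \<le> B" using schwartz_bound[OF \<phi>, of 0] by auto
    then have "bdd_above (range (\<lambda>x. norm (\<phi> x)))" by (auto simp: bdd_above_def)
    then have le: "norm (\<phi> x) \<le> schwartz_norm 0 \<phi>" for x
      unfolding sn by (rule cSUP_upper2) auto
    have "norm (u \<phi>) \<le> (\<integral>x. norm (p x * \<phi> x) \<partial>lborel)" unfolding u[OF \<phi>] by (rule integral_norm_bound)
    also have "\<dots> \<le> (\<integral>x. norm (p x) * schwartz_norm 0 \<phi> \<partial>lborel)"
    proof (rule integral_mono)
      show "integrable lborel (\<lambda>x. norm (p x * \<phi> x))" by (rule integrable_norm[OF int[OF \<phi>]])
      show "integrable lborel (\<lambda>x. norm (p x) * schwartz_norm 0 \<phi>)" using p by simp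
    qed (simp add: norm_mult mult_left_mono le)
    finally show ?thesis by simp
  qed
  moreover have "u (\<lambda>x. \<phi> x + \<psi> x) = u \<phi> + u \<psi>" if "\<phi> \<in> schwartz" "\<psi> \<in> schwartz" for \<phi> \<psi>
    using int[OF that(1)] int[OF that(2)] that by (simp add: u schwartz_add distrib_left)
  moreover have "u (\<lambda>x. c * \<phi> x) = c * u \<phi>" if "\<phi> \<in> schwartz" for c \<phi>
    using that by (simp add: u schwartz_cmult mult.left_commute[of _ c])
  ultimately show ?thesis unfolding tempered_def by blast
qed

section \<open>The kernel of the null form\<close>

lemma japanese_ge_1 [simp]: "japanese x \<ge> 1" by (simp add: japanese_def)
lemma japanese_pos [simp]: "japanese x > 0" by (simp add: japanese_def add_pos_nonneg)

lemma japanese_nonneg [simp]: "japanese x \<ge> 0" by (rule less_imp_le[OF japanese_pos])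
lemma japanese_neq_0 [simp]: "japanese x \<noteq> 0" using japanese_pos[of x] by (rule less_imp_neq[symmetric])

lemma japanese_measurable [measurable (raw)]:
  fixes f :: "'a \<Rightarrow> 'b::{second_countable_topology, real_normed_vector}"
  assumes [measurable]: "f \<in> borel_measurable M"
  shows "(\<lambda>x. japanese (f x)) \<in> borel_measurable M"
  unfolding japanese_def by measurable

type_synonym 'n spacetime = "real \<times> (real ^ 'n)"

lemma nn_integral_vec_prod:
  fixes f :: "'n::finite \<Rightarrow> real \<Rightarrow> ennreal"
  assumes [measurable]: "\<And>i. f i \<in> borel_measurable borel"
  shows "(\<integral>\<^sup>+x. (\<Prod>i\<in>UNIV. f i (x $ i)) \<partial>(lborel :: (real ^ 'n) measure)) = (\<Prod>i\<in>UNIV. \<integral>\<^sup>+y. f i y \<partial>lborel)"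
proof -
  have bij: "bij_betw (\<lambda>i. axis i 1) UNIV (Basis :: (real ^ 'n) set)"
    by (rule bij_betw_byWitness[where f' = axis_index]) (auto simp: axis_index[symmetric])
  have "(\<integral>\<^sup>+x. (\<Prod>b\<in>Basis. f (axis_index b) (x \<bullet> b)) \<partial>(lborel :: (real ^ 'n) measure)) = (\<Prod>b\<in>(Basis :: (real ^ 'n) set). \<integral>\<^sup>+y. f (axis_index b) y \<partial>lborel)"
    by (rule nn_integral_lborel_prod) auto
  then show ?thesis
    unfolding prod.reindex_bij_betw[OF bij, symmetric] by (simp add: cart_eq_inner_axis)
qed

text \<open>The bracket is split equally among the \<open>n - 1\<close> coordinates other than \<open>k\<close>. This suits the later
  integration, as the exponent of each factor exceeds \<open>1\<close> exactly when \<open>2 a > n - 1\<close>.\<close>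

lemma japanese_powr_le_prod:
  fixes \<eta> :: "real ^ 'n" and k :: 'n
  assumes "CARD('n) \<ge> 2" and a: "a \<ge> 0"
  shows "japanese \<eta> powr (- (2 * a)) \<le> (\<Prod>i\<in>UNIV - {k}. japanese (\<eta> $ i) powr (- (2 * a / (real CARD('n) - 1))))"
proof -
  let ?\<beta> = "2 * a / (real CARD('n) - 1)"
  have card: "card (UNIV - {k}) = CARD('n) - 1" by (simp add: card_Diff_singleton)
  have n: "real (CARD('n) - 1) = real CARD('n) - 1" "real CARD('n) - 1 > 0" using assms(1) by auto
  have "(\<Prod>i\<in>UNIV - {k}. japanese (\<eta> $ i)) \<le> (\<Prod>i\<in>UNIV - {k}. japanese \<eta>)"
    by (intro prod_mono) (auto simp: japanese_def component_le_norm_cart)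
  also have "\<dots> = japanese \<eta> powr (real CARD('n) - 1)"
    by (simp only: prod_constant card n(1)[symmetric] powr_realpow[OF japanese_pos])
  finally have le: "(\<Prod>i\<in>UNIV - {k}. japanese (\<eta> $ i)) \<le> japanese \<eta> powr (real CARD('n) - 1)" .
  have "japanese \<eta> powr (- (2 * a)) = (japanese \<eta> powr (real CARD('n) - 1)) powr (- ?\<beta>)"
    using n(2) by (simp add: powr_powr)
  also have "\<dots> \<le> (\<Prod>i\<in>UNIV - {k}. japanese (\<eta> $ i)) powr (- ?\<beta>)"
    using le a n(2) by (intro powr_mono2') (auto intro!: prod_pos)
  also have "\<dots> = (\<Prod>i\<in>UNIV - {k}. japanese (\<eta> $ i) powr (- ?\<beta>))"
    by (rule prod_powr_distrib)
  finally show ?thesis .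
qed

text \<open>With \<open>w = (\<lambda>, \<eta>)\<close> the two last brackets contain \<open>c - (\<lambda> - \<sigma> \<eta>\<^sub>1)\<close> and \<open>\<lambda> + \<sigma> \<eta>\<^sub>1\<close>.
  So \<open>\<sigma> = 1\<close> and \<open>\<sigma> = - 1\<close> exchange the roles of the two null coordinates of \<open>w\<close>, and \<open>c\<close> is a null
  coordinate of the sum of the frequencies.\<close>

definition null_kernel :: "'n::finite \<Rightarrow> real \<Rightarrow> real \<Rightarrow> real \<Rightarrow> real \<Rightarrow> 'n spacetime \<Rightarrow> real" where
  "null_kernel k a \<theta> \<sigma> c w = japanese (snd w) powr (- (2 * a)) *
     (japanese (c - (fst w - \<sigma> * snd w $ k)) powr (- (2 * \<theta>)) * japanese (fst w + \<sigma> * snd w $ k) powr (- (2 * \<theta>)))"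

lemma null_kernel_nonneg: "null_kernel k a \<theta> \<sigma> c w \<ge> 0"
  by (simp add: null_kernel_def)

lemma vec_nth_measurable [measurable (raw)]:
  assumes "f \<in> borel_measurable M" shows "(\<lambda>x. (f x :: real ^ 'n) $ i) \<in> borel_measurable M"
  using assms unfolding cart_eq_inner_axis by measurable

lemma borel_pair_snd_measurable [measurable]:
  "fst \<in> borel_measurable (borel :: ('n::finite spacetime) measure)"
  "snd \<in> borel_measurable (borel :: ('n::finite spacetime) measure)"
  by (auto intro!: borel_measurable_continuous_onI continuous_intros)

lemma null_kernel_measurable [measurable (raw)]:
  assumes [measurable]: "f \<in> borel_measurable M" "c \<in> borel_measurable M"
  shows "(\<lambda>x. null_kernel k a \<theta> \<sigma> (c x) (f x)) \<in> borel_measurable M"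
proof -
  have [measurable]: "(\<lambda>x. fst (f x)) \<in> borel_measurable M" "(\<lambda>x. snd (f x)) \<in> borel_measurable M"
    using measurable_compose[OF assms(1) borel_pair_snd_measurable(1)] measurable_compose[OF assms(1) borel_pair_snd_measurable(2)] by auto
  show ?thesis unfolding null_kernel_def by measurable
qed

text \<open>The coordinates of \<open>\<eta>\<close> other than the \<open>k\<close>-th separate by \<open>japanese_powr_le_prod\<close>. In the
  remaining plane the two null directions are linearly independent, so after a change of variables the integral
  is a product of one-dimensional integrals, which converge because \<open>2 \<theta> > 1\<close>.\<close>

lemma null_kernel_integral_bound:
  fixes k :: "'n::finite"
  assumes n: "CARD('n) \<ge> 2" and a: "2 * a > real CARD('n) - 1" and \<theta>: "\<theta> > 1 / 2"
  obtains J :: real where "J \<ge> 0"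
    "\<And>\<sigma> c. \<sigma> = 1 \<or> \<sigma> = -1 \<Longrightarrow> (\<integral>\<^sup>+w. ennreal (null_kernel k a \<theta> \<sigma> c w) \<partial>lborel) \<le> ennreal J"
proof -
  define \<beta> where "\<beta> = 2 * a / (real CARD('n) - 1)"
  have \<beta>: "\<beta> > 1" using n a by (simp add: \<beta>_def)
  have a0: "a \<ge> 0" using a n by simp
  let ?g = "\<lambda>y::real. ennreal (japanese y powr (- \<beta>))"
  let ?h = "\<lambda>y::real. ennreal (japanese y powr (- (2 * \<theta>)))"
  define A where "A = (\<integral>\<^sup>+y. ?g y \<partial>lborel)"
  define B where "B = (\<integral>\<^sup>+y. ?h y \<partial>lborel)"
  have A: "A < \<infinity>" unfolding A_def by (rule nn_integral_japanese_finite[OF \<beta>])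
  have B: "B < \<infinity>" unfolding B_def using \<theta> by (intro nn_integral_japanese_finite) simp
  have main: "(\<integral>\<^sup>+w. ennreal (null_kernel k a \<theta> \<sigma> c w) \<partial>lborel) \<le> A ^ (CARD('n) - 1) * (B * B)" if \<sigma>: "\<sigma> = 1 \<or> \<sigma> = -1" for \<sigma> c
  proof -
    let ?K = "\<lambda>l \<eta>. ennreal (null_kernel k a \<theta> \<sigma> c (l, \<eta>))"
    let ?j = "\<lambda>l y. ?h (c - (l - \<sigma> * y)) * ?h (l + \<sigma> * y)"
    have inner: "(\<integral>\<^sup>+\<eta>. ?K l \<eta> \<partial>lborel) \<le> (\<integral>\<^sup>+y. ?j l y \<partial>lborel) * A ^ (CARD('n) - 1)" for l
    proof -
      let ?f = "\<lambda>i. if i = k then ?j l else ?g"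
      have split: "(\<Prod>i\<in>UNIV. ?f i (\<eta> $ i)) = ?j l (\<eta> $ k) * (\<Prod>i\<in>UNIV - {k}. ?g (\<eta> $ i))" for \<eta> :: "real ^ 'n"
      proof -
        have "(\<Prod>i\<in>UNIV - {k}. ?f i (\<eta> $ i)) = (\<Prod>i\<in>UNIV - {k}. ?g (\<eta> $ i))"
          by (rule prod.cong) simp_all
        then show ?thesis by (subst prod.remove[of UNIV k]) simp_all
      qed
      have "(\<integral>\<^sup>+\<eta>. ?K l \<eta> \<partial>lborel) \<le> (\<integral>\<^sup>+\<eta>. (\<Prod>i\<in>UNIV. ?f i (\<eta> $ i)) \<partial>lborel)"
      proof (rule nn_integral_mono)
        fix \<eta> :: "real ^ 'n"
        have "null_kernel k a \<theta> \<sigma> c (l, \<eta>) \<le> (\<Prod>i\<in>UNIV - {k}. japanese (\<eta> $ i) powr (- \<beta>)) *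
           (japanese (c - (l - \<sigma> * \<eta> $ k)) powr (- (2 * \<theta>)) * japanese (l + \<sigma> * \<eta> $ k) powr (- (2 * \<theta>)))"
          unfolding null_kernel_def fst_conv snd_conv \<beta>_def
          by (intro mult_right_mono japanese_powr_le_prod[OF n a0]) auto
        then have "?K l \<eta> \<le> ennreal ((\<Prod>i\<in>UNIV - {k}. japanese (\<eta> $ i) powr (- \<beta>)) *
           (japanese (c - (l - \<sigma> * \<eta> $ k)) powr (- (2 * \<theta>)) * japanese (l + \<sigma> * \<eta> $ k) powr (- (2 * \<theta>))))"
          by (rule ennreal_leI)
        also have "\<dots> = (\<Prod>i\<in>UNIV. ?f i (\<eta> $ i))"
          unfolding split by (simp add: ennreal_mult prod_ennreal prod_nonneg mult_ac)
        finally show "?K l \<eta> \<le> (\<Prod>i\<in>UNIV. ?f i (\<eta> $ i))" .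
      qed
      also have "\<dots> = (\<Prod>i\<in>UNIV. \<integral>\<^sup>+y. ?f i y \<partial>lborel)"
        by (rule nn_integral_vec_prod) auto
      also have "\<dots> = (\<integral>\<^sup>+y. ?j l y \<partial>lborel) * A ^ (CARD('n) - 1)"
      proof -
        have "(\<Prod>i\<in>UNIV - {k}. \<integral>\<^sup>+y. ?f i y \<partial>lborel) = (\<Prod>i\<in>UNIV - {k}. A)"
          by (rule prod.cong) (simp_all add: A_def)
        also have "\<dots> = A ^ (CARD('n) - 1)" by (simp add: card_Diff_singleton)
        finally show ?thesis by (subst prod.remove[of UNIV k]) simp_all
      qed
      finally show ?thesis .
    qed
    have yint: "(\<integral>\<^sup>+y. ?j l y \<partial>lborel) = (\<integral>\<^sup>+\<mu>. ?h (c + \<mu> - 2 * l) * ?h \<mu> \<partial>lborel)" for l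
    proof -
      have "(\<integral>\<^sup>+\<mu>. ?h (c + \<mu> - 2 * l) * ?h \<mu> \<partial>lborel) = \<bar>\<sigma>\<bar> * (\<integral>\<^sup>+y. ?h (c + (l + \<sigma> * y) - 2 * l) * ?h (l + \<sigma> * y) \<partial>lborel)"
        using \<sigma> by (intro nn_integral_real_affine) auto
      also have "\<dots> = (\<integral>\<^sup>+y. ?j l y \<partial>lborel)"
      proof -
        have "c + (l + \<sigma> * y) - 2 * l = c - (l - \<sigma> * y)" for y by simp
        moreover have "\<bar>\<sigma>\<bar> = 1" using \<sigma> by auto
        ultimately show ?thesis by (simp only: ennreal_1 mult_1)
      qed
      finally show ?thesis by (rule sym)
    qed
    \<comment> \<open>Here \<open>\<mu>\<close> is the null coordinate \<open>l + \<sigma> y\<close>, which replaces \<open>y\<close>.\<close>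
    have "(\<integral>\<^sup>+l. (\<integral>\<^sup>+\<mu>. ?h (c + \<mu> - 2 * l) * ?h \<mu> \<partial>lborel) \<partial>lborel) = (\<integral>\<^sup>+\<mu>. (\<integral>\<^sup>+l. ?h (c + \<mu> - 2 * l) * ?h \<mu> \<partial>lborel) \<partial>lborel)"
      by (rule lborel_pair.Fubini'[symmetric]) measurable
    also have "\<dots> = (\<integral>\<^sup>+\<mu>. (\<integral>\<^sup>+l. ?h (c + \<mu> - 2 * l) \<partial>lborel) * ?h \<mu> \<partial>lborel)"
      by (simp add: nn_integral_multc)
    also have "\<dots> \<le> (\<integral>\<^sup>+\<mu>. B * ?h \<mu> \<partial>lborel)"
    proof (intro nn_integral_mono mult_right_mono)
      fix \<mu>
      let ?I = "\<integral>\<^sup>+l. ?h (c + \<mu> + (- 2) * l) \<partial>lborel"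
      have "B = ennreal \<bar>- 2\<bar> * ?I"
        unfolding B_def by (rule nn_integral_real_affine) auto
      moreover have "1 * ?I \<le> ennreal \<bar>- 2\<bar> * ?I" by (intro mult_right_mono) simp_all
      ultimately have "?I \<le> B" by (simp only: mult_1)
      then show "(\<integral>\<^sup>+l. ?h (c + \<mu> - 2 * l) \<partial>lborel) \<le> B" by simp
    qed simp
    also have "\<dots> = B * B" unfolding B_def by (rule nn_integral_cmult) measurable
    finally have planar: "(\<integral>\<^sup>+l. (\<integral>\<^sup>+\<mu>. ?h (c + \<mu> - 2 * l) * ?h \<mu> \<partial>lborel) \<partial>lborel) \<le> B * B" .
    have meas: "(\<lambda>w. ennreal (null_kernel k a \<theta> \<sigma> c w)) \<in> borel_measurable (lborel \<Otimes>\<^sub>M lborel)"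
      unfolding lborel_prod by (intro measurable_compose[OF null_kernel_measurable measurable_ennreal] measurable_const measurable_ident_sets) simp_all
    have "(\<integral>\<^sup>+w. ennreal (null_kernel k a \<theta> \<sigma> c w) \<partial>lborel) = (\<integral>\<^sup>+l. \<integral>\<^sup>+\<eta>. ?K l \<eta> \<partial>lborel \<partial>lborel)"
      by (rule lborel.nn_integral_fst[OF meas, unfolded lborel_prod, symmetric])
    also have "\<dots> \<le> (\<integral>\<^sup>+l. (\<integral>\<^sup>+\<mu>. ?h (c + \<mu> - 2 * l) * ?h \<mu> \<partial>lborel) * A ^ (CARD('n) - 1) \<partial>lborel)"
      using inner unfolding yint by (intro nn_integral_mono)
    also have "\<dots> = (\<integral>\<^sup>+l. (\<integral>\<^sup>+\<mu>. ?h (c + \<mu> - 2 * l) * ?h \<mu> \<partial>lborel) \<partial>lborel) * A ^ (CARD('n) - 1)"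
      by (rule nn_integral_multc) measurable
    also have "\<dots> \<le> (B * B) * A ^ (CARD('n) - 1)"
      by (rule mult_right_mono[OF planar]) simp
    finally show ?thesis by (simp only: mult.commute)
  qed
  have fin: "A ^ (CARD('n) - 1) * (B * B) < \<infinity>"
    using A B by (simp add: ennreal_mult_less_top power_less_top_ennreal)
  show ?thesis
    by (rule that[of "enn2real (A ^ (CARD('n) - 1) * (B * B))"]) (use main fin in \<open>auto simp: less_top\<close>)
qed

section \<open>The null form estimate in Fourier space\<close>

text \<open>Of \<open>|u|\<close> and \<open>|v|\<close> the larger is \<open>|\<tau>| + |x|\<close> and the smaller is \<open>||\<tau>| - |x||\<close>. If \<open>v\<close> is the smaller one, the
  claim is immediate. Otherwise a factor \<open>\<langle>u\<rangle> powr (1 - \<theta>)\<close> is traded for the larger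
  \<open>\<langle>v\<rangle> powr (1 - \<theta>)\<close>, which needs \<open>\<theta> \<le> 1\<close>.\<close>

lemma null_weight_bound:
  assumes \<theta>: "0 \<le> \<theta>" "\<theta> \<le> 1" and u: "u = \<tau> + x \<and> v = \<tau> - x \<or> u = \<tau> - x \<and> v = \<tau> + (x::real)"
  shows "\<bar>u\<bar> * japanese v powr \<theta> \<le> (1 + \<bar>\<tau>\<bar> + \<bar>x\<bar>) * japanese (\<bar>\<tau>\<bar> - \<bar>x\<bar>) powr \<theta>"
proof (cases "\<bar>v\<bar> \<le> \<bar>u\<bar>")
  case True
  then have "japanese (\<bar>\<tau>\<bar> - \<bar>x\<bar>) = japanese v" using u by (auto simp: japanese_def)
  moreover have "\<bar>u\<bar> \<le> 1 + \<bar>\<tau>\<bar> + \<bar>x\<bar>" using u by auto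
  ultimately show ?thesis by (simp add: mult_right_mono)
next
  case False
  then have m: "japanese (\<bar>\<tau>\<bar> - \<bar>x\<bar>) = japanese u" using u by (auto simp: japanese_def)
  have le: "japanese u \<le> japanese v" using False by (simp add: japanese_def)
  have "\<bar>u\<bar> * japanese v powr \<theta> \<le> japanese u * japanese v powr \<theta>" by (intro mult_right_mono) (auto simp: japanese_def)
  also have "japanese u = japanese u powr (1 - \<theta>) * japanese u powr \<theta>"
    by (simp flip: powr_add)
  also have "\<dots> * japanese v powr \<theta> \<le> japanese v powr (1 - \<theta>) * japanese u powr \<theta> * japanese v powr \<theta>"
    using \<theta> le by (intro mult_right_mono powr_mono2) auto
  also have "\<dots> = (japanese v powr (1 - \<theta>) * japanese v powr \<theta>) * japanese u powr \<theta>" by (simp add: mult_ac)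
  also have "japanese v powr (1 - \<theta>) * japanese v powr \<theta> = japanese v"
    by (simp flip: powr_add)
  also have "japanese v * japanese u powr \<theta> \<le> (1 + \<bar>\<tau>\<bar> + \<bar>x\<bar>) * japanese u powr \<theta>"
    using u by (intro mult_right_mono) (auto simp: japanese_def)
  finally show ?thesis by (simp add: m)
qed

text \<open>The weight whose \<open>L\<^sup>2\<close> norm is controlled by \<open>H_norm_t k a 1 \<theta>\<close>: the norm of \<open>f\<close> contributes
  \<open>\<langle>\<xi>\<^sub>1\<rangle> = 1 + |\<xi>\<^sub>1|\<close> and that of the time derivative contributes \<open>|\<tau>|\<close>.\<close>

definition energy_weight :: "'n::finite \<Rightarrow> real \<Rightarrow> real \<Rightarrow> 'n spacetime \<Rightarrow> real" where
  "energy_weight k a \<theta> w = japanese (snd w) powr a *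
     ((1 + \<bar>fst w\<bar> + \<bar>snd w $ k\<bar>) * japanese (\<bar>fst w\<bar> - \<bar>snd w $ k\<bar>) powr \<theta>)"

lemma energy_weight_measurable [measurable]: "energy_weight k a \<theta> \<in> borel_measurable borel"
  unfolding energy_weight_def[abs_def] by measurable

abbreviation energy :: "'n::finite \<Rightarrow> real \<Rightarrow> real \<Rightarrow> ('n spacetime \<Rightarrow> complex) \<Rightarrow> ennreal" where
  "energy k a \<theta> F \<equiv> \<integral>\<^sup>+z. ennreal ((energy_weight k a \<theta> z * norm (F z))\<^sup>2) \<partial>lborel"

lemma energy_weight_pos: "energy_weight k a \<theta> w > 0"
  unfolding energy_weight_def by (intro mult_pos_pos) (simp_all add: add_pos_nonneg)

text \<open>The polarisation of \<open>\<tau>\<^sup>2 - \<xi>\<^sub>1\<^sup>2\<close>. The symbol of \<open>Q\<^sub>0\<close> is its negative, since each derivative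
  contributes a factor \<open>\<i>\<close>.\<close>

definition null_symbol :: "'n::finite \<Rightarrow> 'n spacetime \<Rightarrow> 'n spacetime \<Rightarrow> real" where
  "null_symbol k p w = fst p * fst w - snd p $ k * snd w $ k"

abbreviation null_convolution ::
    "'n::finite \<Rightarrow> ('n spacetime \<Rightarrow> complex) \<Rightarrow> ('n spacetime \<Rightarrow> complex) \<Rightarrow> 'n spacetime \<Rightarrow> ennreal" where
  "null_convolution k F G z \<equiv> \<integral>\<^sup>+w. ennreal (\<bar>null_symbol k (z - w) w\<bar> * norm (F (z - w)) * norm (G w)) \<partial>lborel"

text \<open>The weight of the sum is paid for by the larger of the two weights, and the inverse of the other one is gained.\<close>

lemma japanese_powr_triangle:
  fixes x y :: "'a::real_normed_vector"
  assumes "a \<ge> 0"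
  shows "japanese (x + y) powr a \<le> 2 powr a * (japanese x powr a * japanese y powr a) * (japanese x powr (- a) + japanese y powr (- a))"
proof -
  have "japanese (x + y) \<le> 2 * max (japanese x) (japanese y)"
    using norm_triangle_ineq[of x y] unfolding japanese_def max_def by auto
  then have "japanese (x + y) powr a \<le> (2 * max (japanese x) (japanese y)) powr a"
    using assms by (intro powr_mono2) auto
  also have "\<dots> = 2 powr a * (max (japanese x) (japanese y)) powr a"
    by (rule powr_mult)
  also have "\<dots> \<le> 2 powr a * (japanese x powr a + japanese y powr a)"
    by (intro mult_left_mono) (auto simp: max_def)
  also have "\<dots> = 2 powr a * (japanese x powr a * japanese y powr a) * (japanese x powr (- a) + japanese y powr (- a))"
  proof -
    have "japanese z powr a * japanese z powr (- a) = 1" for z :: 'a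
      by (simp flip: powr_add)
    moreover have "(japanese x powr a * japanese y powr a) * (japanese x powr (- a) + japanese y powr (- a))
        = (japanese x powr a * japanese x powr (- a)) * japanese y powr a + (japanese y powr a * japanese y powr (- a)) * japanese x powr a"
      by (simp only: ring_distribs mult_ac)
    ultimately show ?thesis by (simp only: mult.assoc mult_1) (simp add: mult_ac)
  qed
  finally show ?thesis .
qed

lemma square_powr_eq: "0 < (x::real) \<Longrightarrow> (x powr (- t))\<^sup>2 = x powr (- (2 * t))"
  by (simp add: power2_eq_square powr_add[symmetric])

text \<open>The four kernels arise from two choices: which of the two frequencies keeps its inverse weight
  \<open>\<langle>\<xi>\<rangle> powr (- a)\<close>, and which of the terms \<open>u\<^sub>1 v\<^sub>2\<close> and \<open>v\<^sub>1 u\<^sub>2\<close> of the symbol is meant.\<close>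

lemma null_symbol_bound:
  fixes k :: "'n::finite" and z w :: "'n spacetime"
  assumes a: "a \<ge> 0" and \<theta>: "0 \<le> \<theta>" "\<theta> \<le> 1"
  defines "U \<equiv> fst z + snd z $ k" and "V \<equiv> fst z - snd z $ k"
  shows "(japanese (snd z) powr a * \<bar>null_symbol k (z - w) w\<bar>) \<le> 2 powr a *
     sqrt (null_kernel k a \<theta> 1 V w + null_kernel k a \<theta> (-1) U w + null_kernel k a \<theta> (-1) U (z - w) + null_kernel k a \<theta> 1 V (z - w)) *
     (energy_weight k a \<theta> (z - w) * energy_weight k a \<theta> w)"
proof -
  define p where "p = z - w"
  define u1 where "u1 = fst p + snd p $ k"
  define v1 where "v1 = fst p - snd p $ k"
  define u2 where "u2 = fst w + snd w $ k"
  define v2 where "v2 = fst w - snd w $ k"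
  define A where "A = japanese (snd p) powr (- a)"
  define B where "B = japanese (snd w) powr (- a)"
  define C where "C = japanese v1 powr (- \<theta>) * japanese u2 powr (- \<theta>)"
  define D where "D = japanese u1 powr (- \<theta>) * japanese v2 powr (- \<theta>)"
  define M1 where "M1 = (1 + \<bar>fst p\<bar> + \<bar>snd p $ k\<bar>) * japanese (\<bar>fst p\<bar> - \<bar>snd p $ k\<bar>) powr \<theta>"
  define M2 where "M2 = (1 + \<bar>fst w\<bar> + \<bar>snd w $ k\<bar>) * japanese (\<bar>fst w\<bar> - \<bar>snd w $ k\<bar>) powr \<theta>"
  have nn: "A \<ge> 0" "B \<ge> 0" "C \<ge> 0" "D \<ge> 0" "M1 \<ge> 0" "M2 \<ge> 0"
    by (auto simp: A_def B_def C_def D_def M1_def M2_def)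
  have cancel: "\<bar>x\<bar> \<le> M * japanese y powr (- \<theta>)" if "\<bar>x\<bar> * japanese y powr \<theta> \<le> M" for x y M :: real
    using that by (simp add: powr_minus field_simps)
  have "\<bar>u1\<bar> \<le> M1 * japanese v1 powr (- \<theta>)" "\<bar>v1\<bar> \<le> M1 * japanese u1 powr (- \<theta>)"
    "\<bar>u2\<bar> \<le> M2 * japanese v2 powr (- \<theta>)" "\<bar>v2\<bar> \<le> M2 * japanese u2 powr (- \<theta>)"
    unfolding u1_def v1_def u2_def v2_def M1_def M2_def by (intro cancel null_weight_bound \<theta>; simp)+
  then have "\<bar>u1\<bar> * \<bar>v2\<bar> \<le> (M1 * japanese v1 powr (- \<theta>)) * (M2 * japanese u2 powr (- \<theta>))"
     "\<bar>v1\<bar> * \<bar>u2\<bar> \<le> (M1 * japanese u1 powr (- \<theta>)) * (M2 * japanese v2 powr (- \<theta>))"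
    using nn by (auto intro!: mult_mono)
  then have uv: "\<bar>u1\<bar> * \<bar>v2\<bar> \<le> M1 * M2 * C" "\<bar>v1\<bar> * \<bar>u2\<bar> \<le> M1 * M2 * D"
    by (simp_all add: C_def D_def mult_ac)
  \<comment> \<open>The null structure: only products of transversal null coordinates.\<close>
  have "null_symbol k p w = (u1 * v2 + v1 * u2) / 2"
    by (simp add: null_symbol_def u1_def v1_def u2_def v2_def algebra_simps)
  then have "\<bar>null_symbol k p w\<bar> \<le> (\<bar>u1\<bar> * \<bar>v2\<bar> + \<bar>v1\<bar> * \<bar>u2\<bar>) / 2"
    using abs_triangle_ineq[of "u1 * v2" "v1 * u2"] by (simp only: abs_mult abs_divide abs_numeral divide_right_mono zero_le_numeral)
  also have "\<dots> \<le> M1 * M2 * ((C + D) / 2)" using uv by (simp add: field_simps)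
  finally have sym: "\<bar>null_symbol k p w\<bar> \<le> M1 * M2 * ((C + D) / 2)" .
  have zp: "snd z = snd p + snd w" by (simp add: p_def)
  have "japanese (snd z) powr a * \<bar>null_symbol k p w\<bar>
     \<le> (2 powr a * (japanese (snd p) powr a * japanese (snd w) powr a) * (A + B)) * (M1 * M2 * ((C + D) / 2))"
    unfolding zp A_def B_def by (intro mult_mono japanese_powr_triangle a sym) auto
  also have "\<dots> = 2 powr a * ((A + B) * ((C + D) / 2)) * (energy_weight k a \<theta> p * energy_weight k a \<theta> w)"
    by (simp add: energy_weight_def M1_def M2_def mult_ac)
  also have "\<dots> \<le> 2 powr a * sqrt ((A\<^sup>2 + B\<^sup>2) * (C\<^sup>2 + D\<^sup>2)) * (energy_weight k a \<theta> p * energy_weight k a \<theta> w)"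
  proof (intro mult_right_mono mult_left_mono real_le_rsqrt mult_nonneg_nonneg less_imp_le[OF energy_weight_pos])
    have sq: "(x + y)\<^sup>2 \<le> 2 * (x\<^sup>2 + y\<^sup>2)" for x y :: real
      using sum_squares_bound[of x y] by (simp add: power2_sum)
    have "((A + B) * ((C + D) / 2))\<^sup>2 = (A + B)\<^sup>2 * (C + D)\<^sup>2 / 4" by (simp add: power_mult_distrib power_divide)
    also have "\<dots> \<le> (2 * (A\<^sup>2 + B\<^sup>2)) * (2 * (C\<^sup>2 + D\<^sup>2)) / 4"
      by (intro divide_right_mono mult_mono sq) auto
    also have "\<dots> = (A\<^sup>2 + B\<^sup>2) * (C\<^sup>2 + D\<^sup>2)" by (simp add: algebra_simps)
    finally show "((A + B) * ((C + D) / 2))\<^sup>2 \<le> (A\<^sup>2 + B\<^sup>2) * (C\<^sup>2 + D\<^sup>2)" .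
  qed auto
  also have "(A\<^sup>2 + B\<^sup>2) * (C\<^sup>2 + D\<^sup>2) = null_kernel k a \<theta> 1 V w + null_kernel k a \<theta> (-1) U w + null_kernel k a \<theta> (-1) U p + null_kernel k a \<theta> 1 V p"
  proof -
    \<comment> \<open>The null coordinates of \<open>z\<close> are the sums of those of \<open>p\<close> and \<open>w\<close>.\<close>
    have e: "V - v2 = v1" "U - u2 = u1" "U - u1 = u2" "V - v1 = v2"
      by (simp_all add: U_def V_def u1_def v1_def u2_def v2_def p_def)
    have "B\<^sup>2 * C\<^sup>2 = null_kernel k a \<theta> 1 V w" "B\<^sup>2 * D\<^sup>2 = null_kernel k a \<theta> (-1) U w"
      "A\<^sup>2 * C\<^sup>2 = null_kernel k a \<theta> (-1) U p" "A\<^sup>2 * D\<^sup>2 = null_kernel k a \<theta> 1 V p"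
      unfolding A_def B_def C_def D_def null_kernel_def
      by (simp_all add: power_mult_distrib square_powr_eq e u1_def[symmetric] v1_def[symmetric] u2_def[symmetric] v2_def[symmetric])
    then show ?thesis by (simp add: algebra_simps)
  qed
  finally show ?thesis unfolding p_def .
qed

text \<open>The Cauchy-Schwarz inequality in \<open>w\<close> separates the kernel, whose square integral is bounded
  uniformly in \<open>z\<close>, from the product of the weighted functions, whose square integral over \<open>z\<close> factorises.\<close>

theorem null_form_estimate:
  fixes k :: "'n::finite"
  assumes n: "CARD('n) \<ge> 2" and a: "2 * a > real CARD('n) - 1" and \<theta>: "1 / 2 < \<theta>" "\<theta> \<le> 1"
  obtains D :: real where "D \<ge> 0"
    "\<And>(F :: 'n spacetime \<Rightarrow> complex) (G :: 'n spacetime \<Rightarrow> complex). F \<in> borel_measurable borel \<Longrightarrow> G \<in> borel_measurable borel \<Longrightarrow>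
     (\<integral>\<^sup>+z. (ennreal (japanese (snd z) powr a) * null_convolution k F G z)\<^sup>2 \<partial>lborel)
     \<le> ennreal D * energy k a \<theta> F
         * energy k a \<theta> G"
proof -
  have a0: "a \<ge> 0" using n a by simp
  obtain J where J: "J \<ge> 0" "\<And>\<sigma> c. \<sigma> = 1 \<or> \<sigma> = -1 \<Longrightarrow> (\<integral>\<^sup>+w. ennreal (null_kernel k a \<theta> \<sigma> c w) \<partial>lborel) \<le> ennreal J"
    using null_kernel_integral_bound[OF n a \<theta>(1)] by blast
  let ?W = "energy_weight k a \<theta>"
  have main: "(\<integral>\<^sup>+z. (ennreal (japanese (snd z) powr a) * null_convolution k F G z)\<^sup>2 \<partial>lborel)
     \<le> ennreal ((2 powr a)\<^sup>2 * (4 * J)) * (\<integral>\<^sup>+w. ennreal ((?W w * norm (F w))\<^sup>2) \<partial>lborel) * (\<integral>\<^sup>+w. ennreal ((?W w * norm (G w))\<^sup>2) \<partial>lborel)"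
    if [measurable]: "F \<in> borel_measurable borel" "G \<in> borel_measurable borel" for F G :: "'n spacetime \<Rightarrow> complex"
  proof -
    define S where "S z w = null_kernel k a \<theta> 1 (fst z - snd z $ k) w + null_kernel k a \<theta> (-1) (fst z + snd z $ k) w
        + null_kernel k a \<theta> (-1) (fst z + snd z $ k) (z - w) + null_kernel k a \<theta> 1 (fst z - snd z $ k) (z - w)" for z w
    define f where "f w = ?W w * norm (F w)" for w
    define g where "g w = ?W w * norm (G w)" for w
    let ?L = "\<lambda>z. (ennreal (japanese (snd z) powr a) * null_convolution k F G z)\<^sup>2"
    let ?FG = "\<lambda>z. \<integral>\<^sup>+w. ennreal ((f (z - w))\<^sup>2) * ennreal ((g w)\<^sup>2) \<partial>lborel"
    have [measurable]: "f \<in> borel_measurable borel" "g \<in> borel_measurable borel" unfolding f_def g_def by measurable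
    have [measurable]: "S z \<in> borel_measurable borel" for z unfolding S_def by measurable
    have S0: "S z w \<ge> 0" for z w by (simp add: S_def null_kernel_nonneg)
    have fg0: "f w \<ge> 0" "g w \<ge> 0" for w by (simp_all add: f_def g_def less_imp_le[OF energy_weight_pos])
    have Sint: "(\<integral>\<^sup>+w. ennreal (S z w) \<partial>lborel) \<le> ennreal (4 * J)" for z
    proof -
      have refl: "(\<integral>\<^sup>+w. ennreal (null_kernel k a \<theta> \<sigma> c (z - w)) \<partial>lborel) = (\<integral>\<^sup>+w. ennreal (null_kernel k a \<theta> \<sigma> c w) \<partial>lborel)" for \<sigma> c
        by (rule nn_integral_lborel_reflect) measurable
      have "(\<integral>\<^sup>+w. ennreal (S z w) \<partial>lborel) \<le> ennreal J + ennreal J + ennreal J + ennreal J"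
        unfolding S_def by (simp add: null_kernel_nonneg nn_integral_add refl add_mono J)
      also have "\<dots> = ennreal (4 * J)" using J(1) by (simp flip: ennreal_plus)
      finally show ?thesis .
    qed
    have pt: "?L z
       \<le> ennreal ((2 powr a)\<^sup>2 * (4 * J)) * ?FG z" for z
    proof -
      have "ennreal (japanese (snd z) powr a) * null_convolution k F G z
         = (\<integral>\<^sup>+w. ennreal (japanese (snd z) powr a) * ennreal (\<bar>null_symbol k (z - w) w\<bar> * norm (F (z - w)) * norm (G w)) \<partial>lborel)"
        by (rule nn_integral_cmult[symmetric]) (unfold null_symbol_def, measurable)
      also have "\<dots> \<le> (\<integral>\<^sup>+w. ennreal (2 powr a * sqrt (S z w)) * ennreal (f (z - w) * g w) \<partial>lborel)"
      proof (rule nn_integral_mono)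
        fix w
        have "japanese (snd z) powr a * (\<bar>null_symbol k (z - w) w\<bar> * norm (F (z - w)) * norm (G w))
          = (japanese (snd z) powr a * \<bar>null_symbol k (z - w) w\<bar>) * (norm (F (z - w)) * norm (G w))" by simp
        also have "\<dots> \<le> (2 powr a * sqrt (S z w) * (?W (z - w) * ?W w)) * (norm (F (z - w)) * norm (G w))"
          unfolding S_def using \<theta> by (intro mult_right_mono null_symbol_bound a0) auto
        also have "\<dots> = (2 powr a * sqrt (S z w)) * (f (z - w) * g w)" by (simp add: f_def g_def)
        finally show "ennreal (japanese (snd z) powr a) * ennreal (\<bar>null_symbol k (z - w) w\<bar> * norm (F (z - w)) * norm (G w))
          \<le> ennreal (2 powr a * sqrt (S z w)) * ennreal (f (z - w) * g w)"
          using S0[of z w] fg0 by (simp add: ennreal_mult[symmetric] ennreal_leI)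
      qed
      finally have "?L z
         \<le> (\<integral>\<^sup>+w. ennreal (2 powr a * sqrt (S z w)) * ennreal (f (z - w) * g w) \<partial>lborel)\<^sup>2" by (rule power_mono) simp
      also have "\<dots> \<le> (\<integral>\<^sup>+w. (ennreal (2 powr a * sqrt (S z w)))\<^sup>2 \<partial>lborel) * (\<integral>\<^sup>+w. (ennreal (f (z - w) * g w))\<^sup>2 \<partial>lborel)"
        by (rule Cauchy_Schwarz_nn_integral) measurable
      also have "(\<integral>\<^sup>+w. (ennreal (2 powr a * sqrt (S z w)))\<^sup>2 \<partial>lborel) = ennreal ((2 powr a)\<^sup>2) * (\<integral>\<^sup>+w. ennreal (S z w) \<partial>lborel)"
      proof -
        have "(ennreal (2 powr a * sqrt (S z w)))\<^sup>2 = ennreal ((2 powr a)\<^sup>2) * ennreal (S z w)" for w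
          using S0[of z w] by (simp add: ennreal_power power_mult_distrib ennreal_mult)
        then show ?thesis by (simp add: nn_integral_cmult)
      qed
      also have "(\<integral>\<^sup>+w. (ennreal (f (z - w) * g w))\<^sup>2 \<partial>lborel) = ?FG z"
        using fg0 by (simp add: ennreal_power power_mult_distrib ennreal_mult)
      also have "ennreal ((2 powr a)\<^sup>2) * (\<integral>\<^sup>+w. ennreal (S z w) \<partial>lborel) * ?FG z
         \<le> ennreal ((2 powr a)\<^sup>2) * ennreal (4 * J) * ?FG z"
        by (intro mult_right_mono mult_left_mono Sint) auto
      finally show ?thesis using J(1) by (simp add: ennreal_mult)
    qed
    have "(\<integral>\<^sup>+z. ?L z \<partial>lborel)
      \<le> (\<integral>\<^sup>+z. ennreal ((2 powr a)\<^sup>2 * (4 * J)) * ?FG z \<partial>lborel)"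
      by (intro nn_integral_mono pt)
    also have "\<dots> = ennreal ((2 powr a)\<^sup>2 * (4 * J)) * (\<integral>\<^sup>+z. \<integral>\<^sup>+w. ennreal ((f (z - w))\<^sup>2) * ennreal ((g w)\<^sup>2) \<partial>lborel \<partial>lborel)"
      by (rule nn_integral_cmult) measurable
    also have "(\<integral>\<^sup>+z. \<integral>\<^sup>+w. ennreal ((f (z - w))\<^sup>2) * ennreal ((g w)\<^sup>2) \<partial>lborel \<partial>lborel) = (\<integral>\<^sup>+w. \<integral>\<^sup>+z. ennreal ((f (z - w))\<^sup>2) * ennreal ((g w)\<^sup>2) \<partial>lborel \<partial>lborel)"
      by (rule lborel_pair.Fubini'[symmetric]) measurable
    also have "\<dots> = (\<integral>\<^sup>+w. (\<integral>\<^sup>+z. ennreal ((f z)\<^sup>2) \<partial>lborel) * ennreal ((g w)\<^sup>2) \<partial>lborel)"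
    proof (rule nn_integral_cong)
      fix w
      have "(\<integral>\<^sup>+z. ennreal ((f (z - w))\<^sup>2) * ennreal ((g w)\<^sup>2) \<partial>lborel) = (\<integral>\<^sup>+z. ennreal ((f (z - w))\<^sup>2) \<partial>lborel) * ennreal ((g w)\<^sup>2)"
        by (rule nn_integral_multc) measurable
      also have "(\<integral>\<^sup>+z. ennreal ((f (z - w))\<^sup>2) \<partial>lborel) = (\<integral>\<^sup>+z. ennreal ((f z)\<^sup>2) \<partial>lborel)"
        by (rule nn_integral_translate_minus) measurable
      finally show "(\<integral>\<^sup>+z. ennreal ((f (z - w))\<^sup>2) * ennreal ((g w)\<^sup>2) \<partial>lborel) = (\<integral>\<^sup>+z. ennreal ((f z)\<^sup>2) \<partial>lborel) * ennreal ((g w)\<^sup>2)" .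
    qed
    also have "\<dots> = (\<integral>\<^sup>+z. ennreal ((f z)\<^sup>2) \<partial>lborel) * (\<integral>\<^sup>+w. ennreal ((g w)\<^sup>2) \<partial>lborel)"
      by (rule nn_integral_cmult) measurable
    finally show ?thesis unfolding f_def g_def by (simp only: mult.assoc)
  qed
  show ?thesis by (rule that[OF _ main]) (use J(1) in auto)
qed

section \<open>The spaces \<open>H\<close> and the null form\<close>

lemma L2_norm_square: "(L2_norm F)\<^sup>2 = square_integral F"
proof -
  let ?I = "square_integral F"
  show ?thesis
  proof (cases "?I = \<infinity>")
    case True
    then show ?thesis by (simp add: L2_norm_def)
  next
    case False
    then have "?I = ennreal (enn2real ?I)" by (simp add: less_top)
    then show ?thesis using False by (simp add: L2_norm_def ennreal_power)
  qed
qed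

lemma L2_norm_le:
  assumes "square_integral F \<le> ennreal (c\<^sup>2)" and c: "c \<ge> 0"
  shows "L2_norm F \<le> ennreal c"
proof -
  let ?I = "square_integral F"
  have fin: "?I \<noteq> \<infinity>" using assms(1) by (auto simp: top_unique)
  have "enn2real ?I \<le> c\<^sup>2" using assms(1) by (simp add: enn2real_leI)
  then have "sqrt (enn2real ?I) \<le> c" using c by (simp add: real_le_lsqrt)
  then show ?thesis using fin by (simp add: L2_norm_def ennreal_leI)
qed

lemma weight_eq: "weight k a b \<theta> z = japanese (snd z) powr a * japanese (snd z $ k) powr b
     * japanese (\<bar>fst z\<bar> - \<bar>snd z $ k\<bar>) powr \<theta>"
  by (simp add: weight_def split_beta)

lemma weight_measurable [measurable]: "weight k a b \<theta> \<in> borel_measurable borel"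
  unfolding weight_eq[abs_def] by measurable

lemma weight_nonneg: "weight k a b \<theta> z \<ge> 0"
  by (simp add: weight_eq)

lemma H_norm_density:
  assumes F: "has_density (fourier u) F"
  shows "H_norm k a b \<theta> u = L2_norm (\<lambda>z. of_real (weight k a b \<theta> z) * F z)"
proof -
  have "square_integral (\<lambda>z. of_real (weight k a b \<theta> z) * density_of (fourier u) z)
      = square_integral (\<lambda>z. of_real (weight k a b \<theta> z) * F z)"
    by (rule nn_integral_cong_AE) (use density_of_AE[OF F] in \<open>eventually_elim, simp\<close>)
  then show ?thesis using F by (auto simp: H_norm_def L2_norm_def)
qed

lemma H_norm_square:
  assumes F: "has_density (fourier u) F"
  shows "(H_norm k a b \<theta> u)\<^sup>2 = (\<integral>\<^sup>+z. ennreal ((weight k a b \<theta> z * norm (F z))\<^sup>2) \<partial>lborel)"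
  unfolding H_norm_density[OF F] L2_norm_square
  by (simp add: norm_mult weight_nonneg)

lemma inner_time: "(z :: 'n::finite spacetime) \<bullet> (1, 0) = fst z"
  by (simp add: inner_prod_def)

lemma inner_space: "(z :: 'n::finite spacetime) \<bullet> (0, axis k 1) = snd z $ k"
  by (simp add: inner_prod_def cart_eq_inner_axis)

lemma fourier_d_t_density:
  "has_density (fourier f) F \<Longrightarrow> has_density (fourier (d_t f)) (\<lambda>z. \<i> * of_real (fst z) * F z)"
  using fourier_dist_deriv_density[of f F "(1, 0)"] by (simp add: d_t_def inner_time)

lemma fourier_d_y_density:
  "has_density (fourier f) F \<Longrightarrow> has_density (fourier (d_y k f)) (\<lambda>z. \<i> * of_real (snd z $ k) * F z)"
  using fourier_dist_deriv_density[of f F "(0, axis k 1)"] by (simp add: d_y_def inner_space)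

text \<open>The energy weight is the sum of the two weights that occur in \<open>H_norm_t\<close>.\<close>

lemma energy_le_H_norm_t:
  assumes F: "has_density (fourier f) F"
  shows "energy k a \<theta> F \<le> 2 * (H_norm_t k a 1 \<theta> f)\<^sup>2"
proof -
  have [measurable]: "F \<in> borel_measurable borel" using F by (simp add: has_density_def)
  let ?A = "\<lambda>z. weight k a 1 \<theta> z * norm (F z)" and ?B = "\<lambda>z. weight k a 0 \<theta> z * (\<bar>fst z\<bar> * norm (F z))"
  have "energy k a \<theta> F
     \<le> (\<integral>\<^sup>+z. 2 * (ennreal ((?A z)\<^sup>2) + ennreal ((?B z)\<^sup>2)) \<partial>lborel)"
  proof (rule nn_integral_mono)
    fix z
    have "energy_weight k a \<theta> z * norm (F z) = ?A z + ?B z"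
      by (simp add: energy_weight_def weight_eq japanese_def[of "snd z $ k"] algebra_simps)
    then have "(energy_weight k a \<theta> z * norm (F z))\<^sup>2 \<le> 2 * ((?A z)\<^sup>2 + (?B z)\<^sup>2)"
      using sum_squares_bound[of "?A z" "?B z"] by (simp add: power2_sum)
    then have "ennreal ((energy_weight k a \<theta> z * norm (F z))\<^sup>2) \<le> ennreal (2 * ((?A z)\<^sup>2 + (?B z)\<^sup>2))" by (rule ennreal_leI)
    also have "\<dots> = 2 * (ennreal ((?A z)\<^sup>2) + ennreal ((?B z)\<^sup>2))"
      by (subst ennreal_mult) auto
    finally show "ennreal ((energy_weight k a \<theta> z * norm (F z))\<^sup>2) \<le> \<dots>" .
  qed
  also have "\<dots> = 2 * ((\<integral>\<^sup>+z. ennreal ((?A z)\<^sup>2) \<partial>lborel) + (\<integral>\<^sup>+z. ennreal ((?B z)\<^sup>2) \<partial>lborel))"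
    by (simp add: nn_integral_cmult nn_integral_add)
  also have "(\<integral>\<^sup>+z. ennreal ((?A z)\<^sup>2) \<partial>lborel) = (H_norm k a 1 \<theta> f)\<^sup>2"
    by (rule H_norm_square[OF F, symmetric])
  also have "(\<integral>\<^sup>+z. ennreal ((?B z)\<^sup>2) \<partial>lborel) = (H_norm k a 0 \<theta> (d_t f))\<^sup>2"
    unfolding H_norm_square[OF fourier_d_t_density[OF F]] by (simp add: norm_mult)
  also have "2 * ((H_norm k a 1 \<theta> f)\<^sup>2 + (H_norm k a 0 \<theta> (d_t f))\<^sup>2) \<le> 2 * (H_norm_t k a 1 \<theta> f)\<^sup>2"
    by (intro mult_left_mono) (simp_all add: H_norm_t_def power2_sum add_increasing2)
  finally show ?thesis .
qed

lemma energy_weight_ge: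
  assumes "a \<ge> 0" "\<theta> \<ge> 0"
  shows "1 + \<bar>fst z\<bar> + \<bar>snd z $ k\<bar> \<le> energy_weight k a \<theta> z"
proof -
  have "1 * ((1 + \<bar>fst z\<bar> + \<bar>snd z $ k\<bar>) * 1) \<le> energy_weight k a \<theta> z"
    unfolding energy_weight_def using assms by (intro mult_mono ge_one_powr_ge_zero) auto
  then show ?thesis by simp
qed

text \<open>The energy weight dominates both \<open>|\<tau>|\<close> and \<open>|\<xi>\<^sub>1|\<close>, as its other factors are at least \<open>1\<close>.\<close>

lemma square_integrable_derivatives:
  assumes [measurable]: "F \<in> borel_measurable borel" and a: "a \<ge> 0" "\<theta> \<ge> 0"
    and fin: "energy k a \<theta> F < \<infinity>"
  shows "square_integrable (\<lambda>z. \<i> * of_real (fst z) * F z)"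
    and "square_integrable (\<lambda>z. \<i> * of_real (snd z $ k) * F z)"
proof -
  have E: "square_integrable (\<lambda>z. of_real (energy_weight k a \<theta> z) * F z)"
    using fin by (simp add: square_integrable_def norm_mult less_imp_le[OF energy_weight_pos])
  have le: "\<bar>fst z\<bar> \<le> energy_weight k a \<theta> z" "\<bar>snd z $ k\<bar> \<le> energy_weight k a \<theta> z" for z
    using energy_weight_ge[OF a, of z k] by auto
  show "square_integrable (\<lambda>z. \<i> * of_real (fst z) * F z)"
    by (rule square_integrable_bound[OF E, where C = 1])
       (auto simp: norm_mult less_imp_le[OF energy_weight_pos] intro!: mult_right_mono le)
  show "square_integrable (\<lambda>z. \<i> * of_real (snd z $ k) * F z)"
    by (rule square_integrable_bound[OF E, where C = 1])
       (auto simp: norm_mult less_imp_le[OF energy_weight_pos] intro!: mult_right_mono le)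
qed

lemma square_integrable_reflect:
  assumes F: "square_integrable F" shows "square_integrable (\<lambda>w. F (z - w))"
proof -
  have [measurable]: "F \<in> borel_measurable borel" using F by (simp add: square_integrable_def)
  have "square_integral (\<lambda>w. F (z - w)) = square_integral F"
    by (rule nn_integral_lborel_reflect) measurable
  then show ?thesis using F by (simp add: square_integrable_def)
qed

text \<open>The two convolutions are combined before absolute values are taken, since it is their difference that
  has the null symbol.\<close>

lemma null_form_convolution_bound:
  fixes F G :: "real \<times> (real ^ 'n::finite) \<Rightarrow> complex" and k :: 'n
  defines "Ft \<equiv> \<lambda>z. \<i> * of_real (fst z) * F z" and "Fy \<equiv> \<lambda>z. \<i> * of_real (snd z $ k) * F z"
    and "Gt \<equiv> \<lambda>z. \<i> * of_real (fst z) * G z" and "Gy \<equiv> \<lambda>z. \<i> * of_real (snd z $ k) * G z"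
  assumes "square_integrable Ft" "square_integrable Fy" "square_integrable Gt" "square_integrable Gy"
  shows "ennreal (norm (convolution Ft Gt z - convolution Fy Gy z))
    \<le> null_convolution k F G z"
proof -
  have "convolution Ft Gt z - convolution Fy Gy z = (\<integral>w. Ft (z - w) * Gt w - Fy (z - w) * Gy w \<partial>lborel)"
    unfolding convolution_def
    by (rule Bochner_Integration.integral_diff[symmetric]; intro square_integrable_mult square_integrable_reflect assms)
  also have "ennreal (norm \<dots>) \<le> (\<integral>\<^sup>+w. ennreal (norm (Ft (z - w) * Gt w - Fy (z - w) * Gy w)) \<partial>lborel)"
    by (rule norm_integral_le_nn_integral)
  also have "(\<lambda>w. norm (Ft (z - w) * Gt w - Fy (z - w) * Gy w)) = (\<lambda>w. \<bar>null_symbol k (z - w) w\<bar> * norm (F (z - w)) * norm (G w))"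
  proof
    fix w
    have "Ft (z - w) * Gt w - Fy (z - w) * Gy w = - of_real (null_symbol k (z - w) w) * F (z - w) * G w"
      by (simp add: Ft_def Fy_def Gt_def Gy_def null_symbol_def algebra_simps)
    then show "norm (Ft (z - w) * Gt w - Fy (z - w) * Gy w) = \<bar>null_symbol k (z - w) w\<bar> * norm (F (z - w)) * norm (G w)"
      by (simp only: norm_mult norm_minus_cancel norm_of_real)
  qed
  finally show ?thesis .
qed

lemma Q0_fourier_density:
  fixes f g :: "'n::finite dist"
  assumes f: "has_density (fourier f) F" and g: "has_density (fourier g) G" and a: "a \<ge> 0" "\<theta> \<ge> 0"
    and F: "energy k a \<theta> F < \<infinity>"
    and G: "energy k a \<theta> G < \<infinity>"
  obtains R where "Q0_defined k f g" "tempered (Q0 k f g)" "has_density (fourier (Q0 k f g)) R"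
    "\<And>z. ennreal (norm (R z)) \<le> ennreal (1 / (gauss_mass TYPE('n spacetime))\<^sup>2) *
       null_convolution k F G z"
proof -
  let ?c = "(gauss_mass TYPE('n spacetime))\<^sup>2"
  let ?Ft = "\<lambda>z. \<i> * of_real (fst z) * F z" and ?Fy = "\<lambda>z. \<i> * of_real (snd z $ k) * F z"
    and ?Gt = "\<lambda>z. \<i> * of_real (fst z) * G z" and ?Gy = "\<lambda>z. \<i> * of_real (snd z $ k) * G z"
  have [measurable]: "F \<in> borel_measurable borel" "G \<in> borel_measurable borel" using f g by (auto simp: has_density_def)
  note sF = square_integrable_derivatives[OF _ a F] and sG = square_integrable_derivatives[OF _ a G]
  obtain p where p: "dist_mult_defined (d_t f) (d_t g)" "integrable lborel p"
    "\<And>\<phi>. \<phi> \<in> schwartz \<Longrightarrow> dist_mult (d_t f) (d_t g) \<phi> = (\<integral>x. p x * \<phi> x \<partial>lborel)"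
    "has_density (fourier (dist_mult (d_t f) (d_t g))) (\<lambda>z. convolution ?Ft ?Gt z / of_real ?c)"
    using dist_mult_square_integrable[OF fourier_d_t_density[OF f] sF(1) fourier_d_t_density[OF g] sG(1)] by auto
  obtain q where q: "dist_mult_defined (d_y k f) (d_y k g)" "integrable lborel q"
    "\<And>\<phi>. \<phi> \<in> schwartz \<Longrightarrow> dist_mult (d_y k f) (d_y k g) \<phi> = (\<integral>x. q x * \<phi> x \<partial>lborel)"
    "has_density (fourier (dist_mult (d_y k f) (d_y k g))) (\<lambda>z. convolution ?Fy ?Gy z / of_real ?c)"
    using dist_mult_square_integrable[OF fourier_d_y_density[OF f] sF(2) fourier_d_y_density[OF g] sG(2)] by auto
  define R where "R z = convolution ?Ft ?Gt z / of_real ?c - convolution ?Fy ?Gy z / of_real ?c" for z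
  have "tempered (Q0 k f g)"
  proof (rule tempered_if_integrable_density[of "\<lambda>x. p x - q x"])
    fix \<phi> :: "'n spacetime \<Rightarrow> complex" assume \<phi>: "\<phi> \<in> schwartz"
    show "Q0 k f g \<phi> = (\<integral>x. (p x - q x) * \<phi> x \<partial>lborel)"
      using integrable_mult_schwartz[OF p(2) \<phi>] integrable_mult_schwartz[OF q(2) \<phi>]
      by (simp add: Q0_def p(3)[OF \<phi>] q(3)[OF \<phi>] left_diff_distrib)
  qed (use p q in auto)
  moreover have "has_density (fourier (Q0 k f g)) R"
  proof -
    have "integrable lborel (\<lambda>x. R x * \<phi> x) \<and> fourier (Q0 k f g) \<phi> = (\<integral>x. R x * \<phi> x \<partial>lborel)" if \<phi>: "\<phi> \<in> schwartz" for \<phi>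
      using bspec[OF conjunct2[OF p(4)[unfolded has_density_def]] \<phi>] bspec[OF conjunct2[OF q(4)[unfolded has_density_def]] \<phi>]
      unfolding R_def left_diff_distrib by (simp add: fourier_def Q0_def)
    moreover have "R \<in> borel_measurable borel" unfolding R_def by measurable
    ultimately show ?thesis by (simp add: has_density_def)
  qed
  moreover have "ennreal (norm (R z)) \<le> ennreal (1 / ?c) *
       null_convolution k F G z" for z
  proof -
    have "norm (R z) = 1 / ?c * norm (convolution ?Ft ?Gt z - convolution ?Fy ?Gy z)"
      by (simp add: R_def diff_divide_distrib[symmetric] norm_divide norm_power)
    then have "ennreal (norm (R z)) = ennreal (1 / ?c * norm (convolution ?Ft ?Gt z - convolution ?Fy ?Gy z))" by (rule arg_cong)
    also have "\<dots> = ennreal (1 / ?c) * ennreal (norm (convolution ?Ft ?Gt z - convolution ?Fy ?Gy z))"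
      by (rule ennreal_mult') simp
    also have "\<dots> \<le> ennreal (1 / ?c) * null_convolution k F G z"
      by (intro mult_left_mono null_form_convolution_bound sF sG) auto
    finally show ?thesis .
  qed
  ultimately show ?thesis using p(1) q(1) by (intro that[of R]) (auto simp: Q0_defined_def)
qed

text \<open>All truncations of a null density have the inverse transform zero.\<close>

lemma fourier_density_zero:
  fixes u :: "('a::euclidean_space \<Rightarrow> complex) \<Rightarrow> complex"
  assumes u: "has_density (fourier u) H" and H: "AE x in lborel. H x = 0"
  shows "has_density u (\<lambda>x. 0)"
proof -
  have [measurable]: "H \<in> borel_measurable borel" using u by (simp add: has_density_def)
  have "square_integral H = 0"
    by (subst nn_integral_0_iff_AE) (use H in auto)
  then have sH: "square_integrable H" by (simp add: square_integrable_def)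
  have s0: "square_integrable (\<lambda>x::'a. 0)" by (simp add: square_integrable_def)
  have "fourier_fun (cutoff r H) x = 0" for r x
    unfolding fourier_fun_wave
    by (rule integral_eq_zero_AE) (use H in \<open>eventually_elim, simp add: cutoff_def\<close>)
  then have "fourier_limit H (\<lambda>x. 0)"
    unfolding fourier_limit_def using s0 filterlim_real_sequentially
    by (intro conjI exI[of _ real] exI[of _ "\<lambda>x. 0"]) auto
  from has_density_from_fourier[OF u sH this] show ?thesis by simp
qed

lemma dist_mult_zero:
  assumes u: "has_density u (\<lambda>x. 0)"
  shows "dist_mult u v \<phi> = 0" "dist_mult v u \<phi> = 0"
proof -
  have "(\<integral>x. density_of u x * density_of v x * \<phi> x \<partial>lborel) = 0"
    by (rule integral_eq_zero_AE) (use density_of_AE[OF u] in \<open>eventually_elim, simp\<close>)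
  then show "dist_mult u v \<phi> = 0" by (simp add: dist_mult_def)
  have "(\<integral>x. density_of v x * density_of u x * \<phi> x \<partial>lborel) = 0"
    by (rule integral_eq_zero_AE) (use density_of_AE[OF u] in \<open>eventually_elim, simp\<close>)
  then show "dist_mult v u \<phi> = 0" by (simp add: dist_mult_def)
qed

text \<open>The energy weight is positive, so the Fourier transform of \<open>f\<close> vanishes almost everywhere.\<close>

lemma derivatives_zero_if_H_norm_t_zero:
  assumes f: "has_density (fourier f) F" and zero: "H_norm_t k a 1 \<theta> f = 0"
  shows "has_density (d_t f) (\<lambda>x. 0)" "has_density (d_y k f) (\<lambda>x. 0)"
proof -
  have [measurable]: "F \<in> borel_measurable borel" using f by (auto simp: has_density_def)
  have "energy k a \<theta> F = 0"
    using energy_le_H_norm_t[OF f, of k a \<theta>] zero by simp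
  then have "AE z in lborel. ennreal ((energy_weight k a \<theta> z * norm (F z))\<^sup>2) = 0"
    by (subst (asm) nn_integral_0_iff_AE) auto
  then have F0: "AE z in lborel. F z = 0"
  proof eventually_elim
    case (elim z)
    then have "(energy_weight k a \<theta> z * norm (F z))\<^sup>2 = 0" by (simp only: ennreal_eq_0_iff) (simp add: power2_less_eq_zero_iff)
    then show ?case using energy_weight_pos[of k a \<theta> z] by simp
  qed
  show "has_density (d_t f) (\<lambda>x. 0)"
    by (rule fourier_density_zero[OF fourier_d_t_density[OF f]]) (use F0 in \<open>eventually_elim, simp\<close>)
  show "has_density (d_y k f) (\<lambda>x. 0)"
    by (rule fourier_density_zero[OF fourier_d_y_density[OF f]]) (use F0 in \<open>eventually_elim, simp\<close>)
qed

lemma H_space_density: "f \<in> H_space k a b \<theta> \<Longrightarrow> \<exists>F. has_density (fourier f) F"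
  by (rule ccontr) (simp add: H_space_def H_norm_def)

lemma H_norm_zero: "H_norm k a b \<theta> (\<lambda>\<phi>. 0) = 0"
proof -
  have "has_density (fourier (\<lambda>\<phi>. 0)) (\<lambda>x::'n::finite spacetime. 0)" by (simp add: has_density_def fourier_def)
  from H_norm_density[OF this] show ?thesis by (simp add: L2_norm_def)
qed

text \<open>This covers the case that one norm vanishes and the other one is infinite, where the right-hand side of the
  estimate is \<open>0\<close>. The products may then be undefined, but the default value of \<open>dist_mult\<close> is \<open>0\<close> too.\<close>

lemma Q0_zero:
  assumes "has_density (fourier f) F" "has_density (fourier g) G"
    and "H_norm_t k a 1 \<theta> f = 0 \<or> H_norm_t k a 1 \<theta> g = 0"
  shows "Q0 k f g = (\<lambda>\<phi>. 0)"
  using assms(3)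
proof
  assume "H_norm_t k a 1 \<theta> f = 0"
  from derivatives_zero_if_H_norm_t_zero[OF assms(1) this] show ?thesis
    by (simp add: Q0_def dist_mult_zero)
next
  assume "H_norm_t k a 1 \<theta> g = 0"
  from derivatives_zero_if_H_norm_t_zero[OF assms(2) this] show ?thesis
    by (simp add: Q0_def dist_mult_zero)
qed

theorem lemma4p1:
  fixes k :: "'n::finite" and s \<theta> :: real
  assumes "CARD('n) \<ge> 2"
    and "s > (real CARD('n) + 1) / 2"
    and "1 / 2 < \<theta>" and "\<theta> < 1"
  shows "\<exists>C::real. C > 0 \<and>
    (\<forall>f \<in> H_space k (s - 1) 1 \<theta>. \<forall>g \<in> H_space k (s - 1) 1 \<theta>.
       (H_norm_t k (s - 1) 1 \<theta> f < \<infinity> \<and> H_norm_t k (s - 1) 1 \<theta> g < \<infinity> \<longrightarrow>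
          Q0_defined k f g \<and> tempered (Q0 k f g)) \<and>
       H_norm k (s - 1) 0 0 (Q0 k f g)
         \<le> ennreal C * H_norm_t k (s - 1) 1 \<theta> f * H_norm_t k (s - 1) 1 \<theta> g)"
proof -
  define a where "a = s - 1"
  have a: "2 * a > real CARD('n) - 1" using assms(2) by (simp add: a_def field_simps)
  then have a0: "a \<ge> 0" and \<theta>0: "\<theta> \<ge> 0" using assms by auto
  let ?N = "H_norm_t k a 1 \<theta>"
  define c where "c = (gauss_mass TYPE('n spacetime))\<^sup>2"
  have c: "c > 0" using gauss_mass_pos[where 'a = "'n spacetime"] by (simp add: c_def)
  let ?E = "\<lambda>F :: 'n spacetime \<Rightarrow> complex. energy k a \<theta> F"
  obtain D where D: "D \<ge> 0"
    and est: "\<And>(F :: 'n spacetime \<Rightarrow> complex) (G :: 'n spacetime \<Rightarrow> complex). F \<in> borel_measurable borel \<Longrightarrow> G \<in> borel_measurable borel \<Longrightarrow>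
     (\<integral>\<^sup>+z. (ennreal (japanese (snd z) powr a) * null_convolution k F G z)\<^sup>2 \<partial>lborel)
     \<le> ennreal D * ?E F * ?E G"
    using null_form_estimate[OF assms(1) a assms(3) less_imp_le[OF assms(4)]] by blast
  \<comment> \<open>The factor \<open>2\<close> comes from \<open>energy_le_H_norm_t\<close>, used for \<open>f\<close> and for \<open>g\<close>; \<open>1 / c\<close> normalises the inverse transform.\<close>
  define C0 where "C0 = 2 * sqrt D / c"
  have C0: "C0 \<ge> 0" using D c by (simp add: C0_def)
  have finite_case: "Q0_defined k f g \<and> tempered (Q0 k f g) \<and> H_norm k a 0 0 (Q0 k f g) \<le> ennreal C0 * ?N f * ?N g"
    if f: "has_density (fourier f) F" and g: "has_density (fourier g) G" and fin: "?N f < \<infinity>" "?N g < \<infinity>" for f g F G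
  proof -
    have [measurable]: "F \<in> borel_measurable borel" "G \<in> borel_measurable borel" using f g by (auto simp: has_density_def)
    define nf where "nf = enn2real (?N f)"
    define ng where "ng = enn2real (?N g)"
    have nf: "?N f = ennreal nf" "nf \<ge> 0" and ng: "?N g = ennreal ng" "ng \<ge> 0"
      using fin by (simp_all add: nf_def ng_def)
    have EF: "?E F \<le> ennreal (2 * nf\<^sup>2)" and EG: "?E G \<le> ennreal (2 * ng\<^sup>2)"
      using energy_le_H_norm_t[OF f, of k a \<theta>] energy_le_H_norm_t[OF g, of k a \<theta>] nf ng
      by (simp_all add: ennreal_mult ennreal_power)
    have Efin: "?E F < \<infinity>" "?E G < \<infinity>" using le_less_trans[OF EF] le_less_trans[OF EG] by auto
    obtain R where R: "Q0_defined k f g" "tempered (Q0 k f g)" "has_density (fourier (Q0 k f g)) R"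
      "\<And>z. ennreal (norm (R z)) \<le> ennreal (1 / c) *
       null_convolution k F G z"
      unfolding c_def using Q0_fourier_density[OF f g a0 \<theta>0 Efin] by blast
    let ?I = "\<lambda>z. null_convolution k F G z"
    have [measurable]: "?I \<in> borel_measurable borel" unfolding null_symbol_def by measurable
    have "square_integral (\<lambda>z. of_real (weight k a 0 0 z) * R z)
        \<le> (\<integral>\<^sup>+z. ennreal ((1 / c)\<^sup>2) * (ennreal (japanese (snd z) powr a) * ?I z)\<^sup>2 \<partial>lborel)"
    proof (rule nn_integral_mono)
      fix z
      have "ennreal ((norm (of_real (weight k a 0 0 z) * R z))\<^sup>2) = (ennreal (japanese (snd z) powr a) * ennreal (norm (R z)))\<^sup>2"
        by (simp add: weight_eq norm_mult ennreal_power[symmetric] ennreal_mult)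
      also have "\<dots> \<le> (ennreal (japanese (snd z) powr a) * (ennreal (1 / c) * ?I z))\<^sup>2"
        by (intro power_mono mult_left_mono R) auto
      also have "\<dots> = ennreal ((1 / c)\<^sup>2) * (ennreal (japanese (snd z) powr a) * ?I z)\<^sup>2"
        using c by (simp add: ennreal_power[symmetric] power_mult_distrib mult_ac)
      finally show "ennreal ((norm (of_real (weight k a 0 0 z) * R z))\<^sup>2) \<le> \<dots>" .
    qed
    also have "\<dots> = ennreal ((1 / c)\<^sup>2) * (\<integral>\<^sup>+z. (ennreal (japanese (snd z) powr a) * ?I z)\<^sup>2 \<partial>lborel)"
      by (rule nn_integral_cmult) measurable
    also have "\<dots> \<le> ennreal ((1 / c)\<^sup>2) * (ennreal D * ?E F * ?E G)"
      by (intro mult_left_mono est) auto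
    also have "\<dots> \<le> ennreal ((1 / c)\<^sup>2) * (ennreal D * ennreal (2 * nf\<^sup>2) * ennreal (2 * ng\<^sup>2))"
      by (intro mult_left_mono mult_mono EF EG) auto
    also have "\<dots> = ennreal ((C0 * nf * ng)\<^sup>2)"
      using D c by (simp add: ennreal_mult[symmetric] C0_def power_mult_distrib power_divide)
    finally have "H_norm k a 0 0 (Q0 k f g) \<le> ennreal (C0 * nf * ng)"
      unfolding H_norm_density[OF R(3)] using C0 nf(2) ng(2) by (intro L2_norm_le) auto
    then show ?thesis using R(1,2) C0 nf ng by (simp add: ennreal_mult)
  qed
  have "(?N f < \<infinity> \<and> ?N g < \<infinity> \<longrightarrow> Q0_defined k f g \<and> tempered (Q0 k f g)) \<and>
       H_norm k a 0 0 (Q0 k f g) \<le> ennreal (C0 + 1) * ?N f * ?N g"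
    if fg: "f \<in> H_space k a 1 \<theta>" "g \<in> H_space k a 1 \<theta>" for f g
  proof -
    obtain F where F: "has_density (fourier f) F" using H_space_density[OF fg(1)] by blast
    obtain G where G: "has_density (fourier g) G" using H_space_density[OF fg(2)] by blast
    consider (fin) "?N f \<noteq> \<infinity>" "?N g \<noteq> \<infinity>" | (zero) "?N f = 0 \<or> ?N g = 0" "?N f = \<infinity> \<or> ?N g = \<infinity>"
      | (inf) "?N f \<noteq> 0" "?N g \<noteq> 0" "?N f = \<infinity> \<or> ?N g = \<infinity>" by blast
    then show ?thesis
    proof cases
      case fin
      then have fin: "?N f < \<infinity>" "?N g < \<infinity>" by (simp_all add: less_top)
      have "ennreal C0 * ?N f * ?N g \<le> ennreal (C0 + 1) * ?N f * ?N g"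
        using C0 by (intro mult_right_mono ennreal_leI) auto
      then show ?thesis using finite_case[OF F G fin] by (auto intro: order_trans)
    next
      case zero
      then show ?thesis using Q0_zero[OF F G zero(1)] zero(2) by (auto simp: H_norm_zero)
    next
      case inf
      then have "ennreal (C0 + 1) * ?N f * ?N g = \<infinity>"
        using C0 by (auto simp: ennreal_mult_eq_top_iff ennreal_eq_0_iff)
      then show ?thesis using inf by auto
    qed
  qed
  \<comment> \<open>Adding \<open>1\<close> makes the constant positive.\<close>
  then show ?thesis using C0 unfolding a_def by (intro exI[of _ "C0 + 1"]) auto
qed

end
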